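(* Given a sorted input $x_1\le \dots \le x_n$ of real numbers and a real number $\lambda \ge 0$, an optimal regularized 1D $k$-Means clustering, i.e. a pair $(k,\mathcal{M})$ with $k\ge 1$ and $\mathcal{M}=\{\mu_1,\dots,\mu_k\}\subset\mathbb{R}$ attaining $$\min_{k,\ \mathcal{M}=\{\mu_1,\dots,\mu_k\}} \sum_{\ell=1}^n \min_{\mu\in\mathcal{M}}(x_\ell-\mu)^2 + \lambda k,$$ can be computed in $O(n)$ time.
   Context: Model of computation: a real RAM in which arithmetic operations and comparisons on real numbers take constant time. *)

theory Defs
  imports Complex_Main "HOL-Library.Landau_Symbols"
begin

section \<open>A real RAM\<close>

text \<open>
  A program is a finite list of instructions. It works on real-valued registers, addressed directly
  by the program text, and on a real-valued memory, addressed indirectly: \<open>Load a b\<close> and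
  \<open>Store a b\<close> use the content of a register as an address. Constants in the program text are
  integers, and there is no rounding operation.
\<close>

datatype instr =
    Const nat int
  | Move nat nat
  | Add nat nat nat
  | Sub nat nat nat
  | Mul nat nat nat
  | Div nat nat nat
  | Load nat nat          \<comment> \<open>\<open>Load a b\<close>: register \<open>a\<close> := memory cell at the address in register \<open>b\<close>\<close>
  | Store nat nat         \<comment> \<open>\<open>Store a b\<close>: memory cell at the address in register \<open>a\<close> := register \<open>b\<close>\<close>
  | Jump nat
  | Jump_less nat nat nat \<comment> \<open>jump to the position given last if the comparison holds\<close>
  | Jump_le nat nat nat
  | Jump_eq nat nat nat
  | Halt

type_synonym program = "instr list"

record config =
  pc :: nat
  reg :: "nat \<Rightarrow> real"
  mem :: "nat \<Rightarrow> real"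

definition set_reg :: "nat \<Rightarrow> real \<Rightarrow> config \<Rightarrow> config" where
  "set_reg a v s = s\<lparr>pc := Suc (pc s), reg := (reg s)(a := v)\<rparr>"

definition set_mem :: "nat \<Rightarrow> real \<Rightarrow> config \<Rightarrow> config" where
  "set_mem i v s = s\<lparr>pc := Suc (pc s), mem := (mem s)(i := v)\<rparr>"

definition branch :: "bool \<Rightarrow> nat \<Rightarrow> config \<Rightarrow> config" where
  "branch b l s = s\<lparr>pc := (if b then l else Suc (pc s))\<rparr>"

text \<open>
  The result \<open>None\<close> means that there is no next configuration. Apart from \<open>Halt\<close> this happens on a
  fault: a division by zero, or an address that is not a natural number.
\<close>

fun exec :: "instr \<Rightarrow> config \<Rightarrow> config option" where
  "exec (Const a c) s = Some (set_reg a (real_of_int c) s)"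
| "exec (Move a b) s = Some (set_reg a (reg s b) s)"
| "exec (Add a b c) s = Some (set_reg a (reg s b + reg s c) s)"
| "exec (Sub a b c) s = Some (set_reg a (reg s b - reg s c) s)"
| "exec (Mul a b c) s = Some (set_reg a (reg s b * reg s c) s)"
| "exec (Div a b c) s = (if reg s c = 0 then None else Some (set_reg a (reg s b / reg s c) s))"
| "exec (Load a b) s =
     (if reg s b \<in> \<nat> then Some (set_reg a (mem s (nat \<lfloor>reg s b\<rfloor>)) s) else None)"
| "exec (Store a b) s =
     (if reg s a \<in> \<nat> then Some (set_mem (nat \<lfloor>reg s a\<rfloor>) (reg s b) s) else None)"
| "exec (Jump l) s = Some (branch True l s)"
| "exec (Jump_less a b l) s = Some (branch (reg s a < reg s b) l s)"
| "exec (Jump_le a b l) s = Some (branch (reg s a \<le> reg s b) l s)"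
| "exec (Jump_eq a b l) s = Some (branch (reg s a = reg s b) l s)"
| "exec Halt s = None"

text \<open>Every step has unit cost, so the running time is the number of steps.\<close>

definition step :: "program \<Rightarrow> config \<Rightarrow> config \<Rightarrow> bool" where
  "step P s s' \<longleftrightarrow> pc s < length P \<and> exec (P ! pc s) s = Some s'"

definition halted :: "program \<Rightarrow> config \<Rightarrow> bool" where
  "halted P s \<longleftrightarrow> pc s < length P \<and> P ! pc s = Halt"

text \<open>A jump outside the program leads to a configuration that can neither step nor is halted.\<close>

definition halts_within :: "program \<Rightarrow> config \<Rightarrow> nat \<Rightarrow> config \<Rightarrow> bool" where
  "halts_within P s T s' \<longleftrightarrow> (\<exists>t\<le>T. (step P ^^ t) s s' \<and> halted P s')"


section \<open>Regularized 1D k-means\<close>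

definition kmeans_cost :: "real list \<Rightarrow> real \<Rightarrow> nat \<times> real set \<Rightarrow> real" where
  "kmeans_cost xs lam = (\<lambda>(k, M).
     (\<Sum>l<length xs. Min ((\<lambda>mu. (xs ! l - mu)\<^sup>2) ` M)) + lam * real k)"

definition clustering :: "nat \<times> real set \<Rightarrow> bool" where
  "clustering = (\<lambda>(k, M). k \<ge> 1 \<and> finite M \<and> card M = k)"

definition optimal_clustering :: "real list \<Rightarrow> real \<Rightarrow> nat \<times> real set \<Rightarrow> bool" where
  "optimal_clustering xs lam = is_arg_min (kmeans_cost xs lam) clustering"

text \<open>
  Input: register 0 holds the number of points, register 1 holds the regularization parameter, and
  the points occupy an initial segment of the memory. Output: register 0 holds the number of
  centres, and the centres occupy an initial segment of the memory.
\<close>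

definition input_config :: "real list \<Rightarrow> real \<Rightarrow> config" where
  "input_config xs lam =
     \<lparr>pc = 0,
      reg = (\<lambda>_. 0)(0 := real (length xs), 1 := lam),
      mem = (\<lambda>i. if i < length xs then xs ! i else 0)\<rparr>"

definition outputs :: "config \<Rightarrow> nat \<times> real set \<Rightarrow> bool" where
  "outputs s = (\<lambda>(k, M). reg s 0 = real k \<and> M = mem s ` {..<k})"

end

theory Submission
  imports Defs
begin

text \<open>
  An optimal clustering of sorted points consists of segments, each with its mean as centre. With
  \<open>w i j\<close> the sum of squared deviations of the points \<open>x\<^sub>i, \<dots>, x\<^bsub>j-1\<^esub>\<close> from their mean, the optimal cost
  of a prefix satisfies \<open>E j = (MIN i<j. E i + w i j + \<lambda>)\<close>. The weight satisfies the quadrangle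
  inequality, so the matrix \<open>E i + w i j\<close> is totally monotone: once a later start \<open>b\<close> beats an earlier
  start \<open>a\<close> for some \<open>j\<close>, it does so for all larger \<open>j\<close>.

  Wilber's algorithm solves this recurrence in linear time. Suppose that \<open>E\<close> is known up to \<open>c\<close>, and
  that columns below \<open>r\<close> are no longer needed. The SMAWK algorithm finds the row minima for the next
  \<open>c + 1 - r\<close> rows over the columns \<open>r, \<dots>, c\<close>. They are tentative values of \<open>E\<close>, and a second run of
  SMAWK uses them as columns. If no row improves, all tentative values are correct, and \<open>c\<close> advances by
  \<open>c + 1 - r\<close>. Otherwise the values up to the first improved row are correct, and the improving column
  beats the columns up to \<open>c\<close> from there on, so \<open>r\<close> advances by \<open>c + 1 - r\<close>. In both cases this pays
  for the round.

  The algorithm is written in a small structured language, whose compiler to the real RAM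
  preserves running time up to a constant factor.
\<close>

section \<open>A structured language on the real RAM\<close>

text \<open>Three obstacles shape the proof. Entries of the matrix with \<open>i\<close> not below
  \<open>j\<close> mean nothing; \<open>better\<close> never lets such a column win and leaves ties
  to the earlier column, so every row has a definite leftmost optimum. The second run of SMAWK works
  with values that may be wrong; but the quadrangle inequality concerns \<open>sse\<close> alone,
  and constants added to whole columns cancel, so the run itself is sound for any values. Finally,
  SMAWK is recursive and the machine is not: the rows of a level are the multiples of a power of two
  counted from \<open>base\<close>, so a stride describes a level, its surviving columns form a
  segment of one array, and two loops go down and up the levels.

  A set of centres may serve the points in any way, and its size must be exactly \<open>k\<close>.
  Hence the lower bound is proved for arbitrary finite sets of centres, and the means that the
  program writes must be made distinct.

  Time bounds are credits handed along the run. Their constants are generous and chosen so that the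
  inductions close.\<close>

datatype nvar = Vc | Vr | Vp | Vi | Vj | Vbase | Vlast | Vlo | Vhi | Vk | Vh | Vinp | Vbot | Vtop
  | Vrow | Vcol | Vpos | Vend | Vbest | Vlim

datatype narr = COL | SEG | STRIDE | ARG | BEST

datatype rarr = PTS | PSUM | PSQ | OPT

datatype nexp = Num nat | Len | Var nvar | Plus nexp nexp | Minus nexp nexp | NAt narr nexp

datatype rexp = RNum int | Lam | OfNat nexp | RPlus rexp rexp | RMinus rexp rexp
  | RTimes rexp rexp | RDivide rexp rexp | RAt rarr nexp

datatype bexp = NLess nexp nexp | RLess rexp rexp | Not bexp | And bexp bexp

datatype cmd = Skip | NAssign nvar nexp | NStore narr nexp nexp | RStore rarr nexp rexp
  | Seq cmd cmd (infixr ";;" 60) | If bexp cmd cmd | While bexp cmd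

record state =
  nv :: "nvar \<Rightarrow> nat"
  na :: "narr \<Rightarrow> nat \<Rightarrow> nat"
  ra :: "rarr \<Rightarrow> nat \<Rightarrow> real"

locale machine =
  fixes N :: nat and lam :: real
begin

primrec neval :: "nexp \<Rightarrow> state \<Rightarrow> nat" where
  "neval (Num c) s = c"
| "neval Len s = N"
| "neval (Var v) s = nv s v"
| "neval (Plus a b) s = neval a s + neval b s"
| "neval (Minus a b) s = neval a s - neval b s"
| "neval (NAt a e) s = na s a (neval e s)"

text \<open>Registers hold reals, so truncated subtraction agrees with the machine's
  \<open>Sub\<close> only while the result is not negative; a negative address would be a
  fault.\<close>

primrec ndef :: "nexp \<Rightarrow> state \<Rightarrow> bool" where
  "ndef (Num c) s = True"
| "ndef Len s = True"
| "ndef (Var v) s = True"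
| "ndef (Plus a b) s = (ndef a s \<and> ndef b s)"
| "ndef (Minus a b) s = (ndef a s \<and> ndef b s \<and> neval b s \<le> neval a s)"
| "ndef (NAt a e) s = ndef e s"

primrec reval :: "rexp \<Rightarrow> state \<Rightarrow> real" where
  "reval (RNum c) s = real_of_int c"
| "reval Lam s = lam"
| "reval (OfNat e) s = real (neval e s)"
| "reval (RPlus a b) s = reval a s + reval b s"
| "reval (RMinus a b) s = reval a s - reval b s"
| "reval (RTimes a b) s = reval a s * reval b s"
| "reval (RDivide a b) s = reval a s / reval b s"
| "reval (RAt a e) s = ra s a (neval e s)"

text \<open>Division by zero is a fault. The bound on \<open>PTS\<close> protects the layout: the
  points fill the cells below \<open>N\<close>, and all other arrays live behind them.\<close>

primrec rdef :: "rexp \<Rightarrow> state \<Rightarrow> bool" where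
  "rdef (RNum c) s = True"
| "rdef Lam s = True"
| "rdef (OfNat e) s = ndef e s"
| "rdef (RPlus a b) s = (rdef a s \<and> rdef b s)"
| "rdef (RMinus a b) s = (rdef a s \<and> rdef b s)"
| "rdef (RTimes a b) s = (rdef a s \<and> rdef b s)"
| "rdef (RDivide a b) s = (rdef a s \<and> rdef b s \<and> reval b s \<noteq> 0)"
| "rdef (RAt a e) s = (ndef e s \<and> (a = PTS \<longrightarrow> neval e s < N))"

primrec beval :: "bexp \<Rightarrow> state \<Rightarrow> bool" where
  "beval (NLess a b) s = (neval a s < neval b s)"
| "beval (RLess a b) s = (reval a s < reval b s)"
| "beval (Not b) s = (\<not> beval b s)"
| "beval (And a b) s = (beval a s \<and> beval b s)"

text \<open>Conjunction stops at a false left operand, so a guard there can make the right operand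
  safe: a stack is tested for emptiness before its top is read.\<close>

primrec bdef :: "bexp \<Rightarrow> state \<Rightarrow> bool" where
  "bdef (NLess a b) s = (ndef a s \<and> ndef b s)"
| "bdef (RLess a b) s = (rdef a s \<and> rdef b s)"
| "bdef (Not b) s = bdef b s"
| "bdef (And a b) s = (bdef a s \<and> (beval a s \<longrightarrow> bdef b s))"

abbreviation nupd :: "nvar \<Rightarrow> nat \<Rightarrow> state \<Rightarrow> state" where
  "nupd v x s \<equiv> s\<lparr>nv := (nv s)(v := x)\<rparr>"

abbreviation naupd :: "narr \<Rightarrow> nat \<Rightarrow> nat \<Rightarrow> state \<Rightarrow> state" where
  "naupd a i x s \<equiv> s\<lparr>na := (na s)(a := (na s a)(i := x))\<rparr>"

abbreviation raupd :: "rarr \<Rightarrow> nat \<Rightarrow> real \<Rightarrow> state \<Rightarrow> state" where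
  "raupd a i x s \<equiv> s\<lparr>ra := (ra s)(a := (ra s a)(i := x))\<rparr>"

inductive run :: "cmd \<Rightarrow> state \<Rightarrow> nat \<Rightarrow> state \<Rightarrow> bool" where
  run_Skip: "run Skip s 0 s"
| run_NAssign: "ndef e s \<Longrightarrow> run (NAssign v e) s (Suc 0) (nupd v (neval e s) s)"
| run_NStore: "ndef i s \<Longrightarrow> ndef e s \<Longrightarrow> run (NStore a i e) s (Suc 0) (naupd a (neval i s) (neval e s) s)"
| run_RStore: "ndef i s \<Longrightarrow> rdef e s \<Longrightarrow> (a = PTS \<longrightarrow> neval i s < N) \<Longrightarrow>
    run (RStore a i e) s (Suc 0) (raupd a (neval i s) (reval e s) s)"
| run_Seq: "run c s t s' \<Longrightarrow> run d s' t' s'' \<Longrightarrow> run (c ;; d) s (t + t') s''"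
| run_If: "bdef b s \<Longrightarrow> run (if beval b s then c else d) s t s' \<Longrightarrow> run (If b c d) s (Suc t) s'"
| run_While_False: "bdef b s \<Longrightarrow> \<not> beval b s \<Longrightarrow> run (While b c) s (Suc 0) s"
| run_While_True: "bdef b s \<Longrightarrow> beval b s \<Longrightarrow> run c s t s' \<Longrightarrow> run (While b c) s' t' s'' \<Longrightarrow>
    run (While b c) s (Suc (t + t')) s''"

inductive_cases run_SkipE: "run Skip s t s'"
inductive_cases run_NAssignE: "run (NAssign v e) s t s'"
inductive_cases run_NStoreE: "run (NStore a i e) s t s'"
inductive_cases run_RStoreE: "run (RStore a i e) s t s'"
inductive_cases run_SeqE: "run (c ;; d) s t s'"
inductive_cases run_IfE: "run (If b c d) s t s'"

text \<open>The number \<open>t\<close> is a time credit: a run pays for its cost, and the postcondition sees the rest.\<close>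

definition wp :: "cmd \<Rightarrow> (state \<Rightarrow> nat \<Rightarrow> bool) \<Rightarrow> state \<Rightarrow> nat \<Rightarrow> bool" where
  "wp c Q s t \<longleftrightarrow> (\<exists>u s'. u \<le> t \<and> run c s u s' \<and> Q s' (t - u))"

lemma wp_Skip [simp]: "wp Skip Q s t \<longleftrightarrow> Q s t"
  unfolding wp_def by (auto intro!: exI[of _ 0] run_Skip elim: run_SkipE)

lemma wp_NAssign [simp]:
  "wp (NAssign v e) Q s t \<longleftrightarrow> ndef e s \<and> 1 \<le> t \<and> Q (nupd v (neval e s) s) (t - 1)"
  unfolding wp_def by (auto intro!: exI[of _ "Suc 0"] run_NAssign elim!: run_NAssignE)

lemma wp_NStore [simp]:
  "wp (NStore a i e) Q s t \<longleftrightarrow>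
     ndef i s \<and> ndef e s \<and> 1 \<le> t \<and> Q (naupd a (neval i s) (neval e s) s) (t - 1)"
  unfolding wp_def by (auto intro!: exI[of _ "Suc 0"] run_NStore elim!: run_NStoreE)

lemma wp_RStore [simp]:
  "wp (RStore a i e) Q s t \<longleftrightarrow>
     ndef i s \<and> rdef e s \<and> (a = PTS \<longrightarrow> neval i s < N) \<and> 1 \<le> t \<and>
     Q (raupd a (neval i s) (reval e s) s) (t - 1)"
  unfolding wp_def by (auto intro!: exI[of _ "Suc 0"] run_RStore elim!: run_RStoreE)

lemma wp_Seq [simp]: "wp (c ;; d) Q = wp c (wp d Q)"
proof (intro ext iffI)
  fix s t assume "wp (c ;; d) Q s t"
  then show "wp c (wp d Q) s t"
    unfolding wp_def
    by (elim exE conjE run_SeqE) (metis add_leD1 add_le_imp_le_diff add.commute diff_diff_left)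
next
  fix s t assume "wp c (wp d Q) s t"
  then obtain u s' u' s'' where "u \<le> t" "run c s u s'" "u' \<le> t - u" "run d s' u' s''"
      "Q s'' (t - u - u')"
    unfolding wp_def by blast
  then show "wp (c ;; d) Q s t"
    unfolding wp_def by (intro exI[of _ "u + u'"] exI[of _ s'']) (auto intro: run_Seq)
qed

lemma wp_If [simp]:
  "wp (If b c d) Q s t \<longleftrightarrow> bdef b s \<and> 1 \<le> t \<and> wp (if beval b s then c else d) Q s (t - 1)"
proof
  assume "wp (If b c d) Q s t"
  then obtain u s' where "u \<le> t" "run (If b c d) s u s'" "Q s' (t - u)"
    unfolding wp_def by blast
  then show "bdef b s \<and> 1 \<le> t \<and> wp (if beval b s then c else d) Q s (t - 1)"
    unfolding wp_def
    by (elim run_IfE) (auto intro!: exI[of _ "u - 1"] exI[of _ s'])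
next
  assume R: "bdef b s \<and> 1 \<le> t \<and> wp (if beval b s then c else d) Q s (t - 1)"
  then obtain u s' where "u \<le> t - 1" "run (if beval b s then c else d) s u s'" "Q s' (t - 1 - u)"
    unfolding wp_def by blast
  with R show "wp (If b c d) Q s t"
    unfolding wp_def by (intro exI[of _ "Suc u"] exI[of _ s']) (auto intro: run_If)
qed

text \<open>No separate variant is needed: every iteration consumes credit.\<close>

lemma wp_While:
  assumes "I s t"
    and "\<And>s t. I s t \<Longrightarrow> bdef b s \<and> 1 \<le> t"
    and "\<And>s t. I s t \<Longrightarrow> \<not> beval b s \<Longrightarrow> Q s (t - 1)"
    and "\<And>s t. I s t \<Longrightarrow> beval b s \<Longrightarrow> wp c I s (t - 1)"
  shows "wp (While b c) Q s t"
  using assms(1)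
proof (induction t arbitrary: s rule: less_induct)
  case (less t)
  show ?case
  proof (cases "beval b s")
    case False
    with less.prems assms(2,3) have "run (While b c) s 1 s" "Q s (t - 1)" "1 \<le> t"
      by (auto intro!: run_While_False dest: assms(2))
    then show ?thesis unfolding wp_def by blast
  next
    case True
    with less.prems assms(4) obtain u s' where u: "u \<le> t - 1" "run c s u s'" "I s' (t - 1 - u)"
      unfolding wp_def by blast
    moreover have "1 \<le> t" "bdef b s" using assms(2) less.prems by auto
    ultimately have "t - 1 - u < t" by auto
    from less.IH[OF this u(3)] obtain u' s'' where
      "u' \<le> t - 1 - u" "run (While b c) s' u' s''" "Q s'' (t - 1 - u - u')"
      unfolding wp_def by blast
    with u True \<open>1 \<le> t\<close> \<open>bdef b s\<close> show ?thesis unfolding wp_def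
      by (intro exI[of _ "Suc (u + u')"] exI[of _ s'']) (auto intro: run_While_True)
  qed
qed

end

section \<open>Memory layout and compilation\<close>

fun vreg :: "nvar \<Rightarrow> nat" where
  "vreg Vc = 2" | "vreg Vr = 3" | "vreg Vp = 4" | "vreg Vi = 5" | "vreg Vj = 6"
| "vreg Vbase = 7" | "vreg Vlast = 8" | "vreg Vlo = 9" | "vreg Vhi = 10" | "vreg Vk = 11"
| "vreg Vh = 12" | "vreg Vinp = 13" | "vreg Vbot = 14" | "vreg Vtop = 15" | "vreg Vrow = 16"
| "vreg Vcol = 17" | "vreg Vpos = 18" | "vreg Vend = 19" | "vreg Vbest = 20" | "vreg Vlim = 21"

fun nslot :: "narr \<Rightarrow> nat" where
  "nslot COL = 0" | "nslot SEG = 1" | "nslot STRIDE = 2" | "nslot ARG = 3" | "nslot BEST = 4"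

text \<open>The array \<open>PTS\<close> is the initial segment of the memory, so its slot is a dummy value.\<close>

fun rslot :: "rarr \<Rightarrow> nat" where
  "rslot PSUM = 5" | "rslot PSQ = 6" | "rslot OPT = 7" | "rslot PTS = 0"

lemma vreg_bounds: "2 \<le> vreg v" "vreg v < 22"
  by (cases v; simp)+

lemma vreg_inject [simp]: "vreg v = vreg w \<longleftrightarrow> v = w"
  by (cases v; cases w; simp)

lemma nslot_less: "nslot a < 8"
  by (cases a; simp)

lemma nslot_inject: "nslot a = nslot b \<longleftrightarrow> a = b"
  by (cases a; cases b; simp)

lemma rslot_less: "rslot a < 8"
  by (cases a; simp)

lemma rslot_inject: "a \<noteq> PTS \<Longrightarrow> b \<noteq> PTS \<Longrightarrow> rslot a = rslot b \<longleftrightarrow> a = b"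
  by (cases a; cases b; simp)

lemma nslot_neq_rslot: "b \<noteq> PTS \<Longrightarrow> nslot a \<noteq> rslot b"
  by (cases a; cases b; simp)

text \<open>Register \<open>0\<close> keeps the number of points during the whole compiled run, so
  that the offset of the arrays can be added at run time; \<open>Suc d\<close> is scratch.\<close>

definition addr_code :: "nat \<Rightarrow> nat \<Rightarrow> instr list" where
  "addr_code k d = [Const (Suc d) 8, Mul d d (Suc d), Const (Suc d) (int k), Add d d (Suc d), Add d d 0]"

primrec ncomp :: "nexp \<Rightarrow> nat \<Rightarrow> instr list" where
  "ncomp (Num c) d = [Const d (int c)]"
| "ncomp Len d = [Move d 0]"
| "ncomp (Var v) d = [Move d (vreg v)]"
| "ncomp (Plus a b) d = ncomp a d @ ncomp b (Suc d) @ [Add d d (Suc d)]"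
| "ncomp (Minus a b) d = ncomp a d @ ncomp b (Suc d) @ [Sub d d (Suc d)]"
| "ncomp (NAt a e) d = ncomp e d @ addr_code (nslot a) d @ [Load d d]"

definition raddr_code :: "rarr \<Rightarrow> nat \<Rightarrow> instr list" where
  "raddr_code a d = (if a = PTS then [] else addr_code (rslot a) d)"

primrec rcomp :: "rexp \<Rightarrow> nat \<Rightarrow> instr list" where
  "rcomp (RNum c) d = [Const d c]"
| "rcomp Lam d = [Move d 1]"
| "rcomp (OfNat e) d = ncomp e d"
| "rcomp (RPlus a b) d = rcomp a d @ rcomp b (Suc d) @ [Add d d (Suc d)]"
| "rcomp (RMinus a b) d = rcomp a d @ rcomp b (Suc d) @ [Sub d d (Suc d)]"
| "rcomp (RTimes a b) d = rcomp a d @ rcomp b (Suc d) @ [Mul d d (Suc d)]"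
| "rcomp (RDivide a b) d = rcomp a d @ rcomp b (Suc d) @ [Div d d (Suc d)]"
| "rcomp (RAt a e) d = ncomp e d @ raddr_code a d @ [Load d d]"

definition cmp_code :: "nat \<Rightarrow> nat \<Rightarrow> instr list" where
  "cmp_code l d = [Jump_less d (Suc d) (Suc (Suc (Suc l))), Const d 0, Jump (l + 4), Const d 1]"

text \<open>The second argument of \<open>bcomp\<close> and \<open>comp\<close> is the absolute position of the code, as jumps need it.\<close>

primrec bcomp :: "bexp \<Rightarrow> nat \<Rightarrow> nat \<Rightarrow> instr list" where
  "bcomp (NLess a b) l d = (let xs = ncomp a d @ ncomp b (Suc d) in xs @ cmp_code (l + length xs) d)"
| "bcomp (RLess a b) l d = (let xs = rcomp a d @ rcomp b (Suc d) in xs @ cmp_code (l + length xs) d)"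
| "bcomp (Not b) l d = bcomp b l d @ [Const (Suc d) 1, Sub d (Suc d) d]"
| "bcomp (And a b) l d =
     (let xs = bcomp a l d; ys = bcomp b (l + length xs + 2) d
      in xs @ [Const (Suc d) 0, Jump_eq d (Suc d) (l + length xs + 2 + length ys)] @ ys)"

primrec comp :: "cmd \<Rightarrow> nat \<Rightarrow> instr list" where
  "comp Skip l = []"
| "comp (NAssign v e) l = ncomp e 22 @ [Move (vreg v) 22]"
| "comp (NStore a i e) l = ncomp i 22 @ addr_code (nslot a) 22 @ ncomp e 23 @ [Store 22 23]"
| "comp (RStore a i e) l = ncomp i 22 @ raddr_code a 22 @ rcomp e 23 @ [Store 22 23]"
| "comp (c ;; d) l = (let xs = comp c l in xs @ comp d (l + length xs))"
| "comp (If b c d) l =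
     (let xs = bcomp b l 22; l1 = l + length xs + 2; ys = comp c l1; l2 = l1 + length ys + 1;
          zs = comp d l2
      in xs @ [Const 23 0, Jump_eq 22 23 l2] @ ys @ [Jump (l2 + length zs)] @ zs)"
| "comp (While b c) l =
     (let xs = bcomp b l 22; l1 = l + length xs + 2; ys = comp c l1
      in xs @ [Const 23 0, Jump_eq 22 23 (l1 + length ys + 1)] @ ys @ [Jump l])"

section \<open>Correctness and running time of the compiled code\<close>

definition code_at :: "program \<Rightarrow> nat \<Rightarrow> instr list \<Rightarrow> bool" where
  "code_at P l xs \<longleftrightarrow> (\<forall>i<length xs. l + i < length P \<and> P ! (l + i) = xs ! i)"

lemma code_at_Nil [simp]: "code_at P l []"
  by (simp add: code_at_def)

lemma code_at_Cons [simp]: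
  "code_at P l (x # xs) \<longleftrightarrow> l < length P \<and> P ! l = x \<and> code_at P (Suc l) xs"
  unfolding code_at_def by (auto simp: less_Suc_eq_0_disj all_conj_distrib)

lemma code_at_append [simp]:
  "code_at P l (xs @ ys) \<longleftrightarrow> code_at P l xs \<and> code_at P (l + length xs) ys"
  by (induction xs arbitrary: l) auto

definition reaches :: "program \<Rightarrow> nat \<Rightarrow> config \<Rightarrow> config \<Rightarrow> bool" where
  "reaches P T s s' \<longleftrightarrow> (\<exists>t\<le>T. (step P ^^ t) s s')"

lemma reaches_refl: "reaches P T s s"
  unfolding reaches_def by (intro exI[of _ 0]) auto

lemma reaches_eq: "s = s' \<Longrightarrow> reaches P T s s'"
  using reaches_refl by simp

lemma reaches_trans: "reaches P T s s' \<Longrightarrow> reaches P T' s' s'' \<Longrightarrow> T + T' \<le> U \<Longrightarrow> reaches P U s s''"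
proof -
  assume "reaches P T s s'" "reaches P T' s' s''" and U: "T + T' \<le> U"
  then obtain t t' where "t \<le> T" "t' \<le> T'" "(step P ^^ t) s s'" "(step P ^^ t') s' s''"
    unfolding reaches_def by blast
  then have "(step P ^^ (t + t')) s s''" by (auto simp: relpowp_add)
  with \<open>t \<le> T\<close> \<open>t' \<le> T'\<close> U show ?thesis
    unfolding reaches_def by (intro exI[of _ "t + t'"]) auto
qed

lemma reaches_step: "step P s s' \<Longrightarrow> reaches P T s' s'' \<Longrightarrow> reaches P (Suc T) s s''"
  by (rule reaches_trans[of P 1 s s' T]) (auto simp: reaches_def intro!: exI[of _ 1])

lemma reaches_exec:
  "pc s < length P \<Longrightarrow> exec (P ! pc s) s = Some s' \<Longrightarrow> reaches P T s' s'' \<Longrightarrow> reaches P (Suc T) s s''"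
  by (rule reaches_step) (auto simp: step_def)

text \<open>The eight arrays are interleaved rather than laid out in blocks. No array needs a length
  bound, and cells are told apart by quotient and remainder modulo 8.\<close>

definition cell :: "nat \<Rightarrow> nat \<Rightarrow> nat \<Rightarrow> nat" where
  "cell N k i = i * 8 + k + N"

lemma cell_inject:
  assumes "k < 8" "k' < 8"
  shows "cell N k i = cell N k' i' \<longleftrightarrow> k = k' \<and> i = i'"
proof
  assume "cell N k i = cell N k' i'"
  then have "i * 8 + k = i' * 8 + k'" by (simp add: cell_def)
  then have "(i * 8 + k) mod 8 = (i' * 8 + k') mod 8" "(i * 8 + k) div 8 = (i' * 8 + k') div 8"
    by simp_all
  then show "k = k' \<and> i = i'" using assms by simp
qed simp

definition rcell :: "nat \<Rightarrow> rarr \<Rightarrow> nat \<Rightarrow> nat" where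
  "rcell N a i = (if a = PTS then i else cell N (rslot a) i)"

context machine
begin

definition represents :: "state \<Rightarrow> config \<Rightarrow> bool" where
  "represents s x \<longleftrightarrow>
     reg x 0 = real N \<and> reg x 1 = lam \<and>
     (\<forall>v. reg x (vreg v) = real (nv s v)) \<and>
     (\<forall>a i. mem x (cell N (nslot a) i) = real (na s a i)) \<and>
     (\<forall>i<N. mem x i = ra s PTS i) \<and>
     (\<forall>a i. a \<noteq> PTS \<longrightarrow> mem x (cell N (rslot a) i) = ra s a i)"

lemma represents_cong:
  assumes "represents s x" "mem y = mem x" "\<And>k. k < 22 \<Longrightarrow> reg y k = reg x k"
  shows "represents s y"
  using assms vreg_bounds unfolding represents_def by simp

text \<open>Registers from \<open>d\<close> upward act as an expression stack: whatever lies below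
  \<open>d\<close> survives, which lets a second operand be evaluated into \<open>Suc d\<close>
  without losing the first.\<close>

definition computes :: "program \<Rightarrow> instr list \<Rightarrow> nat \<Rightarrow> config \<Rightarrow> real \<Rightarrow> bool" where
  "computes P xs d x v \<longleftrightarrow>
     (\<exists>y. reaches P (length xs) x y \<and> pc y = pc x + length xs \<and> reg y d = v \<and> mem y = mem x \<and>
          (\<forall>k<d. reg y k = reg x k))"

lemma computes_instr:
  assumes "code_at P (pc x) [i]" "exec i x = Some (set_reg d v x)"
  shows "computes P [i] d x v"
  unfolding computes_def
  by (rule exI[of _ "set_reg d v x"])
     (use assms in \<open>auto simp: set_reg_def intro: reaches_exec reaches_refl\<close>)

lemma computes_binary:
  assumes "computes P xs d x u"
    and "\<And>y. represents s y \<Longrightarrow> pc y = pc x + length xs \<Longrightarrow> computes P ys (Suc d) y v"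
    and "represents s x" "22 \<le> d"
    and "\<And>z. pc z = pc x + length xs + length ys \<Longrightarrow> reg z d = u \<Longrightarrow> reg z (Suc d) = v \<Longrightarrow>
           computes P zs d z w"
  shows "computes P (xs @ ys @ zs) d x w"
proof -
  obtain y where y: "reaches P (length xs) x y" "pc y = pc x + length xs" "reg y d = u"
      "mem y = mem x" "\<forall>k<d. reg y k = reg x k"
    using assms(1) unfolding computes_def by blast
  have "represents s y" by (rule represents_cong[OF assms(3)]) (use y assms(4) in auto)
  from assms(2)[OF this y(2)] obtain z where
    z: "reaches P (length ys) y z" "pc z = pc y + length ys" "reg z (Suc d) = v"
      "mem z = mem y" "\<forall>k<Suc d. reg z k = reg y k"
    unfolding computes_def by blast
  from assms(5)[of z] y z obtain z' where z': "reaches P (length zs) z z'"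
      "pc z' = pc z + length zs" "reg z' d = w" "mem z' = mem z" "\<forall>k<d. reg z' k = reg z k"
    unfolding computes_def by auto
  then have "reaches P (length (xs @ ys @ zs)) x z'"
    using reaches_trans[OF y(1) reaches_trans[OF z(1) z'(1) order_refl]] by simp
  then show ?thesis
    unfolding computes_def by (intro exI[of _ z']) (use y z z' in auto)
qed

lemma computes_append:
  assumes "computes P xs d x u"
    and "\<And>y. pc y = pc x + length xs \<Longrightarrow> reg y d = u \<Longrightarrow> mem y = mem x \<Longrightarrow>
           (\<forall>k<d. reg y k = reg x k) \<Longrightarrow> computes P ys d y v"
  shows "computes P (xs @ ys) d x v"
proof -
  obtain y where y: "reaches P (length xs) x y" "pc y = pc x + length xs" "reg y d = u"
      "mem y = mem x" "\<forall>k<d. reg y k = reg x k"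
    using assms(1) unfolding computes_def by blast
  from assms(2)[OF y(2-5)] obtain z where "reaches P (length ys) y z" "pc z = pc y + length ys"
      "reg z d = v" "mem z = mem y" "\<forall>k<d. reg z k = reg y k"
    unfolding computes_def by blast
  with y show ?thesis
    unfolding computes_def by (intro exI[of _ z]) (auto intro: reaches_trans)
qed

lemma computes_addr_code:
  assumes "code_at P (pc x) (addr_code k d)" "reg x d = real i" "reg x 0 = real N" "0 < d"
  shows "computes P (addr_code k d) d x (real (cell N k i))"
proof -
  let ?y = "x\<lparr>pc := pc x + 5, reg := (reg x)(Suc d := real k, d := real (cell N k i))\<rparr>"
  have "reaches P (Suc (Suc (Suc (Suc (Suc 0))))) x ?y"
    using assms unfolding addr_code_def
    by (intro reaches_exec)
       (auto simp: set_reg_def reaches_def cell_def fun_eq_iff split: if_splits)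
  then show ?thesis
    unfolding computes_def using assms(4) by (intro exI[of _ ?y]) (auto simp: addr_code_def)
qed

lemma computes_ncomp:
  assumes "code_at P (pc x) (ncomp e d)" "represents s x" "ndef e s" "22 \<le> d"
  shows "computes P (ncomp e d) d x (real (neval e s))"
  using assms
proof (induction e arbitrary: d x)
  case (Plus a b)
  show ?case
    unfolding ncomp.simps
    by (rule computes_binary[where s = s and u = "real (neval a s)" and v = "real (neval b s)"])
       (use Plus in \<open>auto intro!: computes_instr\<close>)
next
  case (Minus a b)
  show ?case
    unfolding ncomp.simps
    by (rule computes_binary[where s = s and u = "real (neval a s)" and v = "real (neval b s)"])
       (use Minus in \<open>auto intro!: computes_instr simp: of_nat_diff\<close>)
next
  case (NAt a e)
  show ?case
    unfolding ncomp.simps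
  proof (rule computes_append, rule NAt.IH)
    fix y :: config assume y: "pc y = pc x + length (ncomp e d)" "reg y d = real (neval e s)" "mem y = mem x"
      "\<forall>k<d. reg y k = reg x k"
    have "reg y 0 = real N" using y(4) NAt.prems by (auto simp: represents_def)
    then show "computes P (addr_code (nslot a) d @ [Load d d]) d y (real (neval (NAt a e) s))"
      using y NAt.prems
      by (auto intro!: computes_append[OF computes_addr_code[where i = "neval e s"]] computes_instr
        simp: represents_def)
  qed (use NAt.prems in auto)
qed (auto intro!: computes_instr simp: represents_def)

lemma computes_raddr_code:
  assumes "code_at P (pc x) (raddr_code a d)" "reg x d = real i" "reg x 0 = real N" "0 < d"
  shows "computes P (raddr_code a d) d x (real (rcell N a i))"
  using assms computes_addr_code[of P x "rslot a" d i]
  by (auto simp: raddr_code_def rcell_def computes_def intro: reaches_refl)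

lemma computes_rcomp:
  assumes "code_at P (pc x) (rcomp e d)" "represents s x" "rdef e s" "22 \<le> d"
  shows "computes P (rcomp e d) d x (reval e s)"
  using assms
proof (induction e arbitrary: d x)
  case (OfNat e)
  then show ?case by (auto intro: computes_ncomp)
next
  case (RPlus a b)
  show ?case
    unfolding rcomp.simps
    by (rule computes_binary[where s = s and u = "reval a s" and v = "reval b s"])
       (use RPlus in \<open>auto intro!: computes_instr\<close>)
next
  case (RMinus a b)
  show ?case
    unfolding rcomp.simps
    by (rule computes_binary[where s = s and u = "reval a s" and v = "reval b s"])
       (use RMinus in \<open>auto intro!: computes_instr\<close>)
next
  case (RTimes a b)
  show ?case
    unfolding rcomp.simps
    by (rule computes_binary[where s = s and u = "reval a s" and v = "reval b s"])
       (use RTimes in \<open>auto intro!: computes_instr\<close>)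
next
  case (RDivide a b)
  show ?case
    unfolding rcomp.simps
    by (rule computes_binary[where s = s and u = "reval a s" and v = "reval b s"])
       (use RDivide in \<open>auto intro!: computes_instr\<close>)
next
  case (RAt a e)
  show ?case
    unfolding rcomp.simps
  proof (rule computes_append, rule computes_ncomp)
    fix y :: config assume y: "pc y = pc x + length (ncomp e d)" "reg y d = real (neval e s)" "mem y = mem x"
      "\<forall>k<d. reg y k = reg x k"
    have "reg y 0 = real N" using y(4) RAt.prems by (auto simp: represents_def)
    then show "computes P (raddr_code a d @ [Load d d]) d y (reval (RAt a e) s)"
      using y RAt.prems
      by (auto intro!: computes_append[OF computes_raddr_code[where i = "neval e s"]] computes_instr
        simp: represents_def rcell_def)
  qed (use RAt.prems in auto)
qed (auto intro!: computes_instr simp: represents_def)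

lemma computes_cmp_code:
  assumes "code_at P (pc x) (cmp_code (pc x) d)"
  shows "computes P (cmp_code (pc x) d) d x (of_bool (reg x d < reg x (Suc d)))"
proof -
  let ?y = "x\<lparr>pc := pc x + 4, reg := (reg x)(d := of_bool (reg x d < reg x (Suc d)))\<rparr>"
  have "reaches P 4 x ?y"
  proof (cases "reg x d < reg x (Suc d)")
    case True
    then have "reaches P (Suc (Suc 2)) x ?y"
      using assms unfolding cmp_code_def
      by (intro reaches_exec) (auto simp: set_reg_def branch_def intro!: reaches_eq)
    then show ?thesis by (simp add: eval_nat_numeral)
  next
    case False
    then have "reaches P (Suc (Suc (Suc 1))) x ?y"
      using assms unfolding cmp_code_def
      by (intro reaches_exec) (auto simp: set_reg_def branch_def intro!: reaches_eq)
    then show ?thesis by (simp add: eval_nat_numeral)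
  qed
  then show ?thesis
    unfolding computes_def by (intro exI[of _ ?y]) (auto simp: cmp_code_def eval_nat_numeral)
qed

lemma computes_bcomp:
  assumes "code_at P (pc x) (bcomp b (pc x) d)" "represents s x" "bdef b s" "22 \<le> d"
  shows "computes P (bcomp b (pc x) d) d x (of_bool (beval b s))"
  using assms
proof (induction b arbitrary: x)
  case (NLess a b)
  show ?case
    unfolding bcomp.simps Let_def append_assoc
  proof (rule computes_binary)
    fix z :: config assume z: "pc z = pc x + length (ncomp a d) + length (ncomp b (Suc d))"
      "reg z d = real (neval a s)" "reg z (Suc d) = real (neval b s)"
    then have "pc x + length (ncomp a d @ ncomp b (Suc d)) = pc z" by simp
    then show "computes P (cmp_code (pc x + length (ncomp a d @ ncomp b (Suc d))) d) d z
        (of_bool (beval (NLess a b) s))"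
      using computes_cmp_code[of P z d] NLess.prems(1) z by (simp add: Let_def add.assoc)
  qed (use NLess.prems in \<open>auto simp: Let_def intro!: computes_ncomp\<close>)
next
  case (RLess a b)
  show ?case
    unfolding bcomp.simps Let_def append_assoc
  proof (rule computes_binary)
    fix z :: config assume z: "pc z = pc x + length (rcomp a d) + length (rcomp b (Suc d))"
      "reg z d = reval a s" "reg z (Suc d) = reval b s"
    then have "pc x + length (rcomp a d @ rcomp b (Suc d)) = pc z" by simp
    then show "computes P (cmp_code (pc x + length (rcomp a d @ rcomp b (Suc d))) d) d z
        (of_bool (beval (RLess a b) s))"
      using computes_cmp_code[of P z d] RLess.prems(1) z by (simp add: Let_def add.assoc)
  qed (use RLess.prems in \<open>auto simp: Let_def intro!: computes_rcomp\<close>)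
next
  case (Not b)
  show ?case
    unfolding bcomp.simps
  proof (rule computes_append, rule Not.IH)
    fix y :: config assume y: "pc y = pc x + length (bcomp b (pc x) d)" "reg y d = of_bool (beval b s)"
    let ?z = "y\<lparr>pc := pc y + 2, reg := (reg y)(Suc d := 1, d := 1 - of_bool (beval b s))\<rparr>"
    have "reaches P (Suc (Suc 0)) y ?z"
      using Not.prems y
      by (intro reaches_exec) (auto simp: set_reg_def fun_eq_iff intro!: reaches_eq)
    then show "computes P [Const (Suc d) 1, Sub d (Suc d) d] d y (of_bool (beval (Not b) s))"
      unfolding computes_def by (intro exI[of _ ?z]) auto
  qed (use Not.prems in auto)
next
  case (And a b)
  let ?xs = "bcomp a (pc x) d"
  let ?l = "pc x + length ?xs + 2"
  let ?ys = "bcomp b ?l d"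
  have code: "code_at P (pc x + length ?xs)
      ([Const (Suc d) 0, Jump_eq d (Suc d) (?l + length ?ys)] @ ?ys)"
    using And.prems(1) unfolding bcomp.simps Let_def code_at_append by blast
  show ?case
    unfolding bcomp.simps Let_def
  proof (rule computes_append, rule And.IH(1))
    fix y :: config assume y: "pc y = pc x + length ?xs" "reg y d = of_bool (beval a s)" "mem y = mem x"
      "\<forall>k<d. reg y k = reg x k"
    let ?r = "(reg y)(Suc d := 0)"
    show "computes P ([Const (Suc d) 0, Jump_eq d (Suc d) (?l + length ?ys)] @ ?ys) d y
        (of_bool (beval (And a b) s))"
    proof (cases "beval a s")
      \<comment> \<open>Register \<open>d\<close> already holds 0, the value of the whole
        conjunction, so the jump may skip the right operand.\<close>
      case False
      let ?z = "y\<lparr>pc := ?l + length ?ys, reg := ?r\<rparr>"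
      have "reaches P (Suc (Suc (length ?ys))) y ?z"
        using code y False
        by (intro reaches_exec) (auto simp: set_reg_def branch_def intro!: reaches_eq)
      then show ?thesis
        unfolding computes_def using y False by (intro exI[of _ ?z]) auto
    next
      case True
      let ?z = "y\<lparr>pc := ?l, reg := ?r\<rparr>"
      have "represents s ?z"
        by (rule represents_cong[OF And.prems(2)]) (use y And.prems in auto)
      then have "computes P ?ys d ?z (of_bool (beval b s))"
        using And.IH(2)[of ?z] And.prems code True by auto
      then obtain z' where z': "reaches P (length ?ys) ?z z'" "pc z' = ?l + length ?ys"
        "reg z' d = of_bool (beval b s)" "mem z' = mem y" "\<forall>k<d. reg z' k = ?r k"
        unfolding computes_def by auto
      have "reaches P (Suc (Suc (length ?ys))) y z'"
        using code y True z'(1)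
        by (intro reaches_exec) (auto simp: set_reg_def branch_def)
      then show ?thesis
        unfolding computes_def using y z' True by (intro exI[of _ z']) auto
    qed
  qed (use And.prems in \<open>auto simp: Let_def\<close>)
qed

lemma represents_nupd:
  assumes "represents s x"
  shows "represents (nupd v k s) (set_reg (vreg v) (real k) x)"
  using assms vreg_bounds(1)[of v] unfolding represents_def set_reg_def by auto

lemma represents_naupd:
  assumes "represents s x"
  shows "represents (naupd a i k s) (set_mem (cell N (nslot a) i) (real k) x)"
  using assms unfolding represents_def set_mem_def
  by (auto simp: cell_inject nslot_less nslot_inject rcell_def rslot_less nslot_neq_rslot[symmetric])
     (auto simp: cell_def)

lemma represents_raupd:
  assumes "represents s x" "a = PTS \<longrightarrow> i < N"
  shows "represents (raupd a i k s) (set_mem (rcell N a i) k x)"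
  using assms unfolding represents_def set_mem_def
  by (auto simp: cell_inject nslot_less rslot_inject rcell_def rslot_less nslot_neq_rslot)
     (auto simp: cell_def)

lemma bcomp_branch:
  assumes "code_at P (pc x) (bcomp b (pc x) 22 @ [Const 23 0, Jump_eq 22 23 l])"
    and "represents s x" "bdef b s"
  shows "\<exists>y. reaches P (length (bcomp b (pc x) 22) + 2) x y \<and> represents s y \<and>
    pc y = (if beval b s then pc x + length (bcomp b (pc x) 22) + 2 else l)"
proof -
  obtain y where y: "reaches P (length (bcomp b (pc x) 22)) x y"
      "pc y = pc x + length (bcomp b (pc x) 22)" "reg y 22 = of_bool (beval b s)"
      "mem y = mem x" "\<forall>k<22. reg y k = reg x k"
    using computes_bcomp[of P x b 22 s] assms unfolding computes_def by auto
  let ?z = "y\<lparr>pc := (if beval b s then pc y + 2 else l), reg := (reg y)(23 := 0)\<rparr>"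
  have "reaches P (Suc (Suc 0)) y ?z"
    using assms(1) y by (intro reaches_exec) (auto simp: set_reg_def branch_def intro!: reaches_eq)
  then have "reaches P (length (bcomp b (pc x) 22) + 2) x ?z"
    using reaches_trans[OF y(1)] by simp
  moreover have "represents s ?z"
    by (rule represents_cong[OF assms(2)]) (use y in auto)
  ultimately show ?thesis
    using y by (intro exI[of _ ?z]) auto
qed

text \<open>A unit of source time pays for one straight pass through code of the command charged,
  such as a condition with its jumps, and no such pass is longer than the whole code. The bound
  \<open>L\<close> is separate from the length of \<open>comp c\<close>, so that it stays fixed
  while the induction descends into subcommands.\<close>

lemma comp_correct:
  assumes "run c s t s'" "code_at P (pc x) (comp c (pc x))" "length (comp c (pc x)) \<le> L"
    "represents s x"
  shows "\<exists>y. reaches P (L * t) x y \<and> pc y = pc x + length (comp c (pc x)) \<and> represents s' y"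
  using assms
proof (induction arbitrary: x rule: run.induct)
  case (run_Skip s)
  then show ?case by (auto intro: reaches_refl)
next
  case (run_NAssign e s v)
  then obtain y where y: "reaches P (length (ncomp e 22)) x y" "pc y = pc x + length (ncomp e 22)"
      "reg y 22 = real (neval e s)" "mem y = mem x" "\<forall>k<22. reg y k = reg x k"
    using computes_ncomp[of P x e 22 s] unfolding computes_def by auto
  let ?z = "set_reg (vreg v) (real (neval e s)) y"
  have "reaches P (Suc 0) y ?z"
    using run_NAssign y by (intro reaches_exec) (auto intro: reaches_refl)
  then have "reaches P (L * Suc 0) x ?z"
    by (rule reaches_trans[OF y(1)]) (use run_NAssign in auto)
  moreover have "represents s y"
    by (rule represents_cong[OF \<open>represents s x\<close>]) (use y in auto)
  then have "represents (nupd v (neval e s) s) ?z" by (rule represents_nupd)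
  ultimately show ?case using y by (intro exI[of _ ?z]) (auto simp: set_reg_def)
next
  case (run_NStore i s e a)
  have "computes P (ncomp i 22 @ addr_code (nslot a) 22) 22 x (real (cell N (nslot a) (neval i s)))"
  proof (rule computes_append, rule computes_ncomp)
    fix y :: config assume "pc y = pc x + length (ncomp i 22)" "reg y 22 = real (neval i s)"
      "\<forall>k<22. reg y k = reg x k"
    then show "computes P (addr_code (nslot a) 22) 22 y (real (cell N (nslot a) (neval i s)))"
      using run_NStore by (intro computes_addr_code) (auto simp: represents_def)
  qed (use run_NStore in auto)
  then obtain y where y: "reaches P (length (ncomp i 22 @ addr_code (nslot a) 22)) x y"
      "pc y = pc x + length (ncomp i 22 @ addr_code (nslot a) 22)"
      "reg y 22 = real (cell N (nslot a) (neval i s))" "mem y = mem x" "\<forall>k<22. reg y k = reg x k"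
    unfolding computes_def by auto
  have rep: "represents s y"
    by (rule represents_cong[OF \<open>represents s x\<close>]) (use y in auto)
  then obtain z where z: "reaches P (length (ncomp e 23)) y z" "pc z = pc y + length (ncomp e 23)"
      "reg z 23 = real (neval e s)" "mem z = mem y" "\<forall>k<23. reg z k = reg y k"
    using computes_ncomp[of P y e 23 s] run_NStore y unfolding computes_def
    by (auto simp: add.assoc)
  let ?z = "set_mem (cell N (nslot a) (neval i s)) (real (neval e s)) z"
  have "reaches P (Suc 0) z ?z"
    using run_NStore y z by (intro reaches_exec) (auto intro: reaches_refl simp: add.assoc)
  then have "reaches P (L * Suc 0) x ?z"
    by (rule reaches_trans[OF y(1) reaches_trans[OF z(1) _ order_refl]]) (use run_NStore in auto)
  moreover have "represents s z"
    by (rule represents_cong[OF rep]) (use z in auto)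
  then have "represents (naupd a (neval i s) (neval e s) s) ?z" by (rule represents_naupd)
  ultimately show ?case using y z by (intro exI[of _ ?z]) (auto simp: set_mem_def)
next
  case (run_RStore i s e a)
  have "computes P (ncomp i 22 @ raddr_code a 22) 22 x (real (rcell N a (neval i s)))"
  proof (rule computes_append, rule computes_ncomp)
    fix y :: config assume "pc y = pc x + length (ncomp i 22)" "reg y 22 = real (neval i s)"
      "\<forall>k<22. reg y k = reg x k"
    then show "computes P (raddr_code a 22) 22 y (real (rcell N a (neval i s)))"
      using run_RStore by (intro computes_raddr_code) (auto simp: represents_def)
  qed (use run_RStore in auto)
  then obtain y where y: "reaches P (length (ncomp i 22 @ raddr_code a 22)) x y"
      "pc y = pc x + length (ncomp i 22 @ raddr_code a 22)"
      "reg y 22 = real (rcell N a (neval i s))" "mem y = mem x" "\<forall>k<22. reg y k = reg x k"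
    unfolding computes_def by auto
  have rep: "represents s y"
    by (rule represents_cong[OF \<open>represents s x\<close>]) (use y in auto)
  then obtain z where z: "reaches P (length (rcomp e 23)) y z" "pc z = pc y + length (rcomp e 23)"
      "reg z 23 = reval e s" "mem z = mem y" "\<forall>k<23. reg z k = reg y k"
    using computes_rcomp[of P y e 23 s] run_RStore y unfolding computes_def
    by (auto simp: add.assoc)
  let ?z = "set_mem (rcell N a (neval i s)) (reval e s) z"
  have "reaches P (Suc 0) z ?z"
    using run_RStore y z by (intro reaches_exec) (auto intro: reaches_refl simp: add.assoc)
  then have "reaches P (L * Suc 0) x ?z"
    by (rule reaches_trans[OF y(1) reaches_trans[OF z(1) _ order_refl]]) (use run_RStore in auto)
  moreover have "represents s z"
    by (rule represents_cong[OF rep]) (use z in auto)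
  then have "represents (raupd a (neval i s) (reval e s) s) ?z"
    using run_RStore by (intro represents_raupd) auto
  ultimately show ?case using y z by (intro exI[of _ ?z]) (auto simp: set_mem_def)
next
  case (run_Seq c s t s' d t' s'')
  let ?xs = "comp c (pc x)"
  from run_Seq.prems have "code_at P (pc x) ?xs" "length ?xs \<le> L" by (auto simp: Let_def)
  from run_Seq.IH(1)[OF this run_Seq.prems(3)] obtain y where
    y: "reaches P (L * t) x y" "pc y = pc x + length ?xs" "represents s' y"
    by blast
  from run_Seq.prems have "code_at P (pc y) (comp d (pc y))" "length (comp d (pc y)) \<le> L"
    by (auto simp: Let_def y(2))
  from run_Seq.IH(2)[OF this y(3)] obtain z where
    z: "reaches P (L * t') y z" "pc z = pc y + length (comp d (pc y))" "represents s'' z"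
    by blast
  have "reaches P (L * (t + t')) x z"
    by (rule reaches_trans[OF y(1) z(1)]) (simp add: algebra_simps)
  with y z show ?case by (intro exI[of _ z]) (auto simp: Let_def)
next
  case (run_If b s c d t s')
  let ?xs = "bcomp b (pc x) 22"
  let ?l1 = "pc x + length ?xs + 2"
  let ?ys = "comp c ?l1"
  let ?l2 = "?l1 + length ?ys + 1"
  let ?zs = "comp d ?l2"
  let ?n = "length (comp (If b c d) (pc x))"
  have n: "?n = length ?xs + 3 + length ?ys + length ?zs"
    by (simp add: Let_def)
  have code: "code_at P (pc x) (?xs @ [Const 23 0, Jump_eq 22 23 ?l2])" "code_at P ?l1 ?ys"
    "code_at P (?l1 + length ?ys) [Jump (?l2 + length ?zs)]" "code_at P ?l2 ?zs"
    using run_If.prems(1) by (auto simp: Let_def algebra_simps)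
  obtain y where y: "reaches P (length ?xs + 2) x y" "represents s y"
      "pc y = (if beval b s then ?l1 else ?l2)"
    using bcomp_branch[OF code(1) run_If.prems(3) run_If.hyps(1)] by auto
  show ?case
  proof (cases "beval b s")
    case True
    from run_If.IH[of y] True code y run_If.prems(2) n obtain z where
      z: "reaches P (L * t) y z" "pc z = ?l1 + length ?ys" "represents s' z"
      by auto
    let ?z = "z\<lparr>pc := ?l2 + length ?zs\<rparr>"
    have "reaches P (Suc 0) z ?z"
      using code(3) z by (intro reaches_exec) (auto simp: branch_def intro!: reaches_eq)
    then have "reaches P (L * Suc t) x ?z"
      by (rule reaches_trans[OF y(1) reaches_trans[OF z(1) _ order_refl]])
         (use run_If.prems(2) n in auto)
    moreover have "represents s' ?z"
      by (rule represents_cong[OF z(3)]) auto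
    ultimately show ?thesis
      using n by (intro exI[of _ ?z]) auto
  next
    case False
    from run_If.IH[of y] False code y run_If.prems(2) n obtain z where
      z: "reaches P (L * t) y z" "pc z = ?l2 + length ?zs" "represents s' z"
      by auto
    have "reaches P (L * Suc t) x z"
      by (rule reaches_trans[OF y(1) z(1)]) (use run_If.prems(2) n in auto)
    with z n show ?thesis by (intro exI[of _ z]) auto
  qed
next
  case (run_While_False b s c)
  let ?xs = "bcomp b (pc x) 22"
  let ?l1 = "pc x + length ?xs + 2"
  let ?ys = "comp c ?l1"
  have code: "code_at P (pc x) (?xs @ [Const 23 0, Jump_eq 22 23 (?l1 + length ?ys + 1)])"
    using run_While_False.prems(1) by (auto simp: Let_def)
  obtain y where y: "reaches P (length ?xs + 2) x y" "represents s y" "pc y = ?l1 + length ?ys + 1"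
    using bcomp_branch[OF code run_While_False.prems(3) run_While_False.hyps(1)]
      run_While_False.hyps(2) by auto
  have "reaches P (L * Suc 0) x y"
    by (rule reaches_trans[OF y(1) reaches_refl[of _ 0]])
       (use run_While_False.prems(2) in \<open>auto simp: Let_def\<close>)
  with y show ?case by (intro exI[of _ y]) (auto simp: Let_def)
next
  case (run_While_True b s c t s' t' s'')
  let ?xs = "bcomp b (pc x) 22"
  let ?l1 = "pc x + length ?xs + 2"
  let ?ys = "comp c ?l1"
  have n: "length ?xs + 3 + length ?ys \<le> L"
    using run_While_True.prems(2) by (simp add: Let_def)
  have code: "code_at P (pc x) (?xs @ [Const 23 0, Jump_eq 22 23 (?l1 + length ?ys + 1)])"
    "code_at P ?l1 ?ys" "code_at P (?l1 + length ?ys) [Jump (pc x)]"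
    using run_While_True.prems(1) by (auto simp: Let_def algebra_simps)
  obtain y where y: "reaches P (length ?xs + 2) x y" "represents s y" "pc y = ?l1"
    using bcomp_branch[OF code(1) run_While_True.prems(3) run_While_True.hyps(1)]
      run_While_True.hyps(2) by auto
  from run_While_True.IH(1)[of y] code y n obtain z where
    z: "reaches P (L * t) y z" "pc z = ?l1 + length ?ys" "represents s' z"
    by auto
  let ?z = "z\<lparr>pc := pc x\<rparr>"
  have "reaches P (Suc 0) z ?z"
    using code(3) z by (intro reaches_exec) (auto simp: branch_def intro!: reaches_eq)
  then have xz: "reaches P (L + L * t) x ?z"
    by (rule reaches_trans[OF y(1) reaches_trans[OF z(1) _ order_refl]]) (use n in auto)
  have "represents s' ?z"
    by (rule represents_cong[OF z(3)]) auto
  with run_While_True.IH(2)[of ?z] run_While_True.prems obtain w where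
    w: "reaches P (L * t') ?z w" "pc w = pc x + length (comp (While b c) (pc x))" "represents s'' w"
    by auto
  have "reaches P (L * Suc (t + t')) x w"
    by (rule reaches_trans[OF xz w(1)]) (simp add: algebra_simps)
  with w show ?case by blast
qed

end

section \<open>Costs of segments\<close>

definition dev :: "(nat \<Rightarrow> real) \<Rightarrow> real \<Rightarrow> nat \<Rightarrow> nat \<Rightarrow> real" where
  "dev x m a b = (\<Sum>l=a..<b. (x l - m)\<^sup>2)"

definition avg :: "(nat \<Rightarrow> real) \<Rightarrow> nat \<Rightarrow> nat \<Rightarrow> real" where
  "avg x a b = (\<Sum>l=a..<b. x l) / (real b - real a)"

text \<open>The sum of squared deviations from the mean, in the form that differences of prefix sums
  deliver in constant time.\<close>

definition sse :: "(nat \<Rightarrow> real) \<Rightarrow> nat \<Rightarrow> nat \<Rightarrow> real" where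
  "sse x a b = (\<Sum>l=a..<b. (x l)\<^sup>2) - (\<Sum>l=a..<b. x l)\<^sup>2 / (real b - real a)"

text \<open>The parallel axis theorem: expand the squares and complete the square in
  \<open>m\<close>.\<close>

lemma dev_eq_sse:
  assumes "a < b"
  shows "dev x m a b = sse x a b + (real b - real a) * (m - avg x a b)\<^sup>2"
proof -
  define S n where "S = (\<Sum>l=a..<b. x l)" and "n = real b - real a"
  have n: "n > 0" "real (b - a) = n" using assms by (auto simp: n_def of_nat_diff)
  have "dev x m a b = (\<Sum>l=a..<b. (x l)\<^sup>2 + m\<^sup>2 - 2 * m * x l)"
    unfolding dev_def by (intro sum.cong) (auto simp: power2_diff)
  also have "\<dots> = (\<Sum>l=a..<b. (x l)\<^sup>2) + n * m\<^sup>2 - 2 * m * S"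
    by (simp add: sum.distrib sum_subtractf S_def n sum_distrib_left)
  also have "\<dots> = (\<Sum>l=a..<b. (x l)\<^sup>2) - S\<^sup>2 / n + n * (m - S / n)\<^sup>2"
    using n(1) by (simp add: power2_diff field_simps power2_eq_square)
  finally show ?thesis
    by (simp add: sse_def avg_def S_def n_def)
qed

lemma sse_le_dev: "a < b \<Longrightarrow> sse x a b \<le> dev x m a b"
  by (simp add: dev_eq_sse)

lemma dev_avg: "a < b \<Longrightarrow> dev x (avg x a b) a b = sse x a b"
  by (simp add: dev_eq_sse)

lemma dev_append: "a \<le> b \<Longrightarrow> b \<le> c \<Longrightarrow> dev x m a c = dev x m a b + dev x m b c"
  unfolding dev_def by (simp add: sum.atLeastLessThan_concat)

lemma avg_le:
  assumes "a < b" "\<And>l. a \<le> l \<Longrightarrow> l < b \<Longrightarrow> x l \<le> y"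
  shows "avg x a b \<le> y"
proof -
  have "(\<Sum>l=a..<b. x l) \<le> real (card {a..<b}) * y"
    using assms by (intro sum_bounded_above) auto
  then show ?thesis
    using assms(1) by (simp add: avg_def divide_le_eq of_nat_diff mult.commute)
qed

lemma avg_ge:
  assumes "a < b" "\<And>l. a \<le> l \<Longrightarrow> l < b \<Longrightarrow> y \<le> x l"
  shows "y \<le> avg x a b"
proof -
  have "real (card {a..<b}) * y \<le> (\<Sum>l=a..<b. x l)"
    using assms by (intro sum_bounded_below) auto
  then show ?thesis
    using assms(1) by (simp add: avg_def le_divide_eq of_nat_diff mult.commute)
qed

lemma square_diff_mono:
  fixes y u v :: real
  shows "u \<le> v \<Longrightarrow> v \<le> y \<Longrightarrow> (y - v)\<^sup>2 \<le> (y - u)\<^sup>2"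
    and "v \<le> u \<Longrightarrow> y \<le> v \<Longrightarrow> (y - v)\<^sup>2 \<le> (y - u)\<^sup>2"
  using abs_le_square_iff[of "y - v" "y - u"] by auto

text \<open>Exchanging the two means, or the two clusters, according to which of the means is larger.\<close>

lemma sse_monge:
  assumes sorted: "\<And>i j. i \<le> j \<Longrightarrow> j < n \<Longrightarrow> x i \<le> x j"
    and le: "i \<le> i'" "i' < j" "j \<le> j'" "j' \<le> n"
  shows "sse x i j + sse x i' j' \<le> sse x i j' + sse x i' j"
proof -
  define u v where "u = avg x i j'" and "v = avg x i' j"
  have eq: "sse x i j' = dev x u i j'" "sse x i' j = dev x v i' j"
    using le by (simp_all add: u_def v_def dev_avg)
  have upper: "v \<le> x l" if "j \<le> l" "l < j'" for l
    unfolding v_def using le that by (intro avg_le sorted) auto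
  have lower: "x l \<le> v" if "l < i'" for l
    unfolding v_def using le that by (intro avg_ge sorted) auto
  show ?thesis
  proof (cases "u \<le> v")
    case True
    \<comment> \<open>Each mean stays with the start of its segment. Only the block from
      \<open>j\<close> to \<open>j'\<close> changes, from \<open>u\<close> to \<open>v\<close>, and
      its points lie at or above \<open>v\<close>.\<close>
    have "dev x v j j' \<le> dev x u j j'"
      unfolding dev_def using True upper by (intro sum_mono square_diff_mono(1)) auto
    moreover have "sse x i j \<le> dev x u i j" "sse x i' j' \<le> dev x v i' j'"
      using le by (auto intro!: sse_le_dev)
    ultimately show ?thesis
      using eq le dev_append[of i j j' x u] dev_append[of i' j j' x v] by linarith
  next
    case False
    \<comment> \<open>Now each mean stays with the end of its segment. Only the block from
      \<open>i\<close> to \<open>i'\<close> changes, from \<open>u\<close> down to \<open>v\<close>,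
      and its points lie at or below \<open>v\<close>.\<close>
    have "dev x v i i' \<le> dev x u i i'"
      unfolding dev_def using False lower by (intro sum_mono square_diff_mono(2)) auto
    moreover have "sse x i j \<le> dev x v i j" "sse x i' j' \<le> dev x u i' j'"
      using le by (auto intro!: sse_le_dev)
    ultimately show ?thesis
      using eq le dev_append[of i i' j' x u] dev_append[of i i' j x v] by linarith
  qed
qed

text \<open>The largest centre serves a final segment of the points.\<close>

lemma dp_le_cost:
  fixes x :: "nat \<Rightarrow> real"
  assumes sorted: "\<And>i j. i \<le> j \<Longrightarrow> j < N \<Longrightarrow> x i \<le> x j"
    and E0: "E 0 = 0" and E: "\<And>i j. i < j \<Longrightarrow> j \<le> N \<Longrightarrow> E j \<le> E i + sse x i j + lam"
    and "lam \<ge> 0" "finite M" "n \<le> N" "M \<noteq> {}"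
  shows "E n \<le> (\<Sum>l<n. Min ((\<lambda>m. (x l - m)\<^sup>2) ` M)) + lam * real (card M)"
  using \<open>finite M\<close> \<open>M \<noteq> {}\<close> \<open>n \<le> N\<close>
proof (induction M arbitrary: n rule: finite_linorder_max_induct)
  case (insert b A)
  have b: "b \<notin> A" using insert.hyps by auto
  have last: "E n \<le> E i + dev x b i n + lam" if "i \<le> n" for i
  proof (cases "i < n")
    case True
    then show ?thesis using E[OF True \<open>n \<le> N\<close>] sse_le_dev[OF True, of x b] by linarith
  next
    \<comment> \<open>A centre may serve no point at all; its segment is then empty, and
      \<open>lam\<close> is not negative.\<close>
    case False
    then show ?thesis using that \<open>lam \<ge> 0\<close> by (simp add: dev_def)
  qed
  show ?case
  proof (cases "A = {}")
    case True
    then show ?thesis using last[of 0] E0 by (simp add: dev_def atLeast0LessThan)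
  next
    case False
    let ?f = "\<lambda>l m. (x l - m)\<^sup>2"
    \<comment> \<open>The first disjunct makes \<open>n\<close> qualify, so that \<open>i\<close>
      exists; \<open>i = n\<close> means that \<open>b\<close> serves nothing.\<close>
    define S where "S l \<longleftrightarrow> n \<le> l \<or> (\<forall>a\<in>A. ?f l b < ?f l a)" for l
    define i where "i = (LEAST l. S l)"
    have "S n" by (simp add: S_def)
    then have i: "S i" "i \<le> n" "\<And>l. l < i \<Longrightarrow> \<not> S l"
      unfolding i_def by (auto intro: LeastI Least_le dest: not_less_Least)
    have Min_insert': "Min (?f l ` insert b A) = min (?f l b) (Min (?f l ` A))" for l
      using False \<open>finite A\<close> by simp
    have below: "Min (?f l ` insert b A) = Min (?f l ` A)" if "l < i" for l
    proof -
      from i(3)[OF that] obtain a where "a \<in> A" "?f l a \<le> ?f l b"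
        by (auto simp: S_def not_less)
      then have "Min (?f l ` A) \<le> ?f l b"
        using \<open>finite A\<close> by (meson Min_le finite_imageI image_eqI order_trans)
      then show ?thesis unfolding Min_insert' by simp
    qed
    have above: "Min (?f l ` insert b A) = ?f l b" if l: "i \<le> l" "l < n" for l
    proof -
      have "?f l b \<le> ?f l a" if "a \<in> A" for a
      proof -
        have "a < b" using insert.hyps that by auto
        have "?f i b < ?f i a" using i(1) l that by (auto simp: S_def)
        \<comment> \<open>The difference of the two squares is
          \<open>(b - a) * (2 * x i - a - b)\<close>, which grows with the point: once
          \<open>b\<close> is ahead of \<open>a\<close>, it stays ahead.\<close>
        then have "0 < (b - a) * (2 * x i - a - b)" by (simp add: power2_eq_square algebra_simps)
        then have "0 < 2 * x i - a - b" using \<open>a < b\<close> by (simp add: zero_less_mult_iff)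
        moreover have "x i \<le> x l" using sorted l \<open>n \<le> N\<close> by auto
        ultimately have "0 \<le> (b - a) * (2 * x l - a - b)" using \<open>a < b\<close> by simp
        then show ?thesis by (simp add: power2_eq_square algebra_simps)
      qed
      then have "?f l b \<le> Min (?f l ` A)" using False \<open>finite A\<close> by simp
      then show ?thesis unfolding Min_insert' by simp
    qed
    have "(\<Sum>l<n. Min (?f l ` insert b A))
        = (\<Sum>l<i. Min (?f l ` insert b A)) + (\<Sum>l=i..<n. Min (?f l ` insert b A))"
      using i(2) by (metis atLeast0LessThan sum.atLeastLessThan_concat zero_le)
    also have "\<dots> = (\<Sum>l<i. Min (?f l ` A)) + dev x b i n"
      using below above by (simp add: dev_def)
    finally have "(\<Sum>l<n. Min (?f l ` insert b A)) = (\<Sum>l<i. Min (?f l ` A)) + dev x b i n" .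
    moreover have "E i \<le> (\<Sum>l<i. Min (?f l ` A)) + lam * real (card A)"
      using insert.IH[OF False] i(2) \<open>n \<le> N\<close> by simp
    ultimately show ?thesis
      using last[OF i(2)] b \<open>finite A\<close> by (simp add: algebra_simps)
  qed
qed simp

section \<open>Row minima of totally monotone matrices\<close>

definition cost_exp :: "nexp \<Rightarrow> nexp \<Rightarrow> rexp" where
  "cost_exp i j =
     (let d = RMinus (RAt PSUM j) (RAt PSUM i)
      in RPlus (RAt OPT i) (RMinus (RMinus (RAt PSQ j) (RAt PSQ i))
           (RDivide (RTimes d d) (RMinus (OfNat j) (OfNat i)))))"

definition better_exp :: "nexp \<Rightarrow> nexp \<Rightarrow> nexp \<Rightarrow> bexp" where
  "better_exp j a b = And (NLess b j) (RLess (cost_exp b j) (cost_exp a j))"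

definition reduce_pop :: cmd where
  "reduce_pop =
     While (And (NLess (Var Vbot) (Var Vtop))
                (better_exp (Var Vrow) (NAt COL (Minus (Var Vtop) (Num 1))) (Var Vcol)))
       (NAssign Vtop (Minus (Var Vtop) (Num 1)) ;; NAssign Vrow (Minus (Var Vrow) (Var Vh)))"

definition reduce_step :: cmd where
  "reduce_step =
     NAssign Vcol (NAt COL (Var Vinp)) ;;
     reduce_pop ;;
     If (NLess (Var Vlast) (Plus (Var Vrow) (Var Vh)))
       Skip
       (NStore COL (Var Vtop) (Var Vcol) ;;
        NAssign Vtop (Plus (Var Vtop) (Num 1)) ;;
        NAssign Vrow (Plus (Var Vrow) (Var Vh))) ;;
     NAssign Vinp (Plus (Var Vinp) (Num 1))"

definition reduce :: cmd where
  "reduce = While (NLess (Var Vinp) (Var Vbot)) reduce_step"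

definition same_except :: "nvar set \<Rightarrow> narr set \<Rightarrow> state \<Rightarrow> state \<Rightarrow> bool" where
  "same_except V A s s' \<longleftrightarrow>
     (\<forall>v. v \<notin> V \<longrightarrow> nv s' v = nv s v) \<and> (\<forall>a. a \<notin> A \<longrightarrow> na s' a = na s a) \<and> ra s' = ra s"

text \<open>With correct prefix sums and \<open>i < j\<close> this is
  \<open>R OPT i + sse x i j\<close>. The summand \<lambda> is left out, being the same for every
  column.\<close>

definition val :: "(rarr \<Rightarrow> nat \<Rightarrow> real) \<Rightarrow> nat \<Rightarrow> nat \<Rightarrow> real" where
  "val R i j = R OPT i + (R PSQ j - R PSQ i - (R PSUM j - R PSUM i)\<^sup>2 / (real j - real i))"

text \<open>A column \<open>b \<ge> j\<close> starts no segment ending at \<open>j\<close>. Instead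
  of giving such entries an infinite value, the comparison never lets them win.\<close>

definition better :: "(rarr \<Rightarrow> nat \<Rightarrow> real) \<Rightarrow> nat \<Rightarrow> nat \<Rightarrow> nat \<Rightarrow> bool" where
  "better R j a b \<longleftrightarrow> b < j \<and> val R b j < val R a j"

context machine
begin

lemma reval_cost_exp [simp]: "reval (cost_exp i j) s = val (ra s) (neval i s) (neval j s)"
  by (simp add: cost_exp_def val_def Let_def power2_eq_square)

lemma rdef_cost_exp [simp]:
  "rdef (cost_exp i j) s \<longleftrightarrow> ndef i s \<and> ndef j s \<and> neval i s \<noteq> neval j s"
  by (auto simp: cost_exp_def Let_def)

lemma beval_better_exp [simp]:
  "beval (better_exp j a b) s \<longleftrightarrow> better (ra s) (neval j s) (neval a s) (neval b s)"
  by (simp add: better_exp_def better_def)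

lemma bdef_better_exp:
  "ndef j s \<Longrightarrow> ndef a s \<Longrightarrow> ndef b s \<Longrightarrow> neval a s < neval b s \<Longrightarrow> bdef (better_exp j a b) s"
  by (auto simp: better_exp_def)

end

text \<open>SMAWK sees the matrix only through \<open>better\<close>. The leftmost optimum is
  described by direct comparison with every other column, so transitivity of \<open>better\<close>
  is never called for.\<close>

locale row_minima = machine N lam for N lam +
  fixes R :: "rarr \<Rightarrow> nat \<Rightarrow> real" and lo hi base last :: nat and opt :: "nat \<Rightarrow> nat"
  assumes better_mono: "better R j a b \<Longrightarrow> lo \<le> a \<Longrightarrow> a < b \<Longrightarrow> b < hi \<Longrightarrow> base < j \<Longrightarrow> j \<le> j' \<Longrightarrow>
      j' \<le> last \<Longrightarrow> better R j' a b"
    and opt_ge: "base < j \<Longrightarrow> j \<le> last \<Longrightarrow> lo \<le> opt j"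
    and opt_less: "base < j \<Longrightarrow> j \<le> last \<Longrightarrow> opt j < hi"
    and opt_left: "base < j \<Longrightarrow> j \<le> last \<Longrightarrow> lo \<le> a \<Longrightarrow> a < opt j \<Longrightarrow> better R j a (opt j)"
    and opt_right: "base < j \<Longrightarrow> j \<le> last \<Longrightarrow> opt j < a \<Longrightarrow> a < hi \<Longrightarrow> \<not> better R j (opt j) a"
begin

text \<open>If the optimum moved left, \<open>opt j\<close> would beat \<open>opt j'\<close> in row
  \<open>j\<close>, hence also in row \<open>j'\<close>, where nothing to the right beats the
  optimum.\<close>

lemma opt_mono:
  assumes "base < j" "j \<le> j'" "j' \<le> last"
  shows "opt j \<le> opt j'"
proof (rule ccontr)
  assume "\<not> opt j \<le> opt j'"
  then have less: "opt j' < opt j" by simp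
  then have "better R j (opt j') (opt j)" using assms opt_ge[of j'] by (intro opt_left) auto
  then have "better R j' (opt j') (opt j)"
    using less assms opt_ge[of j'] opt_less[of j] by (elim better_mono) auto
  then show False using opt_right[of j' "opt j"] less assms opt_less[of j] by auto
qed

section \<open>Reduction to at most as many columns as rows\<close>

definition rows :: "nat \<Rightarrow> nat set" where
  "rows h = {j. base < j \<and> j \<le> last \<and> h dvd j - base}"

lemma rowsE:
  assumes "j \<in> rows h"
  obtains q where "j = base + q * h" "base < j" "j \<le> last"
proof -
  from assms obtain q where "j - base = h * q" "base < j" "j \<le> last"
    unfolding rows_def by (auto elim: dvdE)
  then have "j = base + q * h" by (simp add: mult.commute)
  with that \<open>base < j\<close> \<open>j \<le> last\<close> show thesis by blast
qed

definition increasing :: "(nat \<Rightarrow> nat) \<Rightarrow> nat \<Rightarrow> nat \<Rightarrow> bool" where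
  "increasing col a b \<longleftrightarrow> (\<forall>i j. a \<le> i \<longrightarrow> i < j \<longrightarrow> j < b \<longrightarrow> col i < col j)"

definition in_range :: "(nat \<Rightarrow> nat) \<Rightarrow> nat \<Rightarrow> nat \<Rightarrow> bool" where
  "in_range col a b \<longleftrightarrow> (\<forall>i. a \<le> i \<longrightarrow> i < b \<longrightarrow> lo \<le> col i \<and> col i < hi)"

definition covers :: "(nat \<Rightarrow> nat) \<Rightarrow> nat \<Rightarrow> nat \<Rightarrow> nat \<Rightarrow> bool" where
  "covers col a b h \<longleftrightarrow> increasing col a b \<and> in_range col a b \<and> (\<forall>j\<in>rows h. opt j \<in> col ` {a..<b})"

text \<open>
  The stack of columns \<open>col dn, \<dots>, col (up - 1)\<close>, with the columns \<open>col inp, \<dots>, col (dn - 1)\<close>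
  still to be read. The stack element at position \<open>t\<close> loses against its predecessor in row
  \<open>base + (t - dn) * h\<close>, hence in all rows up to that one.
\<close>

definition stack_inv :: "nat \<Rightarrow> (nat \<Rightarrow> nat) \<Rightarrow> nat \<Rightarrow> nat \<Rightarrow> nat \<Rightarrow> bool" where
  "stack_inv h col inp dn up \<longleftrightarrow>
     inp \<le> dn \<and> dn \<le> up \<and> base + (up - dn) * h \<le> last \<and>
     increasing col dn up \<and> increasing col inp dn \<and>
     in_range col dn up \<and> in_range col inp dn \<and>
     (\<forall>i j. dn \<le> i \<longrightarrow> i < up \<longrightarrow> inp \<le> j \<longrightarrow> j < dn \<longrightarrow> col i < col j) \<and>
     (\<forall>t. dn < t \<longrightarrow> t < up \<longrightarrow> \<not> better R (base + (t - dn) * h) (col (t - 1)) (col t)) \<and>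
     (\<forall>j\<in>rows h. opt j \<in> col ` {dn..<up} \<union> col ` {inp..<dn})"

text \<open>The popped column is the leftmost optimum of no row: from the tested row on, the
  incoming column beats it, and in earlier rows it fails to beat its predecessor on the
  stack.\<close>

lemma stack_inv_pop:
  assumes inv: "stack_inv h col inp dn (Suc up)" and "0 < h" "inp < dn" "dn \<le> up"
    and b: "better R (base + (Suc up - dn) * h) (col up) (col inp)"
  shows "stack_inv h col inp dn up"
proof -
  let ?u = "col up" and ?v = "col inp"
  have uv: "?u < ?v" "lo \<le> ?u" "?u < hi" "?v < hi" "base + (Suc up - dn) * h \<le> last"
    using inv assms by (auto simp: stack_inv_def in_range_def)
  have last: "base + (up - dn) * h \<le> last"
    using uv(5) \<open>dn \<le> up\<close> by (simp add: Suc_diff_le)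
  have not_u: "opt j \<noteq> ?u" if j: "j \<in> rows h" for j
  proof
    assume u: "opt j = ?u"
    obtain q where q: "j = base + q * h" and jb: "base < j" "j \<le> last"
      using j by (rule rowsE)
    show False
    proof (cases "Suc up - dn \<le> q")
      case True
      then have "base + (Suc up - dn) * h \<le> j" by (simp add: q)
      then have "better R j ?u ?v"
        using better_mono[OF b uv(2,1,4)] jb \<open>0 < h\<close> \<open>dn \<le> up\<close> by auto
      then show False using opt_right[OF jb, of ?v] u uv by auto
    next
      case False
      \<comment> \<open>Row \<open>base\<close> itself is excluded, so \<open>0 < q\<close>: a row
        before the tested one exists only if the popped column has a predecessor.\<close>
      then have q': "0 < q" "q \<le> up - dn" "dn < up" using jb q by (auto intro: gr0I)
      have w: "\<not> better R (base + (up - dn) * h) (col (up - 1)) ?u" "col (up - 1) < ?u"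
          "lo \<le> col (up - 1)"
        using inv q'(3) by (auto simp: stack_inv_def in_range_def increasing_def)
      have "better R j (col (up - 1)) ?u" using opt_left[OF jb, of "col (up - 1)"] u w by auto
      moreover have "j \<le> base + (up - dn) * h" using q' by (simp add: q)
      ultimately show False using better_mono[of j "col (up - 1)" ?u] w uv jb last by auto
    qed
  qed
  have "{dn..<Suc up} = insert up {dn..<up}"
    using \<open>dn \<le> up\<close> by auto
  then have "\<forall>j\<in>rows h. opt j \<in> col ` {dn..<up} \<union> col ` {inp..<dn}"
    using inv not_u by (auto simp: stack_inv_def)
  then show ?thesis
    using inv last \<open>dn \<le> up\<close> unfolding stack_inv_def increasing_def in_range_def by simp
qed

text \<open>The failed comparison is what the invariant asks of a new top, and the room left below
  \<open>last\<close> keeps the stack no larger than the number of rows.\<close>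

lemma stack_inv_push:
  assumes inv: "stack_inv h col inp dn up" and "inp < dn" and "base + (up - dn) * h + h \<le> last"
    and nb: "up = dn \<or> \<not> better R (base + (up - dn) * h) (col (up - 1)) (col inp)"
  shows "stack_inv h (col(up := col inp)) (Suc inp) dn (Suc up)"
proof -
  let ?col = "col(up := col inp)"
  have "dn \<le> up" using inv by (simp add: stack_inv_def)
  then have "?col ` {dn..<Suc up} = insert (col inp) (col ` {dn..<up})"
    by (auto simp: atLeastLessThanSuc)
  moreover have "?col ` {Suc inp..<dn} = col ` {Suc inp..<dn}"
    using \<open>dn \<le> up\<close> by (intro image_cong) auto
  moreover have "{inp..<dn} = insert inp {Suc inp..<dn}"
    using \<open>inp < dn\<close> by auto
  ultimately have "\<forall>j\<in>rows h. opt j \<in> ?col ` {dn..<Suc up} \<union> ?col ` {Suc inp..<dn}"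
    using inv by (auto simp: stack_inv_def)
  moreover have "\<not> better R (base + (t - dn) * h) (?col (t - 1)) (?col t)" if "dn < t" "t < Suc up" for t
    using inv nb that by (cases "t = up") (auto simp: stack_inv_def)
  moreover have "increasing ?col dn (Suc up)" "increasing ?col (Suc inp) dn"
    "in_range ?col dn (Suc up)" "in_range ?col (Suc inp) dn"
    using inv \<open>inp < dn\<close> by (auto simp: stack_inv_def increasing_def in_range_def less_Suc_eq)
  moreover have "\<forall>i j. dn \<le> i \<longrightarrow> i < Suc up \<longrightarrow> Suc inp \<le> j \<longrightarrow> j < dn \<longrightarrow> ?col i < ?col j"
    using inv \<open>inp < dn\<close> by (auto simp: stack_inv_def increasing_def less_Suc_eq)
  moreover have "base + (Suc up - dn) * h \<le> last"
    using assms(3) \<open>dn \<le> up\<close> by (simp add: Suc_diff_le add.commute add.left_commute)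
  ultimately show ?thesis
    using inv \<open>inp < dn\<close> unfolding stack_inv_def by auto
qed

text \<open>With a full stack, the tested row is the last one of stride \<open>h\<close>. A column
  that fails to beat the top there beats it in no row.\<close>

lemma stack_inv_discard:
  assumes inv: "stack_inv h col inp dn up" and "inp < dn" "0 < h"
    and full: "last < base + (up - dn) * h + h" and "base + h \<le> last"
    and nb: "up = dn \<or> \<not> better R (base + (up - dn) * h) (col (up - 1)) (col inp)"
  shows "stack_inv h col (Suc inp) dn up"
proof -
  let ?u = "col (up - 1)" and ?v = "col inp"
  have "dn \<le> up" using inv by (simp add: stack_inv_def)
  \<comment> \<open>There is at least one row, so a full stack has a top to compare with.\<close>
  have "dn < up" using full \<open>base + h \<le> last\<close> \<open>dn \<le> up\<close> by (cases "up = dn") auto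
  then have nb': "\<not> better R (base + (up - dn) * h) ?u ?v" using nb by auto
  have uv: "?u < ?v" "lo \<le> ?u" "?v < hi" "base + (up - dn) * h \<le> last"
    using inv \<open>dn < up\<close> \<open>inp < dn\<close> by (auto simp: stack_inv_def in_range_def)
  have not_v: "opt j \<noteq> ?v" if j: "j \<in> rows h" for j
  proof
    assume v: "opt j = ?v"
    obtain q where q: "j = base + q * h" and jb: "base < j" "j \<le> last"
      using j by (rule rowsE)
    have "q * h < Suc (up - dn) * h" using full jb(2) by (simp add: q)
    then have "q \<le> up - dn" using mult_less_cancel2 by (metis less_Suc_eq_le)
    then have "j \<le> base + (up - dn) * h" by (simp add: q)
    moreover have "better R j ?u ?v" using opt_left[of j ?u] v uv jb by auto
    ultimately show False using better_mono[of j ?u ?v] nb' uv jb by auto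
  qed
  have "{inp..<dn} = insert inp {Suc inp..<dn}"
    using \<open>inp < dn\<close> by auto
  then show ?thesis
    using inv not_v \<open>inp < dn\<close> unfolding stack_inv_def increasing_def in_range_def by auto
qed

lemma wp_reduce_pop:
  assumes s: "ra s = R" "nv s Vh = h" "0 < h" "nv s Vinp < nv s Vbot"
      "stack_inv h (na s COL) (nv s Vinp) (nv s Vbot) (nv s Vtop)"
      "nv s Vrow = base + (nv s Vtop - nv s Vbot) * h"
      "nv s Vcol = na s COL (nv s Vinp)"
      "k + 1 + 3 * (nv s Vtop - nv s Vbot) \<le> t"
    and Q: "\<And>s' t'. same_except {Vtop, Vrow} {} s s' \<Longrightarrow>
      stack_inv h (na s' COL) (nv s' Vinp) (nv s' Vbot) (nv s' Vtop) \<Longrightarrow>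
      nv s' Vrow = base + (nv s' Vtop - nv s' Vbot) * h \<Longrightarrow>
      nv s' Vtop = nv s' Vbot \<or>
        \<not> better R (nv s' Vrow) (na s' COL (nv s' Vtop - 1)) (na s' COL (nv s' Vinp)) \<Longrightarrow>
      k + 3 * (nv s' Vtop - nv s' Vbot) \<le> t' \<Longrightarrow> Q s' t'"
  shows "wp reduce_pop Q s t"
proof -
  let ?I = "\<lambda>s' t'. same_except {Vtop, Vrow} {} s s' \<and>
      stack_inv h (na s' COL) (nv s' Vinp) (nv s' Vbot) (nv s' Vtop) \<and>
      nv s' Vrow = base + (nv s' Vtop - nv s' Vbot) * h \<and>
      k + 1 + 3 * (nv s' Vtop - nv s' Vbot) \<le> t'"
  show ?thesis
    unfolding reduce_pop_def
  proof (rule wp_While[where I = ?I])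
    show "?I s t" using s by (simp add: same_except_def)
  next
    fix s' t' assume I: "?I s' t'"
    then have "na s' COL (nv s' Vtop - 1) < nv s' Vcol" if "nv s' Vbot < nv s' Vtop"
      using s that by (auto simp: same_except_def stack_inv_def)
    then show "bdef (And (NLess (Var Vbot) (Var Vtop))
        (better_exp (Var Vrow) (NAt COL (Minus (Var Vtop) (Num 1))) (Var Vcol))) s' \<and> 1 \<le> t'"
      using I by (auto intro!: bdef_better_exp)
  next
    fix s' t' assume I: "?I s' t'" and b: "\<not> beval (And (NLess (Var Vbot) (Var Vtop))
        (better_exp (Var Vrow) (NAt COL (Minus (Var Vtop) (Num 1))) (Var Vcol))) s'"
    have "nv s' Vbot \<le> nv s' Vtop" using I by (simp add: stack_inv_def)
    moreover have "ra s' = R" "nv s' Vcol = na s' COL (nv s' Vinp)"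
      using I s by (auto simp: same_except_def)
    ultimately have "nv s' Vtop = nv s' Vbot \<or>
        \<not> better R (nv s' Vrow) (na s' COL (nv s' Vtop - 1)) (na s' COL (nv s' Vinp))"
      using b by auto
    with I show "Q s' (t' - 1)" by (intro Q) auto
  next
    fix s' t' assume I: "?I s' t'" and b: "beval (And (NLess (Var Vbot) (Var Vtop))
        (better_exp (Var Vrow) (NAt COL (Minus (Var Vtop) (Num 1))) (Var Vcol))) s'"
    have eq: "nv s' Vbot = nv s Vbot" "nv s' Vh = h" "nv s' Vinp = nv s Vinp" "na s' = na s" "ra s' = R"
      "nv s' Vcol = nv s Vcol"
      using I s by (auto simp: same_except_def fun_eq_iff)
    obtain m where m: "nv s' Vtop = Suc (nv s Vbot + m)"
      using b by (auto simp: eq less_iff_Suc_add)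
    have "stack_inv h (na s' COL) (nv s' Vinp) (nv s' Vbot) (nv s Vbot + m)"
      by (rule stack_inv_pop) (use I b s in \<open>auto simp: eq m\<close>)
    with I show "wp (NAssign Vtop (Minus (Var Vtop) (Num 1)) ;;
        NAssign Vrow (Minus (Var Vrow) (Var Vh))) ?I s' (t' - 1)"
      by (auto simp: same_except_def eq m)
  qed
qed

text \<open>Amortisation: each stacked column holds 3 units for its own removal. An input column
  brings 12, of which its step takes at most 8 besides removals and 3 stay on the stack.\<close>

lemma wp_reduce:
  assumes s: "ra s = R" "nv s Vlast = last" "nv s Vh = h" "0 < h" "base + h \<le> last"
      "covers (na s COL) (nv s Vinp) (nv s Vbot) h" "nv s Vinp \<le> nv s Vbot"
      "nv s Vtop = nv s Vbot" "nv s Vrow = base"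
      "k + 1 + 12 * (nv s Vbot - nv s Vinp) \<le> t"
    and Q: "\<And>s' t'. same_except {Vtop, Vrow, Vinp, Vcol} {COL} s s' \<Longrightarrow>
      (\<And>i. i < nv s Vbot \<Longrightarrow> na s' COL i = na s COL i) \<Longrightarrow>
      covers (na s' COL) (nv s Vbot) (nv s' Vtop) h \<Longrightarrow>
      nv s Vbot \<le> nv s' Vtop \<Longrightarrow> (nv s' Vtop - nv s Vbot) * h \<le> last - base \<Longrightarrow>
      k \<le> t' \<Longrightarrow> Q s' t'"
  shows "wp reduce Q s t"
proof -
  let ?I = "\<lambda>s' t'. same_except {Vtop, Vrow, Vinp, Vcol} {COL} s s' \<and>
      (\<forall>i < nv s Vbot. na s' COL i = na s COL i) \<and>
      stack_inv h (na s' COL) (nv s' Vinp) (nv s' Vbot) (nv s' Vtop) \<and>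
      nv s' Vrow = base + (nv s' Vtop - nv s' Vbot) * h \<and>
      k + 1 + 12 * (nv s' Vbot - nv s' Vinp) + 3 * (nv s' Vtop - nv s' Vbot) \<le> t'"
  show ?thesis
    unfolding reduce_def
  proof (rule wp_While[where I = ?I])
    show "?I s t" using s
      by (auto simp: same_except_def stack_inv_def covers_def increasing_def in_range_def)
  next
    fix s' t' assume "?I s' t'"
    then show "bdef (NLess (Var Vinp) (Var Vbot)) s' \<and> 1 \<le> t'" by simp
  next
    fix s' t' assume I: "?I s' t'" and "\<not> beval (NLess (Var Vinp) (Var Vbot)) s'"
    then have "nv s' Vinp = nv s' Vbot" "nv s' Vbot = nv s Vbot"
      by (auto simp: stack_inv_def same_except_def)
    with I show "Q s' (t' - 1)"
      by (intro Q) (auto simp: stack_inv_def covers_def)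
  next
    fix s' t' assume I: "?I s' t'" and b: "beval (NLess (Var Vinp) (Var Vbot)) s'"
    have eq: "nv s' Vbot = nv s Vbot" "nv s' Vh = h" "nv s' Vlast = last" "ra s' = R"
      using I s by (auto simp: same_except_def)
    obtain m where m: "nv s Vbot = Suc (nv s' Vinp + m)"
      using b by (auto simp: eq less_iff_Suc_add)
    show "wp reduce_step ?I s' (t' - 1)"
      unfolding reduce_step_def wp_Seq wp_NAssign
    proof (intro conjI)
      let ?s = "nupd Vcol (neval (NAt COL (Var Vinp)) s') s'"
      let ?k = "k + 12 * m + 10"
      show "1 \<le> t' - 1" using I by (auto simp: eq m)
      show "wp reduce_pop (wp (If (NLess (Var Vlast) (Plus (Var Vrow) (Var Vh))) Skip
          (NStore COL (Var Vtop) (Var Vcol) ;; NAssign Vtop (Plus (Var Vtop) (Num 1)) ;;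
           NAssign Vrow (Plus (Var Vrow) (Var Vh))))
          (\<lambda>s t. ndef (Plus (Var Vinp) (Num 1)) s \<and> 1 \<le> t \<and>
            ?I (nupd Vinp (neval (Plus (Var Vinp) (Num 1)) s) s) (t - 1))) ?s (t' - 1 - 1)"
      proof (rule wp_reduce_pop[where h = h and k = ?k])
        fix u tu
        assume fr: "same_except {Vtop, Vrow} {} ?s u"
          and inv: "stack_inv h (na u COL) (nv u Vinp) (nv u Vbot) (nv u Vtop)"
          and row: "nv u Vrow = base + (nv u Vtop - nv u Vbot) * h"
          and nb: "nv u Vtop = nv u Vbot \<or>
            \<not> better R (nv u Vrow) (na u COL (nv u Vtop - 1)) (na u COL (nv u Vinp))"
          and tu: "?k + 3 * (nv u Vtop - nv u Vbot) \<le> tu"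
        have equ: "nv u Vbot = nv s Vbot" "nv u Vh = h" "nv u Vlast = last" "ra u = R"
          "nv u Vinp = nv s' Vinp" "na u = na s'" "nv u Vcol = na s' COL (nv s' Vinp)"
          using fr by (auto simp: same_except_def eq fun_eq_iff)
        have fr': "same_except {Vtop, Vrow, Vinp, Vcol} {COL} s u"
          using fr I by (auto simp: same_except_def)
        obtain q where q: "nv u Vtop = nv s Vbot + q"
          using inv by (auto simp: stack_inv_def equ le_iff_add)
        show "wp (If (NLess (Var Vlast) (Plus (Var Vrow) (Var Vh))) Skip
          (NStore COL (Var Vtop) (Var Vcol) ;; NAssign Vtop (Plus (Var Vtop) (Num 1)) ;;
           NAssign Vrow (Plus (Var Vrow) (Var Vh))))
          (\<lambda>s t. ndef (Plus (Var Vinp) (Num 1)) s \<and> 1 \<le> t \<and>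
            ?I (nupd Vinp (neval (Plus (Var Vinp) (Num 1)) s) s) (t - 1)) u tu"
        proof (cases "last < nv u Vrow + h")
          case True
          have "stack_inv h (na u COL) (Suc (nv u Vinp)) (nv u Vbot) (nv u Vtop)"
            using True nb row s m by (intro stack_inv_discard[OF inv]) (auto simp: equ)
          then show ?thesis
            using True fr' I tu row by (auto simp: equ q m same_except_def)
        next
          case False
          have "stack_inv h ((na u COL)(nv u Vtop := na u COL (nv u Vinp)))
              (Suc (nv u Vinp)) (nv u Vbot) (Suc (nv u Vtop))"
            using False nb row s m by (intro stack_inv_push[OF inv]) (auto simp: equ)
          then show ?thesis
            using False fr' I tu row by (auto simp: equ q m same_except_def)
        qed
      qed (use I s b m in \<open>auto simp: eq\<close>)
    qed simp
  qed
qed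

end

section \<open>Filling in rows, and the levels of SMAWK\<close>

definition scan :: cmd where
  "scan =
     While (NLess (NAt COL (Var Vpos)) (Var Vlim))
       (NAssign Vpos (Plus (Var Vpos) (Num 1)) ;;
        If (better_exp (Var Vrow) (Var Vbest) (NAt COL (Var Vpos)))
          (NAssign Vbest (NAt COL (Var Vpos)))
          Skip)"

definition fill_step :: cmd where
  "fill_step =
     NAssign Vbest (NAt COL (Var Vpos)) ;;
     If (NLess (Var Vlast) (Plus (Var Vrow) (Var Vh)))
       (NAssign Vlim (NAt COL (Minus (Var Vend) (Num 1))))
       (NAssign Vlim (NAt ARG (Plus (Var Vrow) (Var Vh)))) ;;
     scan ;;
     NStore ARG (Var Vrow) (Var Vbest) ;;
     NAssign Vrow (Plus (Var Vrow) (Plus (Var Vh) (Var Vh)))"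

definition fill :: cmd where
  "fill = While (Not (NLess (Var Vlast) (Var Vrow))) fill_step"

definition down_step :: cmd where
  "down_step =
     NStore STRIDE (Var Vk) (Var Vh) ;;
     NAssign Vinp (NAt SEG (Var Vk)) ;;
     NAssign Vbot (NAt SEG (Plus (Var Vk) (Num 1))) ;;
     NAssign Vtop (Var Vbot) ;;
     NAssign Vrow (Var Vbase) ;;
     reduce ;;
     NAssign Vk (Plus (Var Vk) (Num 1)) ;;
     NStore SEG (Plus (Var Vk) (Num 1)) (Var Vtop) ;;
     NAssign Vh (Plus (Var Vh) (Var Vh))"

definition down :: cmd where
  "down = While (Not (NLess (Var Vlast) (Plus (Var Vbase) (Var Vh)))) down_step"

definition up_step :: cmd where
  "up_step =
     NAssign Vk (Minus (Var Vk) (Num 1)) ;;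
     NAssign Vh (NAt STRIDE (Var Vk)) ;;
     NAssign Vpos (NAt SEG (Plus (Var Vk) (Num 1))) ;;
     NAssign Vend (NAt SEG (Plus (Var Vk) (Num 2))) ;;
     NAssign Vrow (Plus (Var Vbase) (Var Vh)) ;;
     fill"

definition up :: cmd where
  "up = While (NLess (Num 0) (Var Vk)) up_step"

definition init_cols :: cmd where
  "init_cols =
     While (NLess (Plus (Var Vlo) (Var Vpos)) (Var Vhi))
       (NStore COL (Var Vpos) (Plus (Var Vlo) (Var Vpos)) ;;
        NAssign Vpos (Plus (Var Vpos) (Num 1)))"

definition smawk :: cmd where
  "smawk =
     NAssign Vpos (Num 0) ;;
     init_cols ;;
     NStore SEG (Num 0) (Num 0) ;;
     NStore SEG (Num 1) (Var Vpos) ;;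
     NAssign Vk (Num 0) ;;
     NAssign Vh (Num 1) ;;
     down ;;
     up"

context row_minima
begin

text \<open>Left of the optimum the running best column may be any column passed so far. This does
  no harm: the optimum beats every column to its left when it is reached, and afterwards nothing
  beats it.\<close>

lemma wp_scan:
  assumes s: "ra s = R" "base < nv s Vrow" "nv s Vrow \<le> last"
      "covers (na s COL) a b h" "nv s Vrow \<in> rows h"
      "a \<le> nv s Vpos" "nv s Vpos \<le> e" "e < b" "na s COL e = nv s Vlim"
      "nv s Vbest = na s COL (nv s Vpos)"
      "na s COL (nv s Vpos) \<le> opt (nv s Vrow)" "opt (nv s Vrow) \<le> nv s Vlim"
      "k + 1 + 5 * (b - nv s Vpos) \<le> t"
    and Q: "\<And>s' t'. same_except {Vpos, Vbest} {} s s' \<Longrightarrow> nv s' Vpos = e \<Longrightarrow>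
      nv s' Vbest = opt (nv s Vrow) \<Longrightarrow> k + 5 * (b - e) \<le> t' \<Longrightarrow> Q s' t'"
  shows "wp scan Q s t"
proof -
  let ?col = "na s COL" and ?j = "nv s Vrow"
  let ?I = "\<lambda>s' t'. same_except {Vpos, Vbest} {} s s' \<and>
      a \<le> nv s' Vpos \<and> nv s' Vpos \<le> e \<and> lo \<le> nv s' Vbest \<and>
      nv s' Vbest \<le> ?col (nv s' Vpos) \<and> (opt ?j \<le> ?col (nv s' Vpos) \<longrightarrow> nv s' Vbest = opt ?j) \<and>
      k + 1 + 5 * (b - nv s' Vpos) \<le> t'"
  have inc: "?col i < ?col i'" if "a \<le> i" "i < i'" "i' < b" for i i'
    using s(4) that by (auto simp: covers_def increasing_def)
  have rng: "lo \<le> ?col i" "?col i < hi" if "a \<le> i" "i < b" for i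
    using s(4) that by (auto simp: covers_def in_range_def)
  obtain p where p: "opt ?j = ?col p" "a \<le> p" "p < b"
    using s(4,5) by (auto simp: covers_def)
  show ?thesis
    unfolding scan_def
  proof (rule wp_While[where I = ?I])
    show "?I s t" using s rng[of "nv s Vpos"] by (auto simp: same_except_def)
  next
    fix s' t' assume "?I s' t'"
    then show "bdef (NLess (NAt COL (Var Vpos)) (Var Vlim)) s' \<and> 1 \<le> t'" by simp
  next
    fix s' t' assume I: "?I s' t'" and b: "\<not> beval (NLess (NAt COL (Var Vpos)) (Var Vlim)) s'"
    have "nv s' Vlim = nv s Vlim" "na s' COL = ?col" using I by (auto simp: same_except_def)
    then have "?col e \<le> ?col (nv s' Vpos)" using b s by simp
    then have e: "nv s' Vpos = e" using inc[of "nv s' Vpos" e] I s by force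
    then have "nv s' Vbest = opt ?j" using I s by simp
    with I e show "Q s' (t' - 1)" by (intro Q) auto
  next
    fix s' t' assume I: "?I s' t'" and b: "beval (NLess (NAt COL (Var Vpos)) (Var Vlim)) s'"
    let ?p = "nv s' Vpos"
    have eq: "nv s' Vrow = ?j" "nv s' Vlim = ?col e" "na s' COL = ?col" "ra s' = R"
      using I s by (auto simp: same_except_def)
    have "?p \<noteq> e" using b eq by auto
    then have pe: "Suc ?p \<le> e" using I by simp
    have v: "?col ?p < ?col (Suc ?p)" "?col (Suc ?p) < hi"
      using inc[of ?p "Suc ?p"] rng[of "Suc ?p"] I s(8) pe by auto
    have cr: "k + 5 + 5 * (b - Suc ?p) + 1 \<le> t'"
    proof -
      have "b - ?p = Suc (b - Suc ?p)" using pe s(8) by simp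
      then show ?thesis using I by simp
    qed
    have step: "(if better R ?j (nv s' Vbest) (?col (Suc ?p)) then ?col (Suc ?p) else nv s' Vbest) = opt ?j"
      if le: "opt ?j \<le> ?col (Suc ?p)"
    proof (cases "opt ?j \<le> ?col ?p")
      case True
      then have "nv s' Vbest = opt ?j" "opt ?j < ?col (Suc ?p)" using I v by auto
      then show ?thesis using opt_right[OF s(2,3), of "?col (Suc ?p)"] v by auto
    next
      case False
      \<comment> \<open>The columns increase, so a scan that reaches the value \<open>opt\<close> in
        one step has landed on its position.\<close>
      have "?p < p" using inc[of p ?p] p False I s(8) by (cases p ?p rule: linorder_cases) auto
      then have "p = Suc ?p" using inc[of "Suc ?p" p] p le I by (cases "Suc ?p < p") auto
      then have o: "opt ?j = ?col (Suc ?p)" using p by simp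
      have "better R ?j (nv s' Vbest) (opt ?j)"
        using opt_left[OF s(2,3), of "nv s' Vbest"] I v o by auto
      then show ?thesis using o by simp
    qed
    let ?b = "better R ?j (nv s' Vbest) (?col (Suc ?p))"
    have bd: "bdef (better_exp (Var Vrow) (Var Vbest) (NAt COL (Var Vpos))) (nupd Vpos (Suc ?p) s')"
      using I v by (intro bdef_better_exp) (auto simp: eq)
    show "wp (NAssign Vpos (Plus (Var Vpos) (Num 1)) ;;
        If (better_exp (Var Vrow) (Var Vbest) (NAt COL (Var Vpos)))
          (NAssign Vbest (NAt COL (Var Vpos))) Skip) ?I s' (t' - 1)"
    proof (cases ?b)
      case True
      then show ?thesis using I bd step pe cr v rng[of "Suc ?p"] s(8)
        by (auto simp: eq same_except_def)
    next
      case False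
      then show ?thesis using I bd step pe cr v
        by (auto simp: eq same_except_def)
    qed
  qed
qed

text \<open>The even multiples of \<open>h\<close> are known from the coarser level; an odd one is
  scanned between the optima of its neighbours. A scan begins where the previous one ended, so all
  of them together make one pass over the columns, plus a constant for each row.\<close>

lemma wp_fill:
  assumes s: "ra s = R" "nv s Vlast = last" "nv s Vh = h" "0 < h" "base + h \<le> last"
      "nv s Vrow = base + h" "covers (na s COL) (nv s Vpos) (nv s Vend) h"
      "\<forall>j\<in>rows (2 * h). na s ARG j = opt j"
      "k + 1 + 5 * (nv s Vend - nv s Vpos) + 12 * ((last - base) div h) \<le> t"
    and Q: "\<And>s' t'. same_except {Vpos, Vbest, Vlim, Vrow} {ARG} s s' \<Longrightarrow>
      \<forall>j\<in>rows h. na s' ARG j = opt j \<Longrightarrow> k \<le> t' \<Longrightarrow> Q s' t'"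
  shows "wp fill Q s t"
proof -
  let ?col = "na s COL" and ?a = "nv s Vpos" and ?b = "nv s Vend" and ?q = "(last - base) div h"
  let ?I = "\<lambda>s' t'. same_except {Vpos, Vbest, Vlim, Vrow} {ARG} s s' \<and>
      ?a \<le> nv s' Vpos \<and> nv s' Vpos < ?b \<and>
      (\<forall>j\<in>rows (2 * h). na s' ARG j = opt j) \<and>
      (\<forall>j\<in>rows h. j < nv s' Vrow \<longrightarrow> na s' ARG j = opt j) \<and>
      (\<forall>j\<in>rows h. nv s' Vrow \<le> j \<longrightarrow> ?col (nv s' Vpos) \<le> opt j) \<and>
      (\<exists>m. nv s' Vrow = base + (2 * m + 1) * h \<and>
        k + 1 + 5 * (?b - nv s' Vpos) + 12 * (?q - 2 * m) \<le> t')"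
  have inc: "?col i < ?col i'" if "?a \<le> i" "i < i'" "i' < ?b" for i i'
    using s(7) that by (auto simp: covers_def increasing_def)
  have inc_le: "?col i \<le> ?col i'" if "?a \<le> i" "i \<le> i'" "i' < ?b" for i i'
    using inc[of i i'] that by (cases "i = i'") auto
  have in_cols: "\<exists>p. opt j = ?col p \<and> ?a \<le> p \<and> p < ?b" if "j \<in> rows h" for j
    using s(7) that by (force simp: covers_def)
  have rows_h: "base + h \<in> rows h" using s by (simp add: rows_def)
  have rows_cases: "j < base + (2 * m + 1) * h \<or> j = base + (2 * m + 1) * h \<or>
      base + (2 * m + 1) * h + h \<le> j" if jr: "j \<in> rows h" for j m
  proof -
    obtain q where q: "j = base + q * h" using rowsE[OF jr] by blast
    have "q < 2 * m + 1 \<or> q = 2 * m + 1 \<or> Suc (2 * m + 1) \<le> q" by linarith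
    then show ?thesis
    proof (elim disjE)
      assume "q < 2 * m + 1"
      then have "q * h < (2 * m + 1) * h" using \<open>0 < h\<close> by (rule mult_less_mono1)
      then show ?thesis using q by simp
    next
      assume "Suc (2 * m + 1) \<le> q"
      then have "Suc (2 * m + 1) * h \<le> q * h" by (rule mult_le_mono1)
      then show ?thesis using q by simp
    qed (use q in simp)
  qed
  show ?thesis
    unfolding fill_def
  proof (rule wp_While[where I = ?I])
    have "?a < ?b" using in_cols[OF rows_h] by auto
    moreover have "\<exists>m. nv s Vrow = base + (2 * m + 1) * h \<and>
        k + 1 + 5 * (?b - nv s Vpos) + 12 * (?q - 2 * m) \<le> t"
      by (rule exI[of _ 0]) (use s in auto)
    moreover have "?col ?a \<le> opt j" if "j \<in> rows h" for j
      using in_cols[OF that] inc_le by auto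
    moreover have "\<not> j < base + h" if "j \<in> rows h" for j
      using rows_cases[of j 0] that \<open>0 < h\<close> unfolding rows_def by (auto dest: dvd_imp_le)
    ultimately show "?I s t" using s by (auto simp: same_except_def)
  next
    fix s' t' assume "?I s' t'"
    then show "bdef (Not (NLess (Var Vlast) (Var Vrow))) s' \<and> 1 \<le> t'" by auto
  next
    fix s' t' assume I: "?I s' t'" and b: "\<not> beval (Not (NLess (Var Vlast) (Var Vrow))) s'"
    have "nv s' Vlast = last" using I s by (auto simp: same_except_def)
    then have "j < nv s' Vrow" if "j \<in> rows h" for j using b that by (auto simp: rows_def)
    with I show "Q s' (t' - 1)" by (intro Q) auto
  next
    fix s' t' assume I: "?I s' t'" and b: "beval (Not (NLess (Var Vlast) (Var Vrow))) s'"
    have eq: "nv s' Vlast = last" "nv s' Vh = h" "nv s' Vend = ?b" "na s' COL = ?col" "ra s' = R"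
      using I s by (auto simp: same_except_def)
    obtain m where m: "nv s' Vrow = base + (2 * m + 1) * h"
        "k + 1 + 5 * (?b - nv s' Vpos) + 12 * (?q - 2 * m) \<le> t'"
      using I by blast
    define j where "j = nv s' Vrow"
    have j: "base < j" "j \<le> last" "j \<in> rows h"
      using b \<open>0 < h\<close> by (auto simp: j_def eq m rows_def)
    \<comment> \<open>The last odd row may have no even row after it, so \<open>?q - 2 * m\<close>
      is only sure to drop by one; 12 units must suffice for an iteration apart from its
      scan.\<close>
    have "2 * m + 1 \<le> ?q"
      using j(2) \<open>0 < h\<close> by (simp add: less_eq_div_iff_mult_less_eq j_def m)
    then have cr: "k + 1 + 5 * (?b - nv s' Vpos) + 12 * (?q - 2 * Suc m) + 12 \<le> t'"
      using m(2) by simp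
    \<comment> \<open>Without a right neighbour, the scan runs to the end of the segment.\<close>
    define lim where "lim = (if last < j + h then ?col (?b - 1) else na s' ARG (j + h))"
    have next_row: "j + h \<in> rows (2 * h)" "j + h \<in> rows h" if "j + h \<le> last"
    proof -
      have "j + h - base = 2 * h * Suc m" by (simp add: j_def m)
      then show "j + h \<in> rows (2 * h)" using that j by (simp add: rows_def)
      then show "j + h \<in> rows h" unfolding rows_def by (auto dest: dvd_mult_right)
    qed
    have "\<exists>e. nv s' Vpos \<le> e \<and> e < ?b \<and> ?col e = lim \<and> opt j \<le> lim"
    proof (cases "last < j + h")
      case True
      obtain p where "opt j = ?col p" "?a \<le> p" "p < ?b" using in_cols[OF j(3)] by blast
      with I True inc_le[of p "?b - 1"] show ?thesis
        by (intro exI[of _ "?b - 1"]) (auto simp: lim_def)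
    next
      case False
      then have r: "j + h \<in> rows (2 * h)" "j + h \<in> rows h" using next_row by auto
      obtain p where p: "opt (j + h) = ?col p" "?a \<le> p" "p < ?b" using in_cols[OF r(2)] by blast
      have "?col (nv s' Vpos) \<le> ?col p" using I r(2) p by (force simp: j_def)
      then have "nv s' Vpos \<le> p" using inc[of p "nv s' Vpos"] I p by force
      then show ?thesis
        using p I r False opt_mono[of j "j + h"] j by (intro exI[of _ p]) (auto simp: lim_def)
    qed
    then obtain e where e: "nv s' Vpos \<le> e" "e < ?b" "?col e = lim" "opt j \<le> lim" by blast
    let ?s1 = "nupd Vlim lim (nupd Vbest (?col (nv s' Vpos)) s')"
    define J where "J = ?I"
    have scan: "wp scan (wp (NStore ARG (Var Vrow) (Var Vbest))
        (wp (NAssign Vrow (Plus (Var Vrow) (Plus (Var Vh) (Var Vh)))) J)) ?s1 (t' - 1 - 1 - 1 - 1)"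
    proof (rule wp_scan[where a = ?a and b = ?b and e = e and h = h and
          k = "k + 7 + 12 * (?q - 2 * Suc m)"])
      fix u tu
      assume fr: "same_except {Vpos, Vbest} {} ?s1 u" and u: "nv u Vpos = e"
        "nv u Vbest = opt (nv ?s1 Vrow)" "k + 7 + 12 * (?q - 2 * Suc m) + 5 * (?b - e) \<le> tu"
      have equ: "nv u Vrow = j" "nv u Vh = h" "na u = na s'" "nv u Vbest = opt j"
        using fr u by (auto simp: same_except_def eq fun_eq_iff j_def)
      have fr': "same_except {Vpos, Vbest, Vlim, Vrow} {ARG} s u"
        using fr I by (auto simp: same_except_def)
      have up: "?col e \<le> opt j'" if "j' \<in> rows h" "j + 2 * h \<le> j'" for j'
      proof -
        have "j + h \<le> last" using that by (auto simp: rows_def)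
        then have "?col e = opt (j + h)" using e I next_row by (simp add: lim_def)
        then show ?thesis
          using opt_mono[of "j + h" j'] that j by (auto simp: rows_def)
      qed
      have below: "((na s' ARG)(j := opt j)) j' = opt j'" if jr: "j' \<in> rows h" and "j' < j + 2 * h" for j'
      proof -
        consider "j' < j" | "j' = j" | "j + h \<le> j'"
          using rows_cases[OF jr, of m] by (auto simp: j_def m)
        then show ?thesis
        proof cases
          case 3
          have "j + h \<le> last" using 3 that(1) by (auto simp: rows_def)
          \<comment> \<open>No multiple of \<open>h\<close> lies strictly between those of
            \<open>j + h\<close> and \<open>j + 2 * h\<close>, so \<open>j'\<close> is the even row
            known beforehand.\<close>
          have "\<not> j + h < j'"
          proof
            assume "j + h < j'"
            obtain q where q: "j' = base + q * h" using rowsE[OF jr] by blast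
            have "(2 * m + 2) * h < q * h" "q * h < (2 * m + 3) * h"
              using \<open>j + h < j'\<close> that(2) by (auto simp: q j_def m algebra_simps)
            then have "2 * m + 2 < q" "q < 2 * m + 3" by (simp_all only: mult_less_cancel2)
            then show False by simp
          qed
          then show ?thesis using 3 I next_row \<open>j + h \<le> last\<close> \<open>0 < h\<close> by auto
        qed (use I that in \<open>auto simp: j_def\<close>)
      qed
      have even: "((na s' ARG)(j := opt j)) j' = opt j'" if "j' \<in> rows (2 * h)" for j'
        using I that by auto
      have row: "j + 2 * h = base + (2 * Suc m + 1) * h"
        by (simp add: j_def m)
      define w where "w = nupd Vrow (j + (h + h)) (naupd ARG j (opt j) u)"
      have w: "nv w Vpos = e" "nv w Vrow = j + 2 * h" "na w ARG = (na s' ARG)(j := opt j)"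
        by (simp_all add: w_def equ u(1))
      have "same_except {Vpos, Vbest, Vlim, Vrow} {ARG} s w"
        using fr' by (auto simp: same_except_def w_def)
      moreover have "?a \<le> e" using e(1) I by linarith
      moreover have "k + 1 + 5 * (?b - e) + 12 * (?q - 2 * Suc m) \<le> tu - 2"
        using u(3) by linarith
      then have "\<exists>m'. nv w Vrow = base + (2 * m' + 1) * h \<and>
          k + 1 + 5 * (?b - nv w Vpos) + 12 * (?q - 2 * m') \<le> tu - 2"
        unfolding w row by (intro exI[of _ "Suc m"]) simp
      ultimately have "J w (tu - 2)"
        using even below up e(2) unfolding w J_def by blast
      then show "wp (NStore ARG (Var Vrow) (Var Vbest))
        (wp (NAssign Vrow (Plus (Var Vrow) (Plus (Var Vh) (Var Vh)))) J) u tu"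
        using u(3) by (simp add: equ w_def numeral_2_eq_2)
    qed (use s I j e cr in \<open>auto simp: eq j_def\<close>)
    have "nv s' Vpos < ?b" using I by blast
    moreover obtain d where "t' = d + 13" using cr le_Suc_ex[of 13 t'] by auto
    ultimately have "wp fill_step J s' (t' - 1)"
      unfolding fill_step_def using scan
      by (cases "last < j + h") (simp_all add: eq lim_def j_def)
    then show "wp fill_step ?I s' (t' - 1)" unfolding J_def .
  qed
qed

lemma rows_mono: "h dvd h' \<Longrightarrow> rows h' \<subseteq> rows h"
  unfolding rows_def by (auto intro: dvd_trans)

lemma covers_mono: "h dvd h' \<Longrightarrow> covers col a b h \<Longrightarrow> covers col a b h'"
  unfolding covers_def using rows_mono by blast

lemma covers_cong: "(\<And>i. i < b \<Longrightarrow> col' i = col i) \<Longrightarrow> covers col a b h \<Longrightarrow> covers col' a b h"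
  unfolding covers_def increasing_def in_range_def
  by (auto simp: image_iff)

text \<open>
  Segment \<open>i + 1\<close> of \<open>COL\<close> holds the columns that survive the reduction for the rows of stride
  \<open>2 ^ i\<close>; segment \<open>0\<close> holds all columns.
\<close>

definition levels :: "nat \<Rightarrow> (nat \<Rightarrow> nat) \<Rightarrow> (nat \<Rightarrow> nat) \<Rightarrow> (nat \<Rightarrow> nat) \<Rightarrow> bool" where
  "levels K col seg stride \<longleftrightarrow>
     (\<forall>i<K. stride i = 2 ^ i \<and> base + 2 ^ i \<le> last \<and>
        seg (i + 2) - seg (i + 1) \<le> (last - base) div 2 ^ i) \<and>
     (\<forall>i\<le>K. seg i \<le> seg (i + 1) \<and> seg (i + 1) \<le> seg (K + 1) \<and>
        covers col (seg i) (seg (i + 1)) (2 ^ (i - 1)))"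

lemma levels_Suc:
  assumes lev: "levels K col seg stride" and "base + 2 ^ K \<le> last"
    and col: "\<And>i. i < seg (K + 1) \<Longrightarrow> col' i = col i"
    and cov: "covers col' (seg (K + 1)) e (2 ^ K)"
    and e: "seg (K + 1) \<le> e" "e - seg (K + 1) \<le> (last - base) div 2 ^ K"
  shows "levels (Suc K) col' (seg(K + 2 := e)) (stride(K := 2 ^ K))"
proof -
  have "covers col' (seg i) (seg (i + 1)) (2 ^ (i - 1))" if "i \<le> K" for i
    using lev that by (intro covers_cong[OF col]) (auto simp: levels_def intro: less_le_trans)
  moreover have "seg (i + 1) \<le> e" if "i \<le> K" for i
    using lev that e(1) by (auto simp: levels_def intro: order_trans)
  ultimately show ?thesis
    using lev assms(2) cov e unfolding levels_def by (auto simp: less_Suc_eq le_Suc_eq)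
qed

text \<open>On a level with \<open>q\<close> rows, \<open>10 * q\<close> pays for overhead,
  \<open>12 * q\<close> for reducing the at most \<open>q\<close> surviving columns on the next
  level, and \<open>40 * q\<close> is saved for \<open>up\<close>. The next level has at most
  \<open>q / 2\<close> rows, so 124 is the solution of
  \<open>c = 10 + 12 + 40 + c / 2\<close>.\<close>

lemma wp_down:
  assumes s: "ra s = R" "nv s Vbase = base" "nv s Vlast = last" "nv s Vk = 0" "nv s Vh = 1"
      "levels 0 (na s COL) (na s SEG) (na s STRIDE)"
      "k + 2 + 12 * (na s SEG 1 - na s SEG 0) + 124 * (last - base) \<le> t"
    and Q: "\<And>s' t'. same_except {Vk, Vh, Vtop, Vrow, Vinp, Vcol, Vbot} {COL, SEG, STRIDE} s s' \<Longrightarrow>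
      levels (nv s' Vk) (na s' COL) (na s' SEG) (na s' STRIDE) \<Longrightarrow> last < base + 2 ^ nv s' Vk \<Longrightarrow>
      k + 40 * (\<Sum>i<nv s' Vk. (last - base) div 2 ^ i) \<le> t' \<Longrightarrow> Q s' t'"
  shows "wp down Q s t"
proof -
  let ?R = "last - base"
  let ?I = "\<lambda>s' t'. same_except {Vk, Vh, Vtop, Vrow, Vinp, Vcol, Vbot} {COL, SEG, STRIDE} s s' \<and>
      nv s' Vh = 2 ^ nv s' Vk \<and>
      levels (nv s' Vk) (na s' COL) (na s' SEG) (na s' STRIDE) \<and>
      k + 1 + 12 * (na s' SEG (nv s' Vk + 1) - na s' SEG (nv s' Vk)) + 124 * (?R div 2 ^ nv s' Vk) +
        40 * (\<Sum>i<nv s' Vk. ?R div 2 ^ i) \<le> t'"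
  show ?thesis
    unfolding down_def
  proof (rule wp_While[where I = ?I])
    show "?I s t" using s by (simp add: same_except_def)
  next
    fix s' t' assume "?I s' t'"
    then show "bdef (Not (NLess (Var Vlast) (Plus (Var Vbase) (Var Vh)))) s' \<and> 1 \<le> t'" by simp
  next
    fix s' t' assume I: "?I s' t'"
      and b: "\<not> beval (Not (NLess (Var Vlast) (Plus (Var Vbase) (Var Vh)))) s'"
    have "nv s' Vlast = last" "nv s' Vbase = base" using I s by (auto simp: same_except_def)
    then have "last < base + 2 ^ nv s' Vk" using b I by simp
    with I show "Q s' (t' - 1)" by (intro Q) auto
  next
    fix s' t' assume I: "?I s' t'"
      and b: "beval (Not (NLess (Var Vlast) (Plus (Var Vbase) (Var Vh)))) s'"
    define K where "K = nv s' Vk"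
    define h where "h = (2::nat) ^ K"
    define J where "J = ?I"
    have eq: "nv s' Vlast = last" "nv s' Vbase = base" "ra s' = R" "nv s' Vh = h" "nv s' Vk = K"
      using I s by (auto simp: same_except_def h_def K_def)
    have lev: "levels K (na s' COL) (na s' SEG) (na s' STRIDE)" using I by (simp add: K_def)
    have h: "base + h \<le> last" "0 < h" using b eq by (auto simp: h_def)
    have cr: "k + 1 + 12 * (na s' SEG (Suc K) - na s' SEG K) + 124 * (?R div h) +
        40 * (\<Sum>i<K. ?R div 2 ^ i) \<le> t'"
      using I by (simp add: K_def h_def)
    \<comment> \<open>Every level entered has a row, so constant overhead can be charged to its
      rows.\<close>
    have q1: "1 \<le> ?R div h" using h by (simp add: less_eq_div_iff_mult_less_eq)
    have q2: "2 * (?R div (2 * h)) \<le> ?R div h"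
      by (metis div_mult2_eq mult.commute times_div_less_eq_dividend)
    let ?s1 = "nupd Vrow base (nupd Vtop (na s' SEG (Suc K)) (nupd Vbot (na s' SEG (Suc K))
      (nupd Vinp (na s' SEG K) (naupd STRIDE K h s'))))"
    let ?k = "k + 4 + 114 * (?R div h) + 40 * (\<Sum>i<K. ?R div 2 ^ i)"
    have "wp reduce (wp (NAssign Vk (Plus (Var Vk) (Num 1)) ;;
        NStore SEG (Plus (Var Vk) (Num 1)) (Var Vtop) ;; NAssign Vh (Plus (Var Vh) (Var Vh))) J)
      ?s1 (t' - 1 - 1 - 1 - 1 - 1 - 1)"
    proof (rule wp_reduce[where h = h and k = ?k])
      fix u tu
      assume fr: "same_except {Vtop, Vrow, Vinp, Vcol} {COL} ?s1 u"
        and col: "\<And>i. i < nv ?s1 Vbot \<Longrightarrow> na u COL i = na ?s1 COL i"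
        and cov: "covers (na u COL) (nv ?s1 Vbot) (nv u Vtop) h"
        and le: "nv ?s1 Vbot \<le> nv u Vtop" "(nv u Vtop - nv ?s1 Vbot) * h \<le> last - base"
        and tu: "?k \<le> tu"
      have equ: "nv u Vk = K" "nv u Vh = h" "na u SEG = na s' SEG" "na u STRIDE = (na s' STRIDE)(K := h)"
        using fr eq by (auto simp: same_except_def)
      define w where "w = nupd Vh (h + h) (naupd SEG (K + 2) (nv u Vtop) (nupd Vk (Suc K) u))"
      have len: "nv u Vtop - na s' SEG (Suc K) \<le> ?R div h"
        using le h by (simp add: less_eq_div_iff_mult_less_eq)
      have "levels (Suc K) (na u COL) ((na s' SEG)(K + 2 := nv u Vtop)) ((na s' STRIDE)(K := 2 ^ K))"
        by (rule levels_Suc[OF lev]) (use h col cov le len in \<open>auto simp: h_def\<close>)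
      then have "levels (nv w Vk) (na w COL) (na w SEG) (na w STRIDE)"
        by (simp add: w_def equ h_def)
      moreover have "same_except {Vk, Vh, Vtop, Vrow, Vinp, Vcol, Vbot} {COL, SEG, STRIDE} s w"
        using fr I by (auto simp: same_except_def w_def)
      moreover have "k + 1 + 12 * (nv u Vtop - na s' SEG (Suc K)) + 124 * (?R div (2 * h)) +
          40 * ((\<Sum>i<K. ?R div 2 ^ i) + ?R div h) \<le> tu - 3"
      proof -
        have "k + 1 + 12 * l + 124 * q' + 40 * (S + q) \<le> tu - 3"
          if "k + 4 + 114 * q + 40 * S \<le> tu" "2 * q' \<le> q" "l \<le> q" for l q q' S :: nat
        proof -
          have "k + 1 + 12 * l + 124 * q' + 40 * (S + q) + 3 \<le> tu"
            using that by (simp add: algebra_simps)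
          then show ?thesis by linarith
        qed
        from this[OF tu q2 len] show ?thesis .
      qed
      ultimately have "J w (tu - 3)"
        unfolding J_def by (simp add: w_def h_def equ)
      then have "J w (tu - 1 - 1 - 1)" by (simp add: numeral_3_eq_3)
      moreover obtain d where "tu = d + 4" using tu le_Suc_ex[of 4 tu] by auto
      ultimately show "wp (NAssign Vk (Plus (Var Vk) (Num 1)) ;;
        NStore SEG (Plus (Var Vk) (Num 1)) (Var Vtop) ;; NAssign Vh (Plus (Var Vh) (Var Vh))) J u tu"
        by (simp add: equ w_def)
    next
      \<comment> \<open>For \<open>K = 0\<close> the exponent truncates to 0: the segment of all
        columns already covers stride 1.\<close>
      have "covers (na s' COL) (na s' SEG K) (na s' SEG (Suc K)) (2 ^ (K - 1))"
        using lev by (simp add: levels_def)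
      then have "covers (na s' COL) (na s' SEG K) (na s' SEG (Suc K)) h"
        by (rule covers_mono[rotated]) (simp add: h_def le_imp_power_dvd)
      then show "covers (na ?s1 COL) (nv ?s1 Vinp) (nv ?s1 Vbot) h" by simp
      show "nv ?s1 Vinp \<le> nv ?s1 Vbot" using lev by (simp add: levels_def)
      show "?k + 1 + 12 * (nv ?s1 Vbot - nv ?s1 Vinp) \<le> t' - 1 - 1 - 1 - 1 - 1 - 1"
        using cr q1 by simp
    qed (use h in \<open>simp_all add: eq\<close>)
    moreover obtain d where "t' = d + 8" using cr q1 le_Suc_ex[of 8 t'] by auto
    ultimately have "wp down_step J s' (t' - 1)"
      unfolding down_step_def by (simp add: eq)
    then show "wp down_step ?I s' (t' - 1)" unfolding J_def .
  qed
qed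

text \<open>The stride has outgrown the range at the start, so there is no row and nothing to know.
  Each level then hands its optima down as the even rows of the next finer one.\<close>

lemma wp_up:
  assumes s: "ra s = R" "nv s Vbase = base" "nv s Vlast = last"
      "levels (nv s Vk) (na s COL) (na s SEG) (na s STRIDE)" "last < base + 2 ^ nv s Vk"
      "k + 1 + 40 * (\<Sum>i<nv s Vk. (last - base) div 2 ^ i) \<le> t"
    and Q: "\<And>s' t'. same_except {Vk, Vh, Vpos, Vend, Vrow, Vbest, Vlim} {ARG} s s' \<Longrightarrow>
      (\<And>j. base < j \<Longrightarrow> j \<le> last \<Longrightarrow> na s' ARG j = opt j) \<Longrightarrow> k \<le> t' \<Longrightarrow> Q s' t'"
  shows "wp up Q s t"
proof -
  let ?R = "last - base"
  let ?I = "\<lambda>s' t'. same_except {Vk, Vh, Vpos, Vend, Vrow, Vbest, Vlim} {ARG} s s' \<and>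
      nv s' Vk \<le> nv s Vk \<and> (\<forall>j\<in>rows (2 ^ nv s' Vk). na s' ARG j = opt j) \<and>
      k + 1 + 40 * (\<Sum>i<nv s' Vk. ?R div 2 ^ i) \<le> t'"
  show ?thesis
    unfolding up_def
  proof (rule wp_While[where I = ?I])
    have "rows (2 ^ nv s Vk) = {}"
      using s(5) by (auto simp: rows_def dest: dvd_imp_le)
    then show "?I s t" using s by (simp add: same_except_def)
  next
    fix s' t' assume "?I s' t'"
    then show "bdef (NLess (Num 0) (Var Vk)) s' \<and> 1 \<le> t'" by simp
  next
    fix s' t' assume I: "?I s' t'" and "\<not> beval (NLess (Num 0) (Var Vk)) s'"
    then have "nv s' Vk = 0" by simp
    with I show "Q s' (t' - 1)" by (intro Q) (auto simp: rows_def)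
  next
    fix s' t' assume I: "?I s' t'" and "beval (NLess (Num 0) (Var Vk)) s'"
    then obtain K where K: "nv s' Vk = Suc K" by (auto simp: gr0_conv_Suc)
    define h where "h = (2::nat) ^ K"
    define J where "J = ?I"
    let ?a = "na s SEG (Suc K)" and ?b = "na s SEG (Suc (Suc K))"
    have eq: "nv s' Vlast = last" "nv s' Vbase = base" "ra s' = R" "na s' COL = na s COL"
      "na s' SEG = na s SEG" "na s' STRIDE = na s STRIDE"
      using I s by (auto simp: same_except_def)
    have "K < nv s Vk" using I K by simp
    then have lev: "na s STRIDE K = h" "base + h \<le> last" "?b - ?a \<le> ?R div h"
      "covers (na s COL) ?a ?b h"
      using s(4) by (auto simp: levels_def h_def dest: spec[of _ K] spec[of _ "Suc K"])
    have cr: "k + 1 + 40 * (\<Sum>i<K. ?R div 2 ^ i) + 40 * (?R div h) \<le> t'"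
      using I by (simp add: K h_def)
    have q1: "1 \<le> ?R div h" using lev(2) by (simp add: less_eq_div_iff_mult_less_eq h_def)
    let ?s1 = "nupd Vrow (base + h) (nupd Vend ?b (nupd Vpos ?a (nupd Vh h (nupd Vk K s'))))"
    have "wp fill J ?s1 (t' - 1 - 1 - 1 - 1 - 1 - 1)"
    proof (rule wp_fill[where h = h and k = "k + 1 + 40 * (\<Sum>i<K. ?R div 2 ^ i)"])
      fix u tu
      assume fr: "same_except {Vpos, Vbest, Vlim, Vrow} {ARG} ?s1 u"
        and arg: "\<forall>j\<in>rows h. na u ARG j = opt j"
        and tu: "k + 1 + 40 * (\<Sum>i<K. ?R div 2 ^ i) \<le> tu"
      have "nv u Vk = K" using fr by (auto simp: same_except_def)
      moreover have "same_except {Vk, Vh, Vpos, Vend, Vrow, Vbest, Vlim} {ARG} s u"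
        using fr I by (auto simp: same_except_def)
      ultimately show "J u tu"
        unfolding J_def using arg tu \<open>K < nv s Vk\<close> by (simp add: h_def)
    next
      show "\<forall>j\<in>rows (2 * h). na ?s1 ARG j = opt j" using I by (simp add: K h_def)
      show "k + 1 + 40 * (\<Sum>i<K. ?R div 2 ^ i) + 1 + 5 * (nv ?s1 Vend - nv ?s1 Vpos) +
          12 * (?R div h) \<le> t' - 1 - 1 - 1 - 1 - 1 - 1"
        using cr q1 lev(3) by simp
    qed (use lev in \<open>simp_all add: eq h_def\<close>)
    moreover obtain d where "t' = d + 8" using cr q1 le_Suc_ex[of 8 t'] by auto
    ultimately have "wp up_step J s' (t' - 1)"
      unfolding up_step_def by (simp add: eq K lev numeral_2_eq_2)
    then show "wp up_step ?I s' (t' - 1)" unfolding J_def .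
  qed
qed

lemma wp_init_cols:
  assumes s: "nv s Vpos = 0" "k + 1 + 3 * (nv s Vhi - nv s Vlo) \<le> t"
    and Q: "\<And>s' t'. same_except {Vpos} {COL} s s' \<Longrightarrow> nv s' Vpos = nv s Vhi - nv s Vlo \<Longrightarrow>
      (\<And>i. i < nv s' Vpos \<Longrightarrow> na s' COL i = nv s Vlo + i) \<Longrightarrow> k \<le> t' \<Longrightarrow> Q s' t'"
  shows "wp init_cols Q s t"
proof -
  let ?n = "nv s Vhi - nv s Vlo"
  let ?I = "\<lambda>s' t'. same_except {Vpos} {COL} s s' \<and> nv s' Vpos \<le> ?n \<and>
    (\<forall>i < nv s' Vpos. na s' COL i = nv s Vlo + i) \<and> k + 1 + 3 * (?n - nv s' Vpos) \<le> t'"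
  show ?thesis
    unfolding init_cols_def
  proof (rule wp_While[where I = ?I])
    show "?I s t" using s by (simp add: same_except_def)
  next
    fix s' t' assume "?I s' t'"
    then show "bdef (NLess (Plus (Var Vlo) (Var Vpos)) (Var Vhi)) s' \<and> 1 \<le> t'" by simp
  next
    fix s' t' assume I: "?I s' t'" and b: "\<not> beval (NLess (Plus (Var Vlo) (Var Vpos)) (Var Vhi)) s'"
    then have "nv s' Vpos = ?n" by (auto simp: same_except_def)
    with I show "Q s' (t' - 1)" by (intro Q) auto
  next
    fix s' t' assume I: "?I s' t'" and b: "beval (NLess (Plus (Var Vlo) (Var Vpos)) (Var Vhi)) s'"
    have eq: "nv s' Vlo = nv s Vlo" "nv s' Vhi = nv s Vhi" using I by (auto simp: same_except_def)
    obtain m where m: "?n = Suc (nv s' Vpos + m)"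
      using b less_iff_Suc_add[of "nv s' Vpos" ?n] by (auto simp: eq)
    show "wp (NStore COL (Var Vpos) (Plus (Var Vlo) (Var Vpos)) ;;
        NAssign Vpos (Plus (Var Vpos) (Num 1))) ?I s' (t' - 1)"
      using I by (auto simp: m eq same_except_def less_Suc_eq)
  qed
qed

text \<open>Of the 15 units for each column, 3 pay for writing it to \<open>COL\<close> and 12 for
  the first reduction. All later work is bounded by the number of rows.\<close>

lemma wp_smawk:
  assumes s: "ra s = R" "nv s Vbase = base" "nv s Vlast = last" "nv s Vlo = lo" "nv s Vhi = hi"
      "k + 20 + 15 * (hi - lo) + 124 * (last - base) \<le> t"
    and Q: "\<And>s' t'. same_except {Vk, Vh, Vtop, Vrow, Vinp, Vcol, Vbot, Vpos, Vend, Vbest, Vlim}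
        {COL, SEG, STRIDE, ARG} s s' \<Longrightarrow>
      (\<And>j. base < j \<Longrightarrow> j \<le> last \<Longrightarrow> na s' ARG j = opt j) \<Longrightarrow> k \<le> t' \<Longrightarrow> Q s' t'"
  shows "wp smawk Q s t"
proof -
  let ?s1 = "nupd Vpos 0 s"
  have "wp init_cols (wp (NStore SEG (Num 0) (Num 0) ;; NStore SEG (Num 1) (Var Vpos) ;;
      NAssign Vk (Num 0) ;; NAssign Vh (Num 1) ;; down ;; up) Q) ?s1 (t - 1)"
  proof (rule wp_init_cols[where k = "k + 10 + 12 * (hi - lo) + 124 * (last - base)"])
    fix u tu
    assume fr: "same_except {Vpos} {COL} ?s1 u" and pos: "nv u Vpos = nv ?s1 Vhi - nv ?s1 Vlo"
      and col: "\<And>i. i < nv u Vpos \<Longrightarrow> na u COL i = nv ?s1 Vlo + i"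
      and tu: "k + 10 + 12 * (hi - lo) + 124 * (last - base) \<le> tu"
    let ?u = "nupd Vh 1 (nupd Vk 0 (naupd SEG 1 (hi - lo) (naupd SEG 0 0 u)))"
    have pos': "nv u Vpos = hi - lo" using pos s by simp
    have col': "na u COL i = lo + i" if "i < hi - lo" for i using col[of i] pos' that s by simp
    have "covers (na u COL) 0 (hi - lo) 1"
      unfolding covers_def
    proof (intro conjI ballI)
      show "increasing (na u COL) 0 (hi - lo)" using col' by (simp add: increasing_def)
      show "in_range (na u COL) 0 (hi - lo)" using col' by (auto simp: in_range_def)
      fix j assume "j \<in> rows 1"
      then have "lo \<le> opt j" "opt j < hi" using opt_ge opt_less by (auto simp: rows_def)
      then have "opt j = na u COL (opt j - lo)" "opt j - lo < hi - lo" using col' by auto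
      then show "opt j \<in> na u COL ` {0..<hi - lo}" by (metis atLeastLessThan_iff imageI zero_le)
    qed
    then have lev: "levels 0 (na ?u COL) (na ?u SEG) (na ?u STRIDE)"
      by (simp add: levels_def)
    have "wp down (wp up Q) ?u (tu - 1 - 1 - 1 - 1)"
    proof (rule wp_down[where k = "k + 1"])
      fix v tv
      assume frv: "same_except {Vk, Vh, Vtop, Vrow, Vinp, Vcol, Vbot} {COL, SEG, STRIDE} ?u v"
        and v: "levels (nv v Vk) (na v COL) (na v SEG) (na v STRIDE)" "last < base + 2 ^ nv v Vk"
          "k + 1 + 40 * (\<Sum>i<nv v Vk. (last - base) div 2 ^ i) \<le> tv"
      show "wp up Q v tv"
      proof (rule wp_up[where k = k])
        fix w tw
        assume frw: "same_except {Vk, Vh, Vpos, Vend, Vrow, Vbest, Vlim} {ARG} v w"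
          and w: "\<And>j. base < j \<Longrightarrow> j \<le> last \<Longrightarrow> na w ARG j = opt j" "k \<le> tw"
        have "same_except {Vk, Vh, Vtop, Vrow, Vinp, Vcol, Vbot, Vpos, Vend, Vbest, Vlim}
            {COL, SEG, STRIDE, ARG} s w"
          using fr frv frw by (auto simp: same_except_def)
        with w show "Q w tw" by (intro Q) auto
      qed (use v frv fr s in \<open>auto simp: same_except_def\<close>)
    qed (use lev tu fr s in \<open>auto simp: same_except_def\<close>)
    moreover obtain d where "tu = d + 10" using tu le_Suc_ex[of 10 tu] by auto
    ultimately show "wp (NStore SEG (Num 0) (Num 0) ;; NStore SEG (Num 1) (Var Vpos) ;;
      NAssign Vk (Num 0) ;; NAssign Vh (Num 1) ;; down ;; up) Q u tu"
      by (simp add: pos')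
  qed (use s in auto)
  then show ?thesis
    unfolding smawk_def using s(6) by simp
qed

end

section \<open>The dynamic program\<close>

definition prefix_loop :: cmd where
  "prefix_loop =
     While (NLess (Var Vj) Len)
       (RStore PSUM (Plus (Var Vj) (Num 1)) (RPlus (RAt PSUM (Var Vj)) (RAt PTS (Var Vj))) ;;
        RStore PSQ (Plus (Var Vj) (Num 1))
          (RPlus (RAt PSQ (Var Vj)) (RTimes (RAt PTS (Var Vj)) (RAt PTS (Var Vj)))) ;;
        NAssign Vj (Plus (Var Vj) (Num 1)))"

definition init :: cmd where
  "init =
     RStore PSUM (Num 0) (RNum 0) ;;
     RStore PSQ (Num 0) (RNum 0) ;;
     RStore OPT (Num 0) (RNum 0) ;;
     NAssign Vj (Num 0) ;;
     prefix_loop"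

definition tentative :: cmd where
  "tentative =
     While (NLess (Var Vj) (Var Vp))
       (NAssign Vj (Plus (Var Vj) (Num 1)) ;;
        RStore OPT (Var Vj) (RPlus (cost_exp (NAt ARG (Var Vj)) (Var Vj)) Lam) ;;
        NStore BEST (Var Vj) (NAt ARG (Var Vj)))"

definition improves :: bexp where
  "improves = RLess (RPlus (cost_exp (NAt ARG (Var Vj)) (Var Vj)) Lam) (RAt OPT (Var Vj))"

definition search :: cmd where
  "search =
     While (And (Not (NLess (Var Vp) (Var Vj))) (Not improves))
       (NAssign Vj (Plus (Var Vj) (Num 1)))"

text \<open>Row \<open>c + 1\<close> has no start beyond \<open>c\<close>, so its tentative value is
  final and the search begins at \<open>c + 2\<close>.\<close>

definition commit :: cmd where
  "commit =
     NAssign Vj (Plus (Var Vc) (Num 2)) ;;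
     search ;;
     If (NLess (Var Vp) (Var Vj))
       (NAssign Vc (Var Vp))
       (RStore OPT (Var Vj) (RPlus (cost_exp (NAt ARG (Var Vj)) (Var Vj)) Lam) ;;
        NStore BEST (Var Vj) (NAt ARG (Var Vj)) ;;
        NAssign Vr (Plus (Var Vc) (Num 1)) ;;
        NAssign Vc (Var Vj))"

definition extend :: cmd where
  "extend =
     NAssign Vj (Var Vc) ;;
     tentative ;;
     NAssign Vbase (Plus (Var Vc) (Num 1)) ;;
     NAssign Vlo (Plus (Var Vc) (Num 1)) ;;
     NAssign Vhi (Var Vp) ;;
     smawk ;;
     commit"

definition wilber_step :: cmd where
  "wilber_step =
     NAssign Vp (Minus (Plus (Plus (Var Vc) (Var Vc)) (Num 1)) (Var Vr)) ;;
     If (NLess Len (Var Vp)) (NAssign Vp Len) Skip ;;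
     NAssign Vbase (Var Vc) ;;
     NAssign Vlast (Var Vp) ;;
     NAssign Vlo (Var Vr) ;;
     NAssign Vhi (Plus (Var Vc) (Num 1)) ;;
     smawk ;;
     extend"

definition wilber :: cmd where
  "wilber = While (NLess (Var Vc) Len) wilber_step"

text \<open>Means come from prefix sums alone. The points can therefore be overwritten by the
  centres, which have to end up in the initial segment of the memory.\<close>

definition mean_exp :: "nexp \<Rightarrow> nexp \<Rightarrow> rexp" where
  "mean_exp i j = RDivide (RMinus (RAt PSUM j) (RAt PSUM i)) (RMinus (OfNat j) (OfNat i))"

text \<open>
  Coinciding means can occur for \<open>\<lambda> = 0\<close>. They are adjacent, and only one of them is written.
\<close>

definition trace_step :: cmd where
  "trace_step =
     NAssign Vi (NAt BEST (Var Vj)) ;;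
     If (And (NLess (Num 0) (Var Vk))
          (Not (RLess (mean_exp (Var Vi) (Var Vj)) (RAt PTS (Minus (Var Vk) (Num 1))))))
       Skip
       (RStore PTS (Var Vk) (mean_exp (Var Vi) (Var Vj)) ;;
        NAssign Vk (Plus (Var Vk) (Num 1))) ;;
     NAssign Vj (Var Vi)"

definition trace :: cmd where
  "trace = While (NLess (Num 0) (Var Vj)) trace_step"

definition kmeans :: cmd where
  "kmeans =
     init ;;
     NAssign Vc (Num 0) ;;
     NAssign Vr (Num 0) ;;
     wilber ;;
     NAssign Vj Len ;;
     NAssign Vk (Num 0) ;;
     trace"

section \<open>Total monotonicity and the correctness of a round\<close>

lemma val_cong:
  "R' PSUM = R PSUM \<Longrightarrow> R' PSQ = R PSQ \<Longrightarrow> R' OPT i = R OPT i \<Longrightarrow> val R' i j = val R i j"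
  by (simp add: val_def)

locale instance_1d = machine N lam for N lam +
  fixes x :: "nat \<Rightarrow> real"
  assumes sorted: "i \<le> j \<Longrightarrow> j < N \<Longrightarrow> x i \<le> x j"
    and lam_nonneg: "0 \<le> lam" and N_pos: "0 < N"
begin

definition sums_ok :: "(rarr \<Rightarrow> nat \<Rightarrow> real) \<Rightarrow> bool" where
  "sums_ok R \<longleftrightarrow> (\<forall>j\<le>N. R PSUM j = (\<Sum>l<j. x l) \<and> R PSQ j = (\<Sum>l<j. (x l)\<^sup>2))"

lemma sums_ok_cong: "R' PSUM = R PSUM \<Longrightarrow> R' PSQ = R PSQ \<Longrightarrow> sums_ok R' \<longleftrightarrow> sums_ok R"
  by (simp add: sums_ok_def)

lemma sum_diff_lessThan:
  fixes f :: "nat \<Rightarrow> real"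
  shows "i \<le> j \<Longrightarrow> (\<Sum>l<j. f l) - (\<Sum>l<i. f l) = (\<Sum>l=i..<j. f l)"
  using sum_diff_nat_ivl[of 0 i j f] by (simp add: atLeast0LessThan)

lemma val_eq:
  assumes "sums_ok R" "i < j" "j \<le> N"
  shows "val R i j = R OPT i + sse x i j"
  using assms by (simp add: val_def sums_ok_def sse_def sum_diff_lessThan)

text \<open>Nothing is assumed about \<open>R OPT\<close>: as a column constant it appears on both
  sides of the quadrangle inequality and cancels. Tentative values are as good as final ones
  here.\<close>

lemma sums_ok_better_mono:
  assumes R: "sums_ok R" and b: "better R j a b" and "a < b" "j \<le> j'" "j' \<le> N"
  shows "better R j' a b"
proof -
  have "b < j" using b by (simp add: better_def)
  then have "sse x a j + sse x b j' \<le> sse x a j' + sse x b j"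
    using assms by (intro sse_monge[OF sorted]) auto
  moreover have "R OPT b + sse x b j < R OPT a + sse x a j"
    using b \<open>b < j\<close> assms by (simp add: better_def val_eq)
  ultimately show ?thesis
    using \<open>b < j\<close> assms by (simp add: better_def val_eq)
qed

text \<open>Take the least index attaining the minimum among the columns below \<open>j\<close>.
  Columns from \<open>j\<close> on never count as better.\<close>

lemma leftmost_optimum:
  assumes "lo < hi" "lo < j"
  shows "\<exists>i. lo \<le> i \<and> i < hi \<and> (\<forall>a. lo \<le> a \<longrightarrow> a < i \<longrightarrow> better R j a i) \<and>
    (\<forall>a. i < a \<longrightarrow> a < hi \<longrightarrow> \<not> better R j i a)"
proof -
  let ?S = "{i. lo \<le> i \<and> i < hi \<and> i < j}"
  have S: "finite ?S" "?S \<noteq> {}" using assms by auto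
  define m where "m = Min ((\<lambda>i. val R i j) ` ?S)"
  define i where "i = (LEAST i. i \<in> ?S \<and> val R i j = m)"
  have "m \<in> (\<lambda>i. val R i j) ` ?S"
    unfolding m_def using S by (intro Min_in) auto
  then have "\<exists>i. i \<in> ?S \<and> val R i j = m" by auto
  then have i: "i \<in> ?S" "val R i j = m"
    unfolding i_def by (metis (mono_tags, lifting) LeastI_ex)+
  have ge: "m \<le> val R a j" if "a \<in> ?S" for a
    unfolding m_def using S that by (intro Min_le) auto
  have "val R a j \<noteq> m" if "a \<in> ?S" "a < i" for a
    using that not_less_Least[of a "\<lambda>i. i \<in> ?S \<and> val R i j = m"] by (auto simp: i_def)
  then have "better R j a i" if "lo \<le> a" "a < i" for a
    using that i ge[of a] by (force simp: better_def)
  moreover have "\<not> better R j i a" if "i < a" "a < hi" for a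
    using that i ge[of a] by (auto simp: better_def)
  ultimately show ?thesis using i by blast
qed

text \<open>The premise \<open>lo < hi\<close> is conditional because the second run of a round with
  a single new row has neither rows nor columns. That \<open>opt j < j\<close> follows since column
  \<open>lo\<close> lies below every row, and a column that beats it does so by the definition of
  \<open>better\<close>.\<close>

lemma row_minima_exists:
  fixes last :: nat
  assumes "sums_ok R" "last \<le> N" "base < last \<Longrightarrow> lo < hi" "lo \<le> base"
  obtains opt where "row_minima R lo hi base last opt"
    "\<And>j. base < j \<Longrightarrow> j \<le> last \<Longrightarrow> lo \<le> opt j \<and> opt j < hi \<and> opt j < j"
    "\<And>j a. base < j \<Longrightarrow> j \<le> last \<Longrightarrow> lo \<le> a \<Longrightarrow> a < hi \<Longrightarrow> a < j \<Longrightarrow> val R (opt j) j \<le> val R a j"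
proof -
  let ?P = "\<lambda>j i. lo \<le> i \<and> i < hi \<and> (\<forall>a. lo \<le> a \<longrightarrow> a < i \<longrightarrow> better R j a i) \<and>
    (\<forall>a. i < a \<longrightarrow> a < hi \<longrightarrow> \<not> better R j i a)"
  have "\<exists>i. base < j \<and> j \<le> last \<longrightarrow> ?P j i" for j
  proof (cases "base < j \<and> j \<le> last")
    case True
    then have "lo < hi" "lo < j" using assms by auto
    from leftmost_optimum[OF this, of R] show ?thesis by blast
  qed blast
  then obtain opt where opt: "?P j (opt j)" if "base < j" "j \<le> last" for j
    by metis
  show thesis
  proof (rule that)
    show "row_minima R lo hi base last opt"
    proof
      fix j a b j'
      assume "better R j a b" "a < b" "j \<le> j'" "j' \<le> last"
      then show "better R j' a b" using sums_ok_better_mono[OF assms(1)] assms(2) by simp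
    qed (use opt in blast)+
  next
    fix j assume j: "base < j" "j \<le> last"
    have "opt j < j"
    proof (cases "opt j = lo")
      case True
      then show ?thesis using j assms by simp
    next
      case False
      then have "better R j lo (opt j)" using opt[OF j] by auto
      then show ?thesis by (simp add: better_def)
    qed
    then show "lo \<le> opt j \<and> opt j < hi \<and> opt j < j" using opt[OF j] by simp
  next
    fix j a assume j: "base < j" "j \<le> last" "lo \<le> a" "a < hi" "a < j"
    then show "val R (opt j) j \<le> val R a j"
      using opt[OF j(1,2)] by (cases a "opt j" rule: linorder_cases) (force simp: better_def)+
  qed
qed

definition dp_ok :: "(rarr \<Rightarrow> nat \<Rightarrow> real) \<Rightarrow> (nat \<Rightarrow> nat) \<Rightarrow> nat \<Rightarrow> bool" where
  "dp_ok R best c \<longleftrightarrow> R OPT 0 = 0 \<and>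
     (\<forall>j. 0 < j \<longrightarrow> j \<le> c \<longrightarrow> best j < j \<and> R OPT j = val R (best j) j + lam \<and>
       (\<forall>i<j. R OPT j \<le> val R i j + lam))"

lemma dp_okD:
  assumes "dp_ok R best c" "0 < j" "j \<le> c"
  shows "best j < j" "R OPT j = val R (best j) j + lam" "i < j \<Longrightarrow> R OPT j \<le> val R i j + lam"
  using assms unfolding dp_ok_def by blast+

text \<open>A discarded column needs only to be matched in value, and the live column that matches
  it may vary with the row.\<close>

definition candidates_ok :: "(rarr \<Rightarrow> nat \<Rightarrow> real) \<Rightarrow> nat \<Rightarrow> nat \<Rightarrow> bool" where
  "candidates_ok R r c \<longleftrightarrow> r \<le> c \<and>
     (\<forall>j i. c < j \<longrightarrow> j \<le> N \<longrightarrow> i < r \<longrightarrow> (\<exists>i'. r \<le> i' \<and> i' \<le> c \<and> val R i' j \<le> val R i j))"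

end

text \<open>\<open>R\<close> and \<open>best\<close> are the tables before the tentative values are
  written, \<open>R'\<close> and \<open>best'\<close> after it; \<open>opt\<close> and
  \<open>opt'\<close> are the results of the two runs of SMAWK.\<close>

locale wilber_round = instance_1d N lam x for N lam x +
  fixes R R' :: "rarr \<Rightarrow> nat \<Rightarrow> real" and best best' opt opt' :: "nat \<Rightarrow> nat" and r c p :: nat
  assumes sums: "sums_ok R" and dp: "dp_ok R best c" and cand: "candidates_ok R r c"
    and cp: "c < p" "p \<le> N"
    and same: "R' PSUM = R PSUM" "R' PSQ = R PSQ" "\<And>j. j \<le> c \<Longrightarrow> R' OPT j = R OPT j"
      "\<And>j. j \<le> c \<Longrightarrow> best' j = best j"
    and new: "\<And>j. c < j \<Longrightarrow> j \<le> p \<Longrightarrow> R' OPT j = val R (opt j) j + lam \<and> best' j = opt j"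
    and opt: "\<And>j. c < j \<Longrightarrow> j \<le> p \<Longrightarrow> opt j \<le> c"
      "\<And>j i. c < j \<Longrightarrow> j \<le> p \<Longrightarrow> r \<le> i \<Longrightarrow> i \<le> c \<Longrightarrow> val R (opt j) j \<le> val R i j"
    and opt': "\<And>j. Suc c < j \<Longrightarrow> j \<le> p \<Longrightarrow> c < opt' j \<and> opt' j < j"
      "\<And>j i. Suc c < j \<Longrightarrow> j \<le> p \<Longrightarrow> c < i \<Longrightarrow> i < j \<Longrightarrow> val R' (opt' j) j \<le> val R' i j"
begin

lemma val_old: "i \<le> c \<Longrightarrow> val R' i j = val R i j"
  using same by (intro val_cong) auto

text \<open>Columns below \<open>r\<close> were never offered to SMAWK; a live candidate stands in
  for them.\<close>

lemma tentative_le_old: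
  assumes "c < j" "j \<le> p" "i \<le> c"
  shows "R' OPT j \<le> val R' i j + lam"
proof (cases "r \<le> i")
  case True
  then show ?thesis using assms opt(2)[of j i] new[of j] val_old[of i j] by simp
next
  case False
  then obtain i' where "r \<le> i'" "i' \<le> c" "val R i' j \<le> val R i j"
    using cand assms cp unfolding candidates_ok_def by (metis le_trans not_le)
  then show ?thesis using assms opt(2)[of j i'] new[of j] val_old[of i j] by simp
qed

text \<open>The bound \<open>m\<close> is free because both outcomes use it: \<open>m = p\<close> if
  no row improves, and otherwise the row before the first improvement.\<close>

lemma tentative_dp_ok:
  assumes m: "m \<le> p" "\<And>j. Suc c < j \<Longrightarrow> j \<le> m \<Longrightarrow> R' OPT j \<le> val R' (opt' j) j + lam"
  shows "dp_ok R' best' m"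
  unfolding dp_ok_def
proof (intro conjI allI impI)
  show "R' OPT 0 = 0" using dp same by (simp add: dp_ok_def)
next
  fix j assume j: "0 < j" "j \<le> m"
  have old: "best j < j" "R OPT j = val R (best j) j + lam" if "j \<le> c"
    using dp_okD[OF dp j(1) that] by auto
  show "best' j < j"
    using old same(4) new[of j] opt(1)[of j] j m by (cases "j \<le> c") auto
  show "R' OPT j = val R' (best' j) j + lam"
    using old same(3,4) new[of j] opt(1)[of j] j m val_old[of "best' j" j] by (cases "j \<le> c") auto
  fix i assume "i < j"
  show "R' OPT j \<le> val R' i j + lam"
  proof (cases "j \<le> c")
    case True
    then show ?thesis
      using dp_okD(3)[OF dp j(1) True \<open>i < j\<close>] \<open>i < j\<close> same(3)[OF True] val_old[of i j] by simp
  next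
    case False
    show ?thesis
    proof (cases "i \<le> c")
      case True
      then show ?thesis using False j m by (intro tentative_le_old) auto
    next
      \<comment> \<open>A start beyond \<open>c\<close>: the second run has found the best of these,
        and not even that one undercuts the tentative value.\<close>
      case i: False
      then show ?thesis
        using m(2)[of j] opt'(2)[of j i] \<open>i < j\<close> j m(1) by force
    qed
  qed
qed

lemma tentative_candidates_ok: "candidates_ok R' r p"
  unfolding candidates_ok_def
proof (intro conjI allI impI)
  show "r \<le> p" using cand cp by (simp add: candidates_ok_def)
  fix j i assume j: "p < j" "j \<le> N" "i < r"
  then obtain i' where "r \<le> i'" "i' \<le> c" "val R i' j \<le> val R i j"
    using cand cp unfolding candidates_ok_def by (meson less_trans)
  moreover have "i \<le> c" using j cand by (simp add: candidates_ok_def)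
  ultimately show "\<exists>i'. r \<le> i' \<and> i' \<le> p \<and> val R' i' j \<le> val R' i j"
    using cp val_old by (intro exI[of _ i']) auto
qed

context
  fixes m :: nat and R'' :: "rarr \<Rightarrow> nat \<Rightarrow> real"
  assumes m: "Suc c < m" "m \<le> p"
    and before: "\<And>j. Suc c < j \<Longrightarrow> j < m \<Longrightarrow> R' OPT j \<le> val R' (opt' j) j + lam"
    and less: "val R' (opt' m) m + lam < R' OPT m"
    and R'': "R'' = R'(OPT := (R' OPT)(m := val R' (opt' m) m + lam))"
begin

lemma val_R'': "i \<noteq> m \<Longrightarrow> val R'' i j = val R' i j"
  unfolding R'' by (intro val_cong) auto

text \<open>Rows before \<open>m\<close> are final, so the second run chose among correct values for
  the starts from \<open>c + 1\<close> to \<open>m - 1\<close>. Starts up to \<open>c\<close> offer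
  at best the tentative value, which has just been undercut.\<close>

lemma improved_dp_ok: "dp_ok R'' (best'(m := opt' m)) m"
  unfolding dp_ok_def
proof (intro conjI allI impI)
  have dp': "dp_ok R' best' (m - 1)"
    using before m by (intro tentative_dp_ok) auto
  show "R'' OPT 0 = 0" using dp' m by (simp add: dp_ok_def R'')
  fix j assume j: "0 < j" "j \<le> m"
  have opt'_m: "opt' m < m" using opt'(1)[of m] m by auto
  have old: "best' j < j" "R' OPT j = val R' (best' j) j + lam" "\<And>i. i < j \<Longrightarrow> R' OPT j \<le> val R' i j + lam"
    if "j \<noteq> m"
    using dp_okD[OF dp' j(1)] that j by auto
  show "(best'(m := opt' m)) j < j" using old opt'_m by auto
  show "R'' OPT j = val R'' ((best'(m := opt' m)) j) j + lam"
    using old opt'_m val_R'' j by (auto simp: R'')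
  fix i assume "i < j"
  then have v: "val R'' i j = val R' i j" using j by (intro val_R'') auto
  show "R'' OPT j \<le> val R'' i j + lam"
  proof (cases "j = m")
    case False
    then show ?thesis using old(3)[of i] \<open>i < j\<close> v by (simp add: R'')
  next
    case True
    then show ?thesis
      using tentative_le_old[of m i] opt'(2)[of m i] \<open>i < j\<close> v m less
      by (cases "i \<le> c") (auto simp: R'')
  qed
qed

text \<open>In row \<open>m\<close> the column \<open>opt' m\<close> strictly beats every column up
  to \<open>c\<close>, and total monotonicity keeps it ahead in all later rows. One witness thus
  replaces all discarded columns.\<close>

lemma improved_candidates_ok: "candidates_ok R'' (Suc c) m"
  unfolding candidates_ok_def
proof (intro conjI allI impI)
  show "Suc c \<le> m" using m by simp
  fix j i assume j: "m < j" "j \<le> N" "i < Suc c"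
  let ?o = "opt' m"
  have o: "c < ?o" "?o < m" using opt'(1)[of m] m by auto
  have "val R' ?o m < val R' i m"
    using tentative_le_old[of m i] less m j by simp
  then have "better R' m i ?o" using o by (simp add: better_def)
  then have "better R' j i ?o"
    by (rule sums_ok_better_mono[rotated]) (use sums_ok_cong[OF same(1,2)] sums o j in auto)
  then have "val R'' ?o j \<le> val R'' i j"
    using o j m by (simp add: better_def val_R'')
  with o show "\<exists>i'. Suc c \<le> i' \<and> i' \<le> m \<and> val R'' i' j \<le> val R'' i j"
    by (intro exI[of _ ?o]) auto
qed

end

end

section \<open>Running time and correctness of Wilber's loop\<close>

context machine
begin

lemma wp_search:
  assumes s: "nv s Vc = c" "nv s Vp = p" "c < p" "nv s Vj = c + 2"
      "\<And>j. Suc c < j \<Longrightarrow> j \<le> p \<Longrightarrow> na s ARG j < j"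
      "k + 1 + 2 * (p - c) \<le> t"
    and Q: "\<And>s' t'. same_except {Vj} {} s s' \<Longrightarrow> Suc c < nv s' Vj \<Longrightarrow>
      (\<And>j. Suc c < j \<Longrightarrow> j < nv s' Vj \<Longrightarrow> j \<le> p \<Longrightarrow> ra s OPT j \<le> val (ra s) (na s ARG j) j + lam) \<Longrightarrow>
      (nv s' Vj \<le> p \<Longrightarrow> val (ra s) (na s ARG (nv s' Vj)) (nv s' Vj) + lam < ra s OPT (nv s' Vj)) \<Longrightarrow>
      k \<le> t' \<Longrightarrow> Q s' t'"
  shows "wp search Q s t"
proof -
  let ?b = "And (Not (NLess (Var Vp) (Var Vj))) (Not improves)"
  let ?I = "\<lambda>(s' :: state) t'. same_except {Vj} {} s s' \<and> Suc c < nv s' Vj \<and>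
      (\<forall>j. Suc c < j \<longrightarrow> j < nv s' Vj \<longrightarrow> j \<le> p \<longrightarrow> ra s OPT j \<le> val (ra s) (na s ARG j) j + lam) \<and>
      k + 1 + 2 * (p + 2 - nv s' Vj) \<le> t'"
  show ?thesis
    unfolding search_def
  proof (rule wp_While[where I = ?I])
    show "?I s t" using s by (auto simp: same_except_def)
  next
    fix s' :: state and t' assume I: "?I s' t'"
    then have "nv s' Vp = p" "na s' = na s" using s by (auto simp: same_except_def fun_eq_iff)
    then show "bdef ?b s' \<and> 1 \<le> t'"
      using I s(5)[of "nv s' Vj"] by (auto simp: improves_def)
  next
    fix s' :: state and t' assume I: "?I s' t'" and b: "\<not> beval ?b s'"
    then have "nv s' Vp = p" "na s' = na s" "ra s' = ra s"
      using s by (auto simp: same_except_def fun_eq_iff)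
    then show "Q s' (t' - 1)" using I b by (intro Q) (auto simp: improves_def)
  next
    fix s' :: state and t' assume I: "?I s' t'" and b: "beval ?b s'"
    have eq: "nv s' Vp = p" "na s' = na s" "ra s' = ra s"
      using I s by (auto simp: same_except_def fun_eq_iff)
    then have le: "nv s' Vj \<le> p"
      "ra s OPT (nv s' Vj) \<le> val (ra s) (na s ARG (nv s' Vj)) (nv s' Vj) + lam"
      using b by (auto simp: improves_def)
    then obtain d where "p = nv s' Vj + d" using le_Suc_ex by blast
    with I le show "wp (NAssign Vj (Plus (Var Vj) (Num 1))) ?I s' (t' - 1)"
      by (auto simp: same_except_def less_Suc_eq)
  qed
qed

lemma wp_tentative:
  assumes s: "nv s Vj = c" "nv s Vp = p" "c \<le> p"
      "\<And>j. c < j \<Longrightarrow> j \<le> p \<Longrightarrow> na s ARG j \<le> c"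
      "k + 1 + 4 * (p - c) \<le> t"
    and Q: "\<And>s' t'. (\<And>v. v \<noteq> Vj \<Longrightarrow> nv s' v = nv s v) \<Longrightarrow> na s' ARG = na s ARG \<Longrightarrow>
      ra s' PSUM = ra s PSUM \<Longrightarrow> ra s' PSQ = ra s PSQ \<Longrightarrow>
      (\<And>j. j \<le> c \<Longrightarrow> ra s' OPT j = ra s OPT j) \<Longrightarrow> (\<And>j. j \<le> c \<Longrightarrow> na s' BEST j = na s BEST j) \<Longrightarrow>
      (\<And>j. c < j \<Longrightarrow> j \<le> p \<Longrightarrow> ra s' OPT j = val (ra s) (na s ARG j) j + lam \<and> na s' BEST j = na s ARG j) \<Longrightarrow>
      k \<le> t' \<Longrightarrow> Q s' t'"
  shows "wp tentative Q s t"
proof -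
  let ?I = "\<lambda>(s' :: state) t'. (\<forall>v. v \<noteq> Vj \<longrightarrow> nv s' v = nv s v) \<and> na s' ARG = na s ARG \<and>
      ra s' PSUM = ra s PSUM \<and> ra s' PSQ = ra s PSQ \<and>
      (\<forall>j\<le>c. ra s' OPT j = ra s OPT j) \<and> (\<forall>j\<le>c. na s' BEST j = na s BEST j) \<and>
      c \<le> nv s' Vj \<and> nv s' Vj \<le> p \<and>
      (\<forall>j. c < j \<longrightarrow> j \<le> nv s' Vj \<longrightarrow>
        ra s' OPT j = val (ra s) (na s ARG j) j + lam \<and> na s' BEST j = na s ARG j) \<and>
      k + 1 + 4 * (p - nv s' Vj) \<le> t'"
  show ?thesis
    unfolding tentative_def
  proof (rule wp_While[where I = ?I])
    show "?I s t" using s by auto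
  next
    fix s' :: state and t' assume "?I s' t'"
    then show "bdef (NLess (Var Vj) (Var Vp)) s' \<and> 1 \<le> t'" by auto
  next
    fix s' :: state and t' assume I: "?I s' t'" and "\<not> beval (NLess (Var Vj) (Var Vp)) s'"
    then have "nv s' Vj = p" using s by auto
    with I show "Q s' (t' - 1)" by (intro Q) auto
  next
    fix s' :: state and t' assume I: "?I s' t'" and "beval (NLess (Var Vj) (Var Vp)) s'"
    then have "nv s' Vj < p" using s by auto
    define q where "q = nv s' Vj"
    define j where "j = Suc q"
    obtain d where p: "p = Suc (q + d)"
      using \<open>nv s' Vj < p\<close> by (auto simp: less_iff_Suc_add q_def)
    have I': "\<And>v. v \<noteq> Vj \<Longrightarrow> nv s' v = nv s v" "na s' ARG = na s ARG"
      "ra s' PSUM = ra s PSUM" "ra s' PSQ = ra s PSQ"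
      "\<And>j. j \<le> c \<Longrightarrow> ra s' OPT j = ra s OPT j" "\<And>j. j \<le> c \<Longrightarrow> na s' BEST j = na s BEST j"
      "c \<le> q"
      "\<And>j. c < j \<Longrightarrow> j \<le> q \<Longrightarrow>
        ra s' OPT j = val (ra s) (na s ARG j) j + lam \<and> na s' BEST j = na s ARG j"
      "k + 5 + 4 * d \<le> t'"
      using I by (auto simp: q_def[symmetric] p)
    have arg: "na s ARG j \<le> c" "na s ARG j \<noteq> j" using s(4)[of j] I'(7) p by (auto simp: j_def)
    \<comment> \<open>The loop reads \<open>OPT\<close> only up to \<open>c\<close> and writes it
      only beyond \<open>c\<close>, so every tentative value is computed from the table as it was at
      the start.\<close>
    have v: "val (ra s') (na s ARG j) j = val (ra s) (na s ARG j) j"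
      using I' arg by (intro val_cong) auto
    define w where "w = naupd BEST j (na s ARG j)
      (raupd OPT j (val (ra s) (na s ARG j) j + lam) (nupd Vj j s'))"
    define J where "J = ?I"
    have "J w (t' - 1 - 1 - 1 - 1)"
      unfolding J_def using I' p by (auto simp: w_def j_def le_Suc_eq)
    moreover obtain e where "t' = e + 5" using I'(9) le_Suc_ex[of 5 t'] by auto
    ultimately have "wp (NAssign Vj (Plus (Var Vj) (Num 1)) ;;
        RStore OPT (Var Vj) (RPlus (cost_exp (NAt ARG (Var Vj)) (Var Vj)) Lam) ;;
        NStore BEST (Var Vj) (NAt ARG (Var Vj))) J s' (t' - 1)"
      using I'(2) arg v by (simp add: w_def j_def q_def)
    then show "wp (NAssign Vj (Plus (Var Vj) (Num 1)) ;;
        RStore OPT (Var Vj) (RPlus (cost_exp (NAt ARG (Var Vj)) (Var Vj)) Lam) ;;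
        NStore BEST (Var Vj) (NAt ARG (Var Vj))) ?I s' (t' - 1)"
      unfolding J_def .
  qed
qed

end

context wilber_round
begin

lemma wp_commit:
  assumes s: "ra s = R'" "na s BEST = best'" "nv s Vc = c" "nv s Vr = r" "nv s Vp = p"
      "\<And>j. Suc c < j \<Longrightarrow> j \<le> p \<Longrightarrow> na s ARG j = opt' j"
      "k + 10 + 2 * (p - c) \<le> t"
    and Q: "\<And>s' t'. sums_ok (ra s') \<Longrightarrow> dp_ok (ra s') (na s' BEST) (nv s' Vc) \<Longrightarrow>
      candidates_ok (ra s') (nv s' Vr) (nv s' Vc) \<Longrightarrow>
      nv s' Vr = r \<and> nv s' Vc = p \<or> nv s' Vr = Suc c \<and> c < nv s' Vc \<and> nv s' Vc \<le> p \<Longrightarrow>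
      k \<le> t' \<Longrightarrow> Q s' t'"
  shows "wp commit Q s t"
proof -
  let ?s = "nupd Vj (c + 2) s"
  let ?last = "If (NLess (Var Vp) (Var Vj)) (NAssign Vc (Var Vp))
       (RStore OPT (Var Vj) (RPlus (cost_exp (NAt ARG (Var Vj)) (Var Vj)) Lam) ;;
        NStore BEST (Var Vj) (NAt ARG (Var Vj)) ;;
        NAssign Vr (Plus (Var Vc) (Num 1)) ;;
        NAssign Vc (Var Vj))"
  have "wp search (wp ?last Q) ?s (t - 1)"
  proof (rule wp_search[where c = c and p = p and k = "k + 8"])
    fix u :: state and tu
    assume fr: "same_except {Vj} {} ?s u" and m1: "Suc c < nv u Vj"
      and before: "\<And>j. Suc c < j \<Longrightarrow> j < nv u Vj \<Longrightarrow> j \<le> p \<Longrightarrow>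
        ra ?s OPT j \<le> val (ra ?s) (na ?s ARG j) j + lam"
      and found: "nv u Vj \<le> p \<Longrightarrow>
        val (ra ?s) (na ?s ARG (nv u Vj)) (nv u Vj) + lam < ra ?s OPT (nv u Vj)"
      and tu: "k + 8 \<le> tu"
    define m where "m = nv u Vj"
    have eq: "ra u = R'" "na u BEST = best'" "nv u Vc = c" "nv u Vr = r" "nv u Vp = p" "na u = na s"
      using fr s by (auto simp: same_except_def fun_eq_iff)
    have before': "R' OPT j \<le> val R' (opt' j) j + lam" if "Suc c < j" "j < m" "j \<le> p" for j
      using before[of j] that s by (simp add: m_def)
    have sums': "sums_ok R'" using sums sums_ok_cong[OF same(1,2)] by simp
    obtain d where d: "tu = d + 8 + k" using tu le_Suc_ex[of "k + 8" tu] by auto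
    show "wp ?last Q u tu"
    proof (cases "p < m")
      case True
      have "dp_ok R' best' p" using before' True by (intro tentative_dp_ok) auto
      then have "Q (nupd Vc p u) (tu - 1 - 1)"
        using sums' tentative_candidates_ok d by (intro Q) (auto simp: eq s(2))
      then show ?thesis using True d by (simp add: eq m_def)
    next
      case False
      define R'' where "R'' = R'(OPT := (R' OPT)(m := val R' (opt' m) m + lam))"
      have m: "Suc c < m" "m \<le> p" using m1 False by (auto simp: m_def)
      have opt_m: "na s ARG m = opt' m" "opt' m \<noteq> m" using s(6) m opt'(1)[of m] by auto
      have less: "val R' (opt' m) m + lam < R' OPT m"
        using found m s opt_m by (simp add: m_def)
      have before'': "R' OPT j \<le> val R' (opt' j) j + lam" if "Suc c < j" "j < m" for j
        using before' that m by auto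
      define w where "w = nupd Vc m (nupd Vr (Suc c) (naupd BEST m (opt' m)
        (raupd OPT m (val R' (opt' m) m + lam) u)))"
      have "ra w = R''" "na w BEST = best'(m := opt' m)" "nv w Vc = m" "nv w Vr = Suc c"
        by (simp_all add: w_def R''_def eq s(2))
      moreover have "dp_ok R'' (best'(m := opt' m)) m"
        using improved_dp_ok[OF m before'' less R''_def] .
      moreover have "candidates_ok R'' (Suc c) m"
        using improved_candidates_ok[OF m before'' less R''_def] .
      moreover have "sums_ok R''" using sums' sums_ok_cong[of R'' R'] by (simp add: R''_def)
      ultimately have "Q w (tu - 1 - 1 - 1 - 1 - 1)"
        using m d by (intro Q) auto
      then show ?thesis
        using False d opt_m by (simp add: eq m_def[symmetric] w_def)
    qed
  qed (use s cp opt'(1) in auto)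
  then show ?thesis
    unfolding commit_def using s(3,7) by simp
qed

end

context instance_1d
begin

text \<open>For each new row: 4 units for the tentative value, 15 and 124 for the columns and rows
  of SMAWK, and 2 for the search make 145.\<close>

lemma wp_extend:
  assumes s: "nv s Vc = c" "nv s Vr = r" "nv s Vp = p" "nv s Vlast = p" "c < p" "p \<le> N"
      "sums_ok (ra s)" "dp_ok (ra s) (na s BEST) c" "candidates_ok (ra s) r c"
      "\<And>j. c < j \<Longrightarrow> j \<le> p \<Longrightarrow> na s ARG j = opt j"
      "\<And>j. c < j \<Longrightarrow> j \<le> p \<Longrightarrow> opt j \<le> c"
      "\<And>j i. c < j \<Longrightarrow> j \<le> p \<Longrightarrow> r \<le> i \<Longrightarrow> i \<le> c \<Longrightarrow> val (ra s) (opt j) j \<le> val (ra s) i j"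
      "k + 40 + 145 * (p - c) \<le> t"
    and Q: "\<And>s' t'. sums_ok (ra s') \<Longrightarrow> dp_ok (ra s') (na s' BEST) (nv s' Vc) \<Longrightarrow>
      candidates_ok (ra s') (nv s' Vr) (nv s' Vc) \<Longrightarrow>
      nv s' Vr = r \<and> nv s' Vc = p \<or> nv s' Vr = Suc c \<and> c < nv s' Vc \<and> nv s' Vc \<le> p \<Longrightarrow>
      k \<le> t' \<Longrightarrow> Q s' t'"
  shows "wp extend Q s t"
proof -
  let ?s = "nupd Vj c s"
  let ?rest = "NAssign Vbase (Plus (Var Vc) (Num 1)) ;;
     NAssign Vlo (Plus (Var Vc) (Num 1)) ;;
     NAssign Vhi (Var Vp) ;;
     smawk ;;
     commit"
  have "wp tentative (wp ?rest Q) ?s (t - 1)"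
  proof (rule wp_tentative[where c = c and p = p and k = "k + 38 + 141 * (p - c)"])
    fix u :: state and tu
    assume nv: "\<And>v. v \<noteq> Vj \<Longrightarrow> nv u v = nv ?s v" and arg: "na u ARG = na ?s ARG"
      and same: "ra u PSUM = ra ?s PSUM" "ra u PSQ = ra ?s PSQ"
        "\<And>j. j \<le> c \<Longrightarrow> ra u OPT j = ra ?s OPT j" "\<And>j. j \<le> c \<Longrightarrow> na u BEST j = na ?s BEST j"
      and new: "\<And>j. c < j \<Longrightarrow> j \<le> p \<Longrightarrow>
        ra u OPT j = val (ra ?s) (na ?s ARG j) j + lam \<and> na u BEST j = na ?s ARG j"
      and tu: "k + 38 + 141 * (p - c) \<le> tu"
    have equ: "nv u Vc = c" "nv u Vr = r" "nv u Vp = p" "nv u Vlast = p"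
      using nv s by auto
    have sums: "sums_ok (ra u)" using s(7) sums_ok_cong[of "ra u" "ra s"] same by simp
    obtain opt' where S: "row_minima (ra u) (Suc c) p (Suc c) p opt'"
      and opt': "\<And>j. Suc c < j \<Longrightarrow> j \<le> p \<Longrightarrow> Suc c \<le> opt' j \<and> opt' j < p \<and> opt' j < j"
        "\<And>j a. Suc c < j \<Longrightarrow> j \<le> p \<Longrightarrow> Suc c \<le> a \<Longrightarrow> a < p \<Longrightarrow> a < j \<Longrightarrow>
          val (ra u) (opt' j) j \<le> val (ra u) a j"
      using row_minima_exists[OF sums s(6), of "Suc c" "Suc c" p] by auto
    interpret S: row_minima N lam "ra u" "Suc c" p "Suc c" p opt' by (rule S)
    interpret W: wilber_round N lam x "ra s" "ra u" "na s BEST" "na u BEST" opt opt' r c p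
    proof unfold_locales
      fix j assume j: "c < j" "j \<le> p"
      show "ra u OPT j = val (ra s) (opt j) j + lam \<and> na u BEST j = opt j"
        using new[OF j] s(10)[OF j] by simp
    next
      fix j assume "Suc c < j" "j \<le> p"
      then show "c < opt' j \<and> opt' j < j" using opt'(1)[of j] by auto
    next
      fix j i assume "Suc c < j" "j \<le> p" "c < i" "i < j"
      then show "val (ra u) (opt' j) j \<le> val (ra u) i j" using opt'(2)[of j i] by auto
    qed (use s same in auto)
    let ?u = "nupd Vhi p (nupd Vlo (Suc c) (nupd Vbase (Suc c) u))"
    have "wp smawk (wp commit Q) ?u (tu - 1 - 1 - 1)"
    proof (rule S.wp_smawk[where k = "k + 10 + 2 * (p - c)"])
      fix w :: state and tw
      assume fr: "same_except {Vk, Vh, Vtop, Vrow, Vinp, Vcol, Vbot, Vpos, Vend, Vbest, Vlim}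
          {COL, SEG, STRIDE, ARG} ?u w"
        and arg': "\<And>j. Suc c < j \<Longrightarrow> j \<le> p \<Longrightarrow> na w ARG j = opt' j"
        and tw: "k + 10 + 2 * (p - c) \<le> tw"
      show "wp commit Q w tw"
        by (rule W.wp_commit[where k = k])
           (use fr equ arg' tw Q in \<open>auto simp: same_except_def\<close>)
    next
      have "p - Suc c \<le> p - c" "1 \<le> p - c" using s(5) by auto
      then show "k + 10 + 2 * (p - c) + 20 + 15 * (p - Suc c) + 124 * (p - Suc c) \<le> tu - 1 - 1 - 1"
        using tu by linarith
    qed (use equ in auto)
    moreover obtain d where "tu = d + 8" using tu le_Suc_ex[of 8 tu] by auto
    ultimately show "wp ?rest Q u tu" by (simp add: equ)
  qed (use s in auto)
  then show ?thesis
    unfolding extend_def using s by simp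
qed

text \<open>\<open>Suc c - r\<close> is the number of live columns and bounds the number of new
  rows. The first run of SMAWK takes 15 and 124 units for each, and \<open>extend\<close> takes
  145.\<close>

lemma wp_wilber_step:
  assumes s: "nv s Vc = c" "nv s Vr = r" "c < N"
      "sums_ok (ra s)" "dp_ok (ra s) (na s BEST) c" "candidates_ok (ra s) r c"
      "k + 400 * (Suc c - r) \<le> t"
    and Q: "\<And>s' t'. sums_ok (ra s') \<Longrightarrow> dp_ok (ra s') (na s' BEST) (nv s' Vc) \<Longrightarrow>
      candidates_ok (ra s') (nv s' Vr) (nv s' Vc) \<Longrightarrow> nv s' Vc \<le> N \<Longrightarrow>
      nv s' Vr = r \<and> (nv s' Vc = N \<or> nv s' Vc = c + (Suc c - r)) \<or>
        nv s' Vr = Suc c \<and> c < nv s' Vc \<Longrightarrow>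
      k \<le> t' \<Longrightarrow> Q s' t'"
  shows "wp wilber_step Q s t"
proof -
  define L where "L = Suc c - r"
  define p where "p = min (c + L) N"
  have rc: "r \<le> c" using s(6) by (simp add: candidates_ok_def)
  have L: "1 \<le> L" "c + c + 1 - r = c + L" using rc by (auto simp: L_def)
  have p: "c < p" "p \<le> N" "p - c \<le> L" "p = N \<or> p = c + L"
    using s(3) L by (auto simp: p_def min_def)
  obtain opt where S: "row_minima (ra s) r (Suc c) c p opt"
    and opt: "\<And>j. c < j \<Longrightarrow> j \<le> p \<Longrightarrow> r \<le> opt j \<and> opt j < Suc c \<and> opt j < j"
      "\<And>j a. c < j \<Longrightarrow> j \<le> p \<Longrightarrow> r \<le> a \<Longrightarrow> a < Suc c \<Longrightarrow> a < j \<Longrightarrow>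
        val (ra s) (opt j) j \<le> val (ra s) a j"
    using row_minima_exists[OF s(4) p(2), of c r "Suc c"] rc by auto
  interpret S: row_minima N lam "ra s" r "Suc c" c p opt by (rule S)
  let ?u = "nupd Vhi (Suc c) (nupd Vlo r (nupd Vlast p (nupd Vbase c (nupd Vp p s))))"
  have smawk: "wp smawk (wp extend Q) ?u t'" if t': "k + 60 + 284 * L \<le> t'" for t'
  proof (rule S.wp_smawk[where k = "k + 40 + 145 * (p - c)"])
    fix w :: state and tw
    assume fr: "same_except {Vk, Vh, Vtop, Vrow, Vinp, Vcol, Vbot, Vpos, Vend, Vbest, Vlim}
          {COL, SEG, STRIDE, ARG} ?u w"
      and arg: "\<And>j. c < j \<Longrightarrow> j \<le> p \<Longrightarrow> na w ARG j = opt j"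
      and tw: "k + 40 + 145 * (p - c) \<le> tw"
    have eq: "ra w = ra s" "na w BEST = na s BEST" "nv w Vc = c" "nv w Vr = r" "nv w Vp = p"
        "nv w Vlast = p"
      using fr s by (auto simp: same_except_def)
    show "wp extend Q w tw"
    proof (rule wp_extend[where c = c and r = r and p = p and opt = opt and k = k])
      fix j assume "c < j" "j \<le> p"
      then show "opt j \<le> c" using opt(1)[of j] by auto
    next
      fix j i assume "c < j" "j \<le> p" "r \<le> i" "i \<le> c"
      then show "val (ra w) (opt j) j \<le> val (ra w) i j" using opt(2)[of j i] by (simp add: eq)
    next
      fix s' :: state and t'
      assume "sums_ok (ra s')" "dp_ok (ra s') (na s' BEST) (nv s' Vc)"
        "candidates_ok (ra s') (nv s' Vr) (nv s' Vc)"
        "nv s' Vr = r \<and> nv s' Vc = p \<or> nv s' Vr = Suc c \<and> c < nv s' Vc \<and> nv s' Vc \<le> p" "k \<le> t'"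
      then show "Q s' t'" using p by (intro Q) (auto simp: L_def)
    qed (use s p eq arg tw in auto)
  next
    show "k + 40 + 145 * (p - c) + 20 + 15 * (Suc c - r) + 124 * (p - c) \<le> t'"
      using t' p(3) unfolding L_def[symmetric] by linarith
  qed auto
  obtain d where d: "t = k + 300 * L + 100 + d"
    using s(7) L(1) le_Suc_ex[of "k + 300 * L + 100" t] unfolding L_def[symmetric] by auto
  show ?thesis
  proof (cases "N < c + L")
    case True
    then have "p = N" by (simp add: p_def)
    then show ?thesis
      unfolding wilber_step_def using True s rc L smawk[of "t - 1 - 1 - 1 - 1 - 1 - 1 - 1"]
      by (simp add: d)
  next
    case False
    then have "p = c + L" by (simp add: p_def)
    then show ?thesis
      unfolding wilber_step_def using False s rc L smawk[of "t - 1 - 1 - 1 - 1 - 1 - 1"]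
      by (simp add: d)
  qed
qed

lemma wp_wilber:
  assumes s: "nv s Vc = 0" "nv s Vr = 0" "sums_ok (ra s)" "ra s OPT 0 = 0"
      "k + 1 + 401 * (3 * N + 2) \<le> t"
    and Q: "\<And>s' t'. sums_ok (ra s') \<Longrightarrow> dp_ok (ra s') (na s' BEST) N \<Longrightarrow> k \<le> t' \<Longrightarrow> Q s' t'"
  shows "wp wilber Q s t"
proof -
  \<comment> \<open>With \<open>L = Suc c - r\<close>, a round raises \<open>c\<close> by
    \<open>L\<close>, or moves \<open>r\<close> up by \<open>L\<close> without lowering
    \<open>c\<close>, or ends with \<open>c = N\<close>. In the last case \<open>c\<close> may rise
    by less than \<open>L\<close>, and the third summand, which is at least \<open>L\<close>, pays.
    The factor 401 is 400 for the round and 1 for the loop test; the initial potential is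
    \<open>3 * N + 2\<close>.\<close>
  define pot where "pot c r = (N - c) + (Suc N - r) + (if c < N then Suc N else 0)" for c r
  let ?I = "\<lambda>(s' :: state) t'. sums_ok (ra s') \<and> dp_ok (ra s') (na s' BEST) (nv s' Vc) \<and>
      candidates_ok (ra s') (nv s' Vr) (nv s' Vc) \<and> nv s' Vc \<le> N \<and>
      k + 1 + 401 * pot (nv s' Vc) (nv s' Vr) \<le> t'"
  show ?thesis
    unfolding wilber_def
  proof (rule wp_While[where I = ?I])
    show "?I s t" using s N_pos by (auto simp: dp_ok_def candidates_ok_def pot_def)
  next
    fix s' :: state and t' assume "?I s' t'"
    then show "bdef (NLess (Var Vc) Len) s' \<and> 1 \<le> t'" by auto
  next
    fix s' :: state and t' assume I: "?I s' t'" and "\<not> beval (NLess (Var Vc) Len) s'"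
    then have "nv s' Vc = N" by auto
    with I show "Q s' (t' - 1)" by (intro Q) auto
  next
    fix s' :: state and t' assume I: "?I s' t'" and b: "beval (NLess (Var Vc) Len) s'"
    define c r L where "c = nv s' Vc" and "r = nv s' Vr" and "L = Suc (nv s' Vc) - nv s' Vr"
    have "c < N" "r \<le> c" using b I by (auto simp: c_def r_def candidates_ok_def)
    then have L: "1 \<le> L" "L = Suc c - r" "L \<le> pot c r"
      by (auto simp: L_def c_def r_def pot_def)
    have cr: "k + 1 + 401 * (pot c r - L) + 400 * (Suc c - r) \<le> t' - 1"
    proof -
      have "k + 1 + 401 * pot c r \<le> t'" using I by (simp add: c_def r_def)
      then show ?thesis unfolding L(2)[symmetric] using L(1,3) by (simp add: diff_mult_distrib2)
    qed
    show "wp wilber_step ?I s' (t' - 1)"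
    proof (rule wp_wilber_step[OF _ _ _ _ _ _ cr])
      fix u :: state and tu
      assume u: "sums_ok (ra u)" "dp_ok (ra u) (na u BEST) (nv u Vc)"
        "candidates_ok (ra u) (nv u Vr) (nv u Vc)" "nv u Vc \<le> N"
        "nv u Vr = r \<and> (nv u Vc = N \<or> nv u Vc = c + (Suc c - r)) \<or> nv u Vr = Suc c \<and> c < nv u Vc"
        "k + 1 + 401 * (pot c r - L) \<le> tu"
      have "pot (nv u Vc) (nv u Vr) \<le> pot c r - L"
        using u(4,5) \<open>c < N\<close> \<open>r \<le> c\<close> L(2) by (auto simp: pot_def)
      with u show "?I u tu" by auto
    qed (use I \<open>c < N\<close> in \<open>auto simp: c_def r_def\<close>)
  qed
qed

section \<open>Prefix sums and recovery of the centres\<close>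

lemma wp_init:
  assumes s: "\<And>i. i < N \<Longrightarrow> ra s PTS i = x i" "k + 5 + 4 * N \<le> t"
    and Q: "\<And>s' t'. sums_ok (ra s') \<Longrightarrow> ra s' OPT 0 = 0 \<Longrightarrow> k \<le> t' \<Longrightarrow> Q s' t'"
  shows "wp init Q s t"
proof -
  let ?s = "nupd Vj 0 (raupd OPT 0 0 (raupd PSQ 0 0 (raupd PSUM 0 0 s)))"
  let ?I = "\<lambda>(s' :: state) t'. ra s' PTS = ra s PTS \<and> ra s' OPT 0 = 0 \<and> nv s' Vj \<le> N \<and>
      (\<forall>j\<le>nv s' Vj. ra s' PSUM j = (\<Sum>l<j. x l) \<and> ra s' PSQ j = (\<Sum>l<j. (x l)\<^sup>2)) \<and>
      k + 1 + 4 * (N - nv s' Vj) \<le> t'"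
  have "wp prefix_loop Q ?s (t - 1 - 1 - 1 - 1)"
    unfolding prefix_loop_def
  proof (rule wp_While[where I = ?I])
    show "?I ?s (t - 1 - 1 - 1 - 1)" using s(2) by auto
  next
    fix s' :: state and t' assume "?I s' t'"
    then show "bdef (NLess (Var Vj) Len) s' \<and> 1 \<le> t'" by auto
  next
    fix s' :: state and t' assume I: "?I s' t'" and "\<not> beval (NLess (Var Vj) Len) s'"
    then have "nv s' Vj = N" by auto
    with I show "Q s' (t' - 1)" by (intro Q) (auto simp: sums_ok_def)
  next
    fix s' :: state and t' assume I: "?I s' t'" and "beval (NLess (Var Vj) Len) s'"
    then have j: "nv s' Vj < N" by simp
    then obtain d where d: "N - nv s' Vj = Suc d" "N - Suc (nv s' Vj) = d"
      by (metis Suc_diff_Suc)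
    obtain e where e: "t' = e + 5" using I d le_Suc_ex[of 5 t'] by auto
    have x: "ra s' PTS (nv s' Vj) = x (nv s' Vj)" using I j s(1) by simp
    show "wp (RStore PSUM (Plus (Var Vj) (Num 1)) (RPlus (RAt PSUM (Var Vj)) (RAt PTS (Var Vj))) ;;
        RStore PSQ (Plus (Var Vj) (Num 1))
          (RPlus (RAt PSQ (Var Vj)) (RTimes (RAt PTS (Var Vj)) (RAt PTS (Var Vj)))) ;;
        NAssign Vj (Plus (Var Vj) (Num 1))) ?I s' (t' - 1)"
      using I j d e x by (auto simp: le_Suc_eq power2_eq_square)
  qed
  moreover obtain e where "t = e + 5" using s(2) le_Suc_ex[of 5 t] by auto
  ultimately show ?thesis
    unfolding init_def by simp
qed

definition centres :: "state \<Rightarrow> real set" where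
  "centres s = ra s PTS ` {..<nv s Vk}"

definition served :: "state \<Rightarrow> nat \<Rightarrow> real" where
  "served s j = (\<Sum>l=j..<N. Min ((\<lambda>m. (x l - m)\<^sup>2) ` centres s))"

text \<open>Segments are visited from right to left, so the means are written in decreasing order.\<close>

definition trace_inv :: "(nat \<Rightarrow> real) \<Rightarrow> state \<Rightarrow> bool" where
  "trace_inv E s \<longleftrightarrow>
     nv s Vk + nv s Vj \<le> N \<and> (nv s Vj < N \<longrightarrow> 0 < nv s Vk) \<and>
     (\<forall>a b. a < b \<longrightarrow> b < nv s Vk \<longrightarrow> ra s PTS b < ra s PTS a) \<and>
     (0 < nv s Vk \<longrightarrow> (\<forall>l<nv s Vj. x l \<le> ra s PTS (nv s Vk - 1))) \<and>
     served s (nv s Vj) + lam * real (nv s Vk) \<le> E N - E (nv s Vj)"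

text \<open>The new points are charged to the mean of their segment, and the points already served
  can only gain from further centres.\<close>

lemma served_extend:
  assumes ij: "i < j" "j \<le> N" and "j < N \<longrightarrow> 0 < nv s Vk"
    and sub: "centres s \<subseteq> centres s'" and m: "avg x i j \<in> centres s'"
  shows "served s' i \<le> served s j + sse x i j"
proof -
  let ?f = "\<lambda>l m. (x l - m)\<^sup>2"
  have fin: "finite (centres s)" "finite (centres s')" by (auto simp: centres_def)
  have "served s' i = (\<Sum>l=i..<j. Min (?f l ` centres s')) + (\<Sum>l=j..<N. Min (?f l ` centres s'))"
    unfolding served_def using ij by (simp add: sum.atLeastLessThan_concat)
  also have "\<dots> \<le> dev x (avg x i j) i j + served s j"
    unfolding dev_def served_def
  proof (intro add_mono sum_mono)
    fix l assume "l \<in> {j..<N}"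
    then have "centres s \<noteq> {}" using assms(3) by (auto simp: centres_def)
    then show "Min (?f l ` centres s') \<le> Min (?f l ` centres s)"
      using fin sub by (intro Min_antimono) auto
  qed (use fin m in auto)
  finally show ?thesis using ij by (simp add: dev_avg)
qed

lemma wp_trace:
  assumes s: "nv s Vj = N" "nv s Vk = 0" "sums_ok (ra s)" "dp_ok (ra s) (na s BEST) N"
      "k + 1 + 6 * N \<le> t"
    and Q: "\<And>s' t'. nv s' Vj = 0 \<Longrightarrow> trace_inv (ra s OPT) s' \<Longrightarrow> k \<le> t' \<Longrightarrow> Q s' t'"
  shows "wp trace Q s t"
proof -
  let ?E = "ra s OPT"
  let ?I = "\<lambda>(s' :: state) t'. ra s' PSUM = ra s PSUM \<and> na s' BEST = na s BEST \<and> trace_inv ?E s' \<and>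
      k + 1 + 6 * nv s' Vj \<le> t'"
  show ?thesis
    unfolding trace_def
  proof (rule wp_While[where I = ?I])
    show "?I s t" using s by (simp add: trace_inv_def served_def)
  next
    fix s' :: state and t' assume "?I s' t'"
    then show "bdef (NLess (Num 0) (Var Vj)) s' \<and> 1 \<le> t'" by simp
  next
    fix s' :: state and t' assume "?I s' t'" "\<not> beval (NLess (Num 0) (Var Vj)) s'"
    then show "Q s' (t' - 1)" by (intro Q) auto
  next
    fix s' :: state and t' assume I: "?I s' t'" and b: "beval (NLess (Num 0) (Var Vj)) s'"
    define j i n m where "j = nv s' Vj" and "i = na s BEST j" and "n = nv s' Vk" and "m = avg x i j"
    have inv: "n + j \<le> N" "j < N \<longrightarrow> 0 < n"
      "\<And>a b. a < b \<Longrightarrow> b < n \<Longrightarrow> ra s' PTS b < ra s' PTS a"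
      "0 < n \<Longrightarrow> l < j \<Longrightarrow> x l \<le> ra s' PTS (n - 1)"
      "served s' j + lam * real n \<le> ?E N - ?E j" for l
      using I by (auto simp: trace_inv_def j_def n_def)
    have j: "0 < j" "j \<le> N" using b inv(1) by (auto simp: j_def)
    have i: "i < j" and E: "?E j = ?E i + sse x i j + lam"
      using dp_okD[OF s(4) j] s(3) j by (auto simp: i_def val_eq)
    have mean: "(ra s PSUM j - ra s PSUM i) / (real j - real i) = m"
      using s(3) i j by (simp add: sums_ok_def m_def avg_def sum_diff_lessThan)
    have m_le: "m \<le> ra s' PTS (n - 1)" if "0 < n"
      unfolding m_def using i inv(4) that by (intro avg_le) auto
    have m_ge: "x l \<le> m" if "l < i" for l
      unfolding m_def using i j that by (intro avg_ge sorted) auto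
    obtain d where d: "t' = d + 7 + k + 6 * i"
    proof -
      have "k + 1 + 6 * j \<le> t'" using I by (simp add: j_def)
      then have "k + 7 + 6 * i \<le> t'" using i by linarith
      then show thesis using that le_Suc_ex[of "k + 7 + 6 * i" t'] by (auto simp: algebra_simps)
    qed
    have eq: "nv s' Vj = j" "nv s' Vk = n" "na s' BEST j = i" "ra s' PSUM = ra s PSUM"
      using I by (auto simp: j_def n_def i_def)
    define J where "J = ?I"
    have "wp trace_step J s' (t' - 1)"
    proof (cases "0 < n \<and> \<not> m < ra s' PTS (n - 1)")
      case True
      define w where "w = nupd Vj i (nupd Vi i s')"
      \<comment> \<open>All remaining points lie at or below the last centre, hence so does their
        mean. Not being smaller, it coincides with that centre, which then serves this segment
        too.\<close>
      have "ra s' PTS (n - 1) = m" using True m_le by auto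
      then have "m \<in> centres w" using True by (force simp: centres_def w_def eq)
      then have "served w i \<le> served s' j + sse x i j"
        unfolding m_def using i j inv(2) by (intro served_extend) (auto simp: w_def centres_def eq)
      then have "trace_inv ?E w"
        using inv(1,3,5) inv(4) True i E lam_nonneg by (auto simp: trace_inv_def w_def eq)
      then have "J w (t' - 1 - 1 - 1 - 1)" using I d by (auto simp: w_def J_def)
      then show ?thesis
        unfolding trace_step_def using True mean i d inv(1) j
        by (simp add: w_def eq mean_exp_def)
    next
      case False
      define w where "w = nupd Vj i (nupd Vk (Suc n) (raupd PTS n m (nupd Vi i s')))"
      have "n < N" using inv(1) j by simp
      have "m \<in> centres w" by (auto simp: centres_def w_def)
      moreover have "centres s' \<subseteq> centres w"
      proof
        fix y assume "y \<in> centres s'"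
        then obtain a where "a < n" "y = ra s' PTS a" by (auto simp: centres_def eq)
        then show "y \<in> centres w" by (auto simp: centres_def w_def intro!: image_eqI[of _ _ a])
      qed
      ultimately have sv: "served w i \<le> served s' j + sse x i j"
        unfolding m_def using i j inv(2) by (intro served_extend) (auto simp: eq)
      have dec: "ra w PTS b < ra w PTS a" if "a < b" "b < Suc n" for a b
      proof (cases "b = n")
        case True
        then have "m < ra s' PTS (n - 1)" using False that by auto
        also have "\<dots> \<le> ra s' PTS a"
        proof -
          have "a = n - 1 \<or> a < n - 1" using that True by auto
          then show ?thesis using inv(3)[of a "n - 1"] that True by auto
        qed
        finally show ?thesis using that True by (simp add: w_def)
      next
        case b: False
        then show ?thesis using inv(3) that by (simp add: w_def)
      qed
      have "trace_inv ?E w"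
        unfolding trace_inv_def
        using sv dec inv(1,5) i E m_ge by (auto simp: w_def algebra_simps)
      then have "J w (t' - 1 - 1 - 1 - 1 - 1 - 1)" using I d by (auto simp: w_def J_def)
      then show ?thesis
        unfolding trace_step_def using False mean i d \<open>n < N\<close>
        by (auto simp: w_def eq mean_exp_def)
    qed
    then show "wp trace_step ?I s' (t' - 1)" unfolding J_def .
  qed
qed

text \<open>Optimality is a sandwich. \<open>trace_inv\<close> bounds the cost of the centres found
  by \<open>E N\<close>, and the inequality between \<open>E j\<close> and \<open>E i\<close> bounds
  \<open>E N\<close> by the cost of any clustering; this is all that the postcondition retains of
  the recurrence.\<close>

lemma wp_kmeans:
  assumes s: "\<And>i. i < N \<Longrightarrow> ra s PTS i = x i" "k + 1000 + 1300 * N \<le> t"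
    and Q: "\<And>s' t' E. nv s' Vj = 0 \<Longrightarrow> trace_inv E s' \<Longrightarrow> E 0 = 0 \<Longrightarrow>
      (\<And>i j. i < j \<Longrightarrow> j \<le> N \<Longrightarrow> E j \<le> E i + sse x i j + lam) \<Longrightarrow> Q s' t'"
  shows "wp kmeans Q s t"
proof -
  have "wp init (wp (NAssign Vc (Num 0) ;; NAssign Vr (Num 0) ;; wilber ;; NAssign Vj Len ;;
      NAssign Vk (Num 0) ;; trace) Q) s t"
  proof (rule wp_init[where k = "900 + 1250 * N"])
    fix u :: state and tu
    assume u: "sums_ok (ra u)" "ra u OPT 0 = 0" "900 + 1250 * N \<le> tu"
    let ?u = "nupd Vr 0 (nupd Vc 0 u)"
    have "wp wilber (wp (NAssign Vj Len ;; NAssign Vk (Num 0) ;; trace) Q) ?u (tu - 1 - 1)"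
    proof (rule wp_wilber[where k = "3 + 6 * N"])
      fix v :: state and tv
      assume v: "sums_ok (ra v)" "dp_ok (ra v) (na v BEST) N" "3 + 6 * N \<le> tv"
      let ?v = "nupd Vk 0 (nupd Vj N v)"
      have "wp trace Q ?v (tv - 1 - 1)"
      proof (rule wp_trace[where k = 0])
        fix w :: state and tw
        assume w: "nv w Vj = 0" "trace_inv (ra ?v OPT) w"
        show "Q w tw"
        proof (rule Q[OF w])
          show "ra ?v OPT 0 = 0" using v(2) by (simp add: dp_ok_def)
          fix i j assume "i < j" "j \<le> N"
          then show "ra ?v OPT j \<le> ra ?v OPT i + sse x i j + lam"
            using dp_okD(3)[OF v(2), of j i] by (simp add: val_eq[OF v(1)])
        qed
      qed (use v in auto)
      then show "wp (NAssign Vj Len ;; NAssign Vk (Num 0) ;; trace) Q v tv"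
        using v(3) by simp
    qed (use u in auto)
    then show "wp (NAssign Vc (Num 0) ;; NAssign Vr (Num 0) ;; wilber ;; NAssign Vj Len ;;
      NAssign Vk (Num 0) ;; trace) Q u tu"
      using u(3) by simp
  qed (use s in auto)
  then show ?thesis unfolding kmeans_def by simp
qed

end

section \<open>The program and the optimality of its output\<close>

definition kmeans_program :: program where
  "kmeans_program = comp kmeans 0 @ [Move 0 (vreg Vk), Halt]"

theorem theorem4:
  "\<exists>(P :: program) (T :: nat \<Rightarrow> nat).
     (\<lambda>n. real (T n)) \<in> O(\<lambda>n. real n) \<and>
     (\<forall>(xs :: real list) (lam :: real). xs \<noteq> [] \<and> sorted xs \<and> lam \<ge> 0 \<longrightarrow>
        (\<exists>s k M. halts_within P (input_config xs lam) (T (length xs)) s \<and>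
                 outputs s (k, M) \<and> optimal_clustering xs lam (k, M)))"
proof -
  define L where "L = length (comp kmeans 0)"
  \<comment> \<open>The extra step is the final move, which replaces the number of points in
    register 0 by the number of centres; until then addresses depend on that register.\<close>
  define T where "T n = L * (1000 + 1300 * n) + 1" for n :: nat
  have "(\<lambda>n. real (T n)) \<in> O(\<lambda>n. real n)"
  proof (rule bigoI[where c = "real (L * 2300 + 1)"])
    show "\<forall>\<^sub>F n in at_top. norm (real (T n)) \<le> real (L * 2300 + 1) * norm (real n)"
    proof (rule eventually_at_top_linorderI[of 1])
      fix n :: nat assume "1 \<le> n"
      then have "T n \<le> L * (2300 * n) + n"
        unfolding T_def by (intro add_mono mult_left_mono) auto
      then have "T n \<le> (L * 2300 + 1) * n" by (simp add: algebra_simps)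
      then show "norm (real (T n)) \<le> real (L * 2300 + 1) * norm (real n)"
        by (simp only: real_norm_def abs_of_nat of_nat_mult[symmetric] of_nat_le_iff)
    qed
  qed
  moreover have "\<exists>s k M. halts_within kmeans_program (input_config xs lam) (T (length xs)) s \<and>
      outputs s (k, M) \<and> optimal_clustering xs lam (k, M)"
    if xs: "xs \<noteq> []" "sorted xs" "lam \<ge> 0" for xs :: "real list" and lam :: real
  proof -
    let ?N = "length xs" and ?x = "\<lambda>i. xs ! i"
    let ?P = kmeans_program and ?c = "input_config xs lam"
    interpret instance_1d ?N lam ?x
      by unfold_locales (use xs in \<open>auto intro: sorted_nth_mono\<close>)
    define s where "s = \<lparr>nv = \<lambda>_. 0, na = \<lambda>_ _. 0,
      ra = \<lambda>a i. if a = PTS \<and> i < ?N then ?x i else 0\<rparr>"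
    have vreg: "vreg v \<noteq> 0" "vreg v \<noteq> Suc 0" for v
      using vreg_bounds(1)[of v] by auto
    \<comment> \<open>Cells behind the points and registers from 2 on are zero in the input,
      matching variables and arrays that are zero.\<close>
    have "represents s ?c"
      by (auto simp: vreg represents_def input_config_def s_def cell_def)
    let ?Q = "\<lambda>s' (t' :: nat). nv s' Vj = 0 \<and> (\<exists>E. trace_inv E s' \<and> E 0 = 0 \<and>
      (\<forall>i j. i < j \<longrightarrow> j \<le> ?N \<longrightarrow> E j \<le> E i + sse ?x i j + lam))"
    have "wp kmeans ?Q s (1000 + 1300 * ?N)"
      by (rule wp_kmeans[where k = 0]) (auto simp: s_def)
    then obtain u s' E where u: "u \<le> 1000 + 1300 * ?N" and r: "run kmeans s u s'"
      and s': "nv s' Vj = 0" "trace_inv E s'" "E 0 = 0"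
        "\<And>i j. i < j \<Longrightarrow> j \<le> ?N \<Longrightarrow> E j \<le> E i + sse ?x i j + lam"
      unfolding wp_def by blast
    have code: "code_at ?P 0 (comp kmeans 0)" "code_at ?P L [Move 0 (vreg Vk), Halt]"
      unfolding kmeans_program_def L_def by (auto simp: code_at_def nth_append)
    have "pc ?c = 0" by (simp add: input_config_def)
    with comp_correct[OF r, of ?P ?c L] code \<open>represents s ?c\<close> obtain y where
      y: "reaches ?P (L * u) ?c y" "pc y = L" "represents s' y"
      by (auto simp: L_def)
    define k where "k = nv s' Vk"
    define z where "z = set_reg 0 (real k) y"
    have "reg y (vreg Vk) = real k" using y(3) unfolding represents_def k_def by blast
    then have "reaches ?P (Suc 0) y z"
      using code(2) y(2) by (intro reaches_exec) (auto simp: z_def intro: reaches_refl)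
    then have "reaches ?P (T ?N) ?c z"
      by (rule reaches_trans[OF y(1)]) (use u in \<open>simp add: T_def\<close>)
    moreover have "halted ?P z"
      using code(2) y(2) by (simp add: halted_def z_def set_reg_def)
    ultimately have "halts_within ?P ?c (T ?N) z"
      by (auto simp: halts_within_def reaches_def)
    moreover have k: "k \<le> ?N" "0 < k" and dec: "\<And>a b. a < b \<Longrightarrow> b < k \<Longrightarrow> ra s' PTS b < ra s' PTS a"
      and cost: "served s' 0 + lam * real k \<le> E ?N"
      using s'(1-3) N_pos by (auto simp: trace_inv_def k_def)
    have "mem z i = ra s' PTS i" if "i < k" for i
      using y(3) that k by (simp add: represents_def z_def set_reg_def)
    then have mem: "mem z ` {..<k} = centres s'"
      by (auto simp: centres_def k_def[symmetric])
    have "outputs z (k, centres s')"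
      using mem by (simp add: outputs_def z_def set_reg_def)
    moreover have "optimal_clustering xs lam (k, centres s')"
    proof -
      \<comment> \<open>Strict decrease makes the centres distinct, so that the set really has
        \<open>k\<close> elements, even for \<lambda> = 0.\<close>
      have "inj_on (ra s' PTS) {..<k}"
        by (intro linorder_inj_onI') (use dec in force)
      then have "card (centres s') = k"
        by (simp add: centres_def k_def[symmetric] card_image)
      then have "clustering (k, centres s')"
        using k by (simp add: clustering_def centres_def)
      moreover have "kmeans_cost xs lam (k, centres s') \<le> kmeans_cost xs lam (k', M)"
        if "clustering (k', M)" for k' M
      proof -
        have M: "finite M" "card M = k'" "M \<noteq> {}" using that by (auto simp: clustering_def)
        have "kmeans_cost xs lam (k, centres s') = served s' 0 + lam * real k"
          by (simp add: kmeans_cost_def served_def atLeast0LessThan)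
        also note cost
        also have "E ?N \<le> (\<Sum>l<?N. Min ((\<lambda>m. (?x l - m)\<^sup>2) ` M)) + lam * real (card M)"
          by (rule dp_le_cost[where N = ?N]) (use xs s' M sorted in auto)
        also have "\<dots> = kmeans_cost xs lam (k', M)"
          using M by (simp add: kmeans_cost_def)
        finally show ?thesis .
      qed
      ultimately show ?thesis
        unfolding optimal_clustering_def is_arg_min_def by (metis not_less surj_pair)
    qed
    ultimately show ?thesis by blast
  qed
  ultimately show ?thesis by blast
qed

end
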